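(* Let $\mathcal{L}\subset \mathbb{P}^{2}_{\mathbb{C}}$ be an arrangement of $d$ distinct lines whose only singular points are nodes and triple intersection points. If $\mathcal{L}$ is nearly free, then $d \in \{4,5,6,7,8\}$.
   Context: Let $S=\mathbb{C}[x,y,z]$ and let a line arrangement $\mathcal{L}$ of $d$ lines be given by a reduced defining polynomial $f\in S_d$ (the product of the linear forms of the lines). Let $J_f=\langle \partial_x f,\partial_y f,\partial_z f\rangle$ be the Jacobian ideal, $\mathfrak{m}=\langle x,y,z\rangle$, $I_f$ the saturation of $J_f$ with respect to $\mathfrak{m}$, and $N(f)=I_f/J_f$ (a graded $S$-module). The curve $f=0$ is called free if $N(f)=0$, and nearly free if $N(f)\neq 0$ and $\dim N(f)_k\le 1$ for every $k$. A node is a point lying on exactly two lines of the arrangement; a triple intersection point is a point lying on exactly three lines. *)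

theory Defs
  imports Complex_Main "HOL-Library.Poly_Mapping" "HOL-Library.Product_Plus"
begin

text \<open>Polynomials in S = C[x,y,z]: finitely supported coefficient functions on
exponent triples (a,b,c), standing for x^a y^b z^c; multiplication is convolution.\<close>

type_synonym mono3 = "nat \<times> nat \<times> nat"
type_synonym poly3 = "mono3 \<Rightarrow>\<^sub>0 complex"

definition tdeg :: "mono3 \<Rightarrow> nat" where
  "tdeg m = fst m + fst (snd m) + snd (snd m)"

definition var_x :: poly3 where "var_x = Poly_Mapping.single (1,0,0) 1"
definition var_y :: poly3 where "var_y = Poly_Mapping.single (0,1,0) 1"
definition var_z :: poly3 where "var_z = Poly_Mapping.single (0,0,1) 1"

definition cscale :: "complex \<Rightarrow> poly3 \<Rightarrow> poly3" where
  "cscale c p = Poly_Mapping.map (\<lambda>a. c * a) p"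

definition pd_x :: "poly3 \<Rightarrow> poly3" where
  "pd_x p = (\<Sum>m\<in>Poly_Mapping.keys p. case m of (a,b,c) \<Rightarrow>
      Poly_Mapping.single (a - 1, b, c) (of_nat a * Poly_Mapping.lookup p m))"
definition pd_y :: "poly3 \<Rightarrow> poly3" where
  "pd_y p = (\<Sum>m\<in>Poly_Mapping.keys p. case m of (a,b,c) \<Rightarrow>
      Poly_Mapping.single (a, b - 1, c) (of_nat b * Poly_Mapping.lookup p m))"
definition pd_z :: "poly3 \<Rightarrow> poly3" where
  "pd_z p = (\<Sum>m\<in>Poly_Mapping.keys p. case m of (a,b,c) \<Rightarrow>
      Poly_Mapping.single (a, b, c - 1) (of_nat c * Poly_Mapping.lookup p m))"

definition homog :: "nat \<Rightarrow> poly3 set" where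
  "homog k = {p. \<forall>m\<in>Poly_Mapping.keys p. tdeg m = k}"

definition jacobian_ideal :: "poly3 \<Rightarrow> poly3 set" where
  "jacobian_ideal f = {g1 * pd_x f + g2 * pd_y f + g3 * pd_z f | g1 g2 g3. True}"

text \<open>Saturation of an ideal J with respect to m = (x,y,z):
  {h. exists N with m^N h contained in J}; m^N is generated by the monomials of degree N.\<close>
definition saturation :: "poly3 set \<Rightarrow> poly3 set" where
  "saturation J = {h. \<exists>N. \<forall>m. tdeg m = N \<longrightarrow> Poly_Mapping.single m 1 * h \<in> J}"

definition sat_jacobian :: "poly3 \<Rightarrow> poly3 set" where
  "sat_jacobian f = saturation (jacobian_ideal f)"

text \<open>dim_C N(f)_k = dim (I_f)_k - dim (J_f)_k  (J_f \<subseteq> I_f).\<close>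
definition dimN :: "poly3 \<Rightarrow> nat \<Rightarrow> nat" where
  "dimN f k = vector_space.dim cscale (sat_jacobian f \<inter> homog k)
              - vector_space.dim cscale (jacobian_ideal f \<inter> homog k)"

definition nearly_free :: "poly3 \<Rightarrow> bool" where
  "nearly_free f \<longleftrightarrow> sat_jacobian f \<noteq> jacobian_ideal f \<and> (\<forall>k. dimN f k \<le> 1)"

text \<open>Line arrangements: the line i is {a x + b y + c z = 0} with (a,b,c) = v i.\<close>
type_synonym vec3 = "complex \<times> complex \<times> complex"

definition lin_form :: "vec3 \<Rightarrow> poly3" where
  "lin_form v = (case v of (a,b,c) \<Rightarrow>
     Poly_Mapping.single (1,0,0) a + Poly_Mapping.single (0,1,0) b + Poly_Mapping.single (0,0,1) c)"

definition eval_lin :: "vec3 \<Rightarrow> vec3 \<Rightarrow> complex" where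
  "eval_lin v p = (case v of (a,b,c) \<Rightarrow> case p of (x,y,z) \<Rightarrow> a*x + b*y + c*z)"

definition proportional :: "vec3 \<Rightarrow> vec3 \<Rightarrow> bool" where
  "proportional v w \<longleftrightarrow> (\<exists>t::complex. w = (t * fst v, t * fst (snd v), t * snd (snd v)))"

definition distinct_lines :: "nat \<Rightarrow> (nat \<Rightarrow> vec3) \<Rightarrow> bool" where
  "distinct_lines d v \<longleftrightarrow> (\<forall>i<d. v i \<noteq> 0) \<and>
     (\<forall>i<d. \<forall>j<d. i \<noteq> j \<longrightarrow> \<not> proportional (v i) (v j))"

definition arrangement_poly :: "nat \<Rightarrow> (nat \<Rightarrow> vec3) \<Rightarrow> poly3" where
  "arrangement_poly d v = (\<Prod>i<d. lin_form (v i))"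

text \<open>Number of lines through the projective point [p] (p \<noteq> 0).\<close>
definition mult_at :: "nat \<Rightarrow> (nat \<Rightarrow> vec3) \<Rightarrow> vec3 \<Rightarrow> nat" where
  "mult_at d v p = card {i. i < d \<and> eval_lin (v i) p = 0}"

definition only_nodes_triple :: "nat \<Rightarrow> (nat \<Rightarrow> vec3) \<Rightarrow> bool" where
  "only_nodes_triple d v \<longleftrightarrow> (\<forall>p. p \<noteq> 0 \<longrightarrow> 2 \<le> mult_at d v p \<longrightarrow> mult_at d v p \<in> {2,3})"

end

theory Submission
  imports Defs "HOL-Library.Product_Lexorder"
begin

text \<open>
Write $S_k$ for the forms of degree $k$, $f$ for the defining polynomial, $J_q$ for the Jacobian ideal
of $q$ and $\tau$ for the number of nodes plus four times the number of triple points.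

For a singular point $p$ let $q_p$ be the product of the lines through $p$ and $g_p$ that of the others.
Then $g_p^2 J_{q_p} \subseteq J_f$, and $g_p$ does not vanish at $p$; hence the intersection of the
$J_{q_p}$ lies in $I_f$. Since $J_{q_p}$ has codimension at most 1 (node) or 4 (triple point) in $S_k$,
near freeness yields $\dim S_k \le \tau + 1 + 3 \dim S_{k-d+1}$ for all $k$. Taking $k$ near $3d/2$
and counting pairs of lines gives $d \le 10$, no nodes if $d = 10$, and zero or three nodes if $d = 9$.

For $d = 10$ each line would carry nine other lines in pairs, which is impossible. For $d = 9$ the
incidences are those of AG(2,3), possibly with one concurrent triple (the three nodes) missing; solving them forces
the dual Hesse arrangement $(a^3-b^3)(b^3-c^3)(c^3-a^3)$. So no triple is missing, and
this arrangement is free by Saito's criterion, as are all arrangements with $d \le 3$.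
\<close>

text \<open>The numbers 1 and 4 are the Tjurina numbers of a node and of an ordinary triple point,
  so \<tau> is the value of dim S_k - dim (I_f)_k for large k. Only the inequality \<le> \<tau> is
  used, and it holds in every degree: each singular point imposes at most its Tjurina number of
  linear conditions, however these depend on each other. For k \<ge> d - 1 the difference dim S_k -
  3 dim S_(k-d+1) is a concave quadratic in k with its maximum at k = 3d/2 - 3, whence the choice of
  k. A numerical bound of this kind cannot exclude d = 9, since the dual Hesse arrangement, being
  free, satisfies it too; this is why nine lines need both a classification and a proof of freeness.
  Three nodes on nine lines form a triangle by parity: a line meets eight others and its triple
  points use them up two at a time, so it carries an even number of nodes. Declaring this triangle
  to be a block completes the incidences to a Steiner triple system, and the equations then make its
  three sides concurrent, a contradiction.\<close>

section \<open>Polynomials in three variables\<close>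

text \<open>The lexicographic order on exponent triples makes \<^typ>\<open>poly3\<close> an integral domain.\<close>
instance prod :: (linordered_cancel_ab_semigroup_add, linordered_cancel_ab_semigroup_add) ordered_cancel_ab_semigroup_add
  by standard (auto simp: less_eq_prod_def less_prod_def)

instance prod :: ("{linordered_cancel_ab_semigroup_add, ordered_cancel_comm_monoid_add}",
   "{linordered_cancel_ab_semigroup_add, ordered_cancel_comm_monoid_add}") ordered_cancel_comm_monoid_add ..

instance prod :: (linordered_cancel_ab_semigroup_add, linordered_cancel_ab_semigroup_add) linordered_cancel_ab_semigroup_add ..

text \<open>Constants are embedded as ring elements, so that scalar multiplication becomes ordinary
  multiplication and ring normalisation applies to it.\<close>

definition C3 :: "complex \<Rightarrow> poly3" where "C3 c = Poly_Mapping.single 0 c"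

lemma C3_add: "C3 (a + b) = C3 a + C3 b" by (simp add: C3_def single_add)
lemma C3_diff: "C3 (a - b) = C3 a - C3 b" by (simp add: C3_def single_diff)
lemma C3_uminus: "C3 (- a) = - C3 a" by (simp add: C3_def single_uminus)
lemma C3_mult: "C3 (a * b) = C3 a * C3 b" by (simp add: C3_def mult_single)
lemma C3_0 [simp]: "C3 0 = 0" by (simp add: C3_def)
lemma C3_1 [simp]: "C3 1 = 1" by (simp add: C3_def)
lemma C3_numeral [simp]: "C3 (numeral n) = numeral n" by (simp add: C3_def)
lemma C3_of_nat [simp]: "C3 (of_nat n) = of_nat n" by (simp add: C3_def)
lemma C3_power: "C3 (a ^ n) = C3 a ^ n" by (induction n) (simp_all add: C3_mult)
lemmas C3_hom = C3_add C3_diff C3_uminus C3_mult C3_power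

lemma C3_inject [simp]: "C3 a = C3 b \<longleftrightarrow> a = b"
  by (metis C3_def lookup_single_eq)
lemma C3_eq_0 [simp]: "C3 a = 0 \<longleftrightarrow> a = 0"
  using C3_inject[of a 0] by (simp del: C3_inject)

lemma C3_inverse: "a \<noteq> 0 \<Longrightarrow> C3 (inverse a) * C3 a = 1"
  by (simp add: C3_mult[symmetric])

lemma cscale_eq: "cscale c p = Poly_Mapping.single 0 c * p"
  unfolding cscale_def by (rule mult_map_scale_conv_mult)

lemma poly_mapping_sum_single: "p = (\<Sum>m\<in>Poly_Mapping.keys p. Poly_Mapping.single m (Poly_Mapping.lookup p m))"
  by (rule poly_mapping_eqI)
     (auto simp: lookup_sum lookup_single when_def sum.delta in_keys_iff intro!: sum.neutral)

lemma poly_mapping_induct [case_names zero add single]: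
  fixes p :: "'a \<Rightarrow>\<^sub>0 'b::comm_monoid_add"
  assumes "P 0" "\<And>p q. P p \<Longrightarrow> P q \<Longrightarrow> P (p + q)" "\<And>m c. P (Poly_Mapping.single m c)"
  shows "P p"
proof -
  have "P (\<Sum>m\<in>A. Poly_Mapping.single m (Poly_Mapping.lookup p m))" if "finite A" for A
    using that by (induction A) (auto intro: assms)
  from this[of "Poly_Mapping.keys p"] show ?thesis
    using poly_mapping_sum_single[of p] by simp
qed

section \<open>Partial derivatives and the Euler relation\<close>

lemma pd_x_add: "pd_x (p + q) = pd_x p + pd_x q"
  unfolding pd_x_def
  using setsum_keys_plus_distrib[of "\<lambda>m e. case m of (a,b,c) \<Rightarrow> Poly_Mapping.single (a - 1, b, c) (of_nat a * e)" p q]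
  by (simp add: split_def single_add distrib_left)
lemma pd_y_add: "pd_y (p + q) = pd_y p + pd_y q"
  unfolding pd_y_def
  using setsum_keys_plus_distrib[of "\<lambda>m e. case m of (a,b,c) \<Rightarrow> Poly_Mapping.single (a, b - 1, c) (of_nat b * e)" p q]
  by (simp add: split_def single_add distrib_left)
lemma pd_z_add: "pd_z (p + q) = pd_z p + pd_z q"
  unfolding pd_z_def
  using setsum_keys_plus_distrib[of "\<lambda>m e. case m of (a,b,c) \<Rightarrow> Poly_Mapping.single (a, b, c - 1) (of_nat c * e)" p q]
  by (simp add: split_def single_add distrib_left)

lemma pd_single:
  "pd_x (Poly_Mapping.single (a,b,c) e) = Poly_Mapping.single (a - 1, b, c) (of_nat a * e)"
  "pd_y (Poly_Mapping.single (a,b,c) e) = Poly_Mapping.single (a, b - 1, c) (of_nat b * e)"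
  "pd_z (Poly_Mapping.single (a,b,c) e) = Poly_Mapping.single (a, b, c - 1) (of_nat c * e)"
  by (simp_all add: pd_x_def pd_y_def pd_z_def)

lemma pd_zero [simp]: "pd_x 0 = 0" "pd_y 0 = 0" "pd_z 0 = 0"
  by (simp_all add: pd_x_def pd_y_def pd_z_def)

definition derivation3 :: "(poly3 \<Rightarrow> poly3) \<Rightarrow> bool" where
  "derivation3 D \<longleftrightarrow> (\<forall>p q. D (p + q) = D p + D q) \<and> (\<forall>p q. D (p * q) = p * D q + q * D p) \<and> (\<forall>c. D (C3 c) = 0)"

text \<open>Both sides are biadditive in p and q, so pairs of monomials suffice.\<close>

lemma leibniz_from_single:
  assumes "\<And>p q. D (p + q) = D p + (D q :: poly3)" "D 0 = 0"
    and "\<And>m n a b. D (Poly_Mapping.single m a * Poly_Mapping.single n b) =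
      Poly_Mapping.single m a * D (Poly_Mapping.single n b) + Poly_Mapping.single n b * D (Poly_Mapping.single m a)"
  shows "D (p * q) = p * D q + q * D p"
proof (induction p rule: poly_mapping_induct)
  case (single m a)
  show ?case by (induction q rule: poly_mapping_induct) (simp_all add: assms algebra_simps)
qed (simp_all add: assms algebra_simps)

lemma derivation_pd: "derivation3 pd_x" "derivation3 pd_y" "derivation3 pd_z"
proof -
  have "pd_x (p * q) = p * pd_x q + q * pd_x p" for p q
  proof (rule leibniz_from_single)
    fix m n :: mono3 and a b :: complex
    obtain i j k i' j' k' where "m = (i,j,k)" "n = (i',j',k')" by (metis prod_cases3)
    then show "pd_x (Poly_Mapping.single m a * Poly_Mapping.single n b) =
      Poly_Mapping.single m a * pd_x (Poly_Mapping.single n b) + Poly_Mapping.single n b * pd_x (Poly_Mapping.single m a)"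
      \<comment> \<open>Differentiation lowers exponents by truncated subtraction. At exponent 0 the
        coefficient vanishes, hence the case split.\<close>
      by (cases i; cases i') (simp_all add: mult_single pd_single single_add[symmetric] algebra_simps)
  qed (simp_all add: pd_x_add)
  then show "derivation3 pd_x"
    by (simp add: derivation3_def C3_def pd_x_add zero_prod_def pd_single)
  have "pd_y (p * q) = p * pd_y q + q * pd_y p" for p q
  proof (rule leibniz_from_single)
    fix m n :: mono3 and a b :: complex
    obtain i j k i' j' k' where "m = (i,j,k)" "n = (i',j',k')" by (metis prod_cases3)
    then show "pd_y (Poly_Mapping.single m a * Poly_Mapping.single n b) =
      Poly_Mapping.single m a * pd_y (Poly_Mapping.single n b) + Poly_Mapping.single n b * pd_y (Poly_Mapping.single m a)"
      by (cases j; cases j') (simp_all add: mult_single pd_single single_add[symmetric] algebra_simps)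
  qed (simp_all add: pd_y_add)
  then show "derivation3 pd_y"
    by (simp add: derivation3_def C3_def pd_y_add zero_prod_def pd_single)
  have "pd_z (p * q) = p * pd_z q + q * pd_z p" for p q
  proof (rule leibniz_from_single)
    fix m n :: mono3 and a b :: complex
    obtain i j k i' j' k' where "m = (i,j,k)" "n = (i',j',k')" by (metis prod_cases3)
    then show "pd_z (Poly_Mapping.single m a * Poly_Mapping.single n b) =
      Poly_Mapping.single m a * pd_z (Poly_Mapping.single n b) + Poly_Mapping.single n b * pd_z (Poly_Mapping.single m a)"
      by (cases k; cases k') (simp_all add: mult_single pd_single single_add[symmetric] algebra_simps)
  qed (simp_all add: pd_z_add)
  then show "derivation3 pd_z"
    by (simp add: derivation3_def C3_def pd_z_add zero_prod_def pd_single)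
qed

abbreviation xc :: "vec3 \<Rightarrow> complex" where "xc v \<equiv> fst v"
abbreviation yc :: "vec3 \<Rightarrow> complex" where "yc v \<equiv> fst (snd v)"
abbreviation zc :: "vec3 \<Rightarrow> complex" where "zc v \<equiv> snd (snd v)"

lemma lin_form_eq: "lin_form v = C3 (xc v) * var_x + C3 (yc v) * var_y + C3 (zc v) * var_z"
  by (simp add: lin_form_def C3_def var_x_def var_y_def var_z_def mult_single split_def)

lemma derivation3D:
  assumes "derivation3 D"
  shows "D (p + q) = D p + D q" "D (p * q) = p * D q + q * D p" "D (C3 c) = 0" "D 1 = 0" "D 0 = 0" "D (C3 c * p) = C3 c * D p"
proof -
  show *: "D (p + q) = D p + D q" "D (p * q) = p * D q + q * D p" "D (C3 c) = 0" for p q c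
    using assms by (auto simp: derivation3_def)
  show "D 1 = 0" "D 0 = 0" using *(3)[of 1] *(3)[of 0] by simp_all
  show "D (C3 c * p) = C3 c * D p" by (simp add: *)
qed

lemma pd_var:
  "pd_x var_x = 1" "pd_x var_y = 0" "pd_x var_z = 0"
  "pd_y var_x = 0" "pd_y var_y = 1" "pd_y var_z = 0"
  "pd_z var_x = 0" "pd_z var_y = 0" "pd_z var_z = 1"
  unfolding var_x_def var_y_def var_z_def pd_single by (simp_all flip: zero_prod_def)

lemma pd_lin_form:
  "pd_x (lin_form v) = C3 (xc v)" "pd_y (lin_form v) = C3 (yc v)" "pd_z (lin_form v) = C3 (zc v)"
  by (simp_all add: lin_form_eq derivation3D[OF derivation_pd(1)] derivation3D[OF derivation_pd(2)]
      derivation3D[OF derivation_pd(3)] pd_var)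

definition euler3 :: "poly3 \<Rightarrow> poly3" where
  "euler3 p = var_x * pd_x p + var_y * pd_y p + var_z * pd_z p"

lemma euler3_mult: "euler3 (p * q) = p * euler3 q + q * euler3 p"
  by (simp add: euler3_def derivation3D[OF derivation_pd(1)] derivation3D[OF derivation_pd(2)]
      derivation3D[OF derivation_pd(3)] algebra_simps)

text \<open>A linear form is an eigenvector of the Euler derivation with eigenvalue 1, and
  eigenvalues add under products.\<close>

lemma euler3_prod_lin_form:
  assumes "finite F"
  shows "euler3 (\<Prod>i\<in>F. lin_form (v i)) = of_nat (card F) * (\<Prod>i\<in>F. lin_form (v i))"
  using assms
proof (induction F)
  case empty
  then show ?case by (simp add: euler3_def derivation3D[OF derivation_pd(1)] derivation3D[OF derivation_pd(2)]
      derivation3D[OF derivation_pd(3)])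
next
  case (insert i F)
  have "euler3 (lin_form (v i)) = lin_form (v i)"
    unfolding euler3_def pd_lin_form by (simp add: lin_form_eq algebra_simps)
  then show ?case using insert by (simp add: euler3_mult algebra_simps)
qed

section \<open>From local conditions to the saturation\<close>

definition ideal3 :: "poly3 set \<Rightarrow> bool" where
  "ideal3 A \<longleftrightarrow> 0 \<in> A \<and> (\<forall>a\<in>A. \<forall>b\<in>A. a + b \<in> A) \<and> (\<forall>a\<in>A. \<forall>r. r * a \<in> A)"

lemma ideal3D:
  assumes "ideal3 A"
  shows "0 \<in> A" "a \<in> A \<Longrightarrow> b \<in> A \<Longrightarrow> a + b \<in> A" "a \<in> A \<Longrightarrow> r * a \<in> A" "a \<in> A \<Longrightarrow> a * r \<in> A"
    "a \<in> A \<Longrightarrow> b \<in> A \<Longrightarrow> a - b \<in> A"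
proof -
  show *: "0 \<in> A" "a \<in> A \<Longrightarrow> b \<in> A \<Longrightarrow> a + b \<in> A" "a \<in> A \<Longrightarrow> r * a \<in> A" for a b r
    using assms by (auto simp: ideal3_def)
  show "a \<in> A \<Longrightarrow> a * r \<in> A" using *(3)[of a r] by (simp add: mult.commute)
  show "a \<in> A \<Longrightarrow> b \<in> A \<Longrightarrow> a - b \<in> A" using *(2)[of a "- 1 * b"] *(3)[of b "- 1"] by simp
qed

lemma ideal3_jacobian: "ideal3 (jacobian_ideal f)"
  unfolding ideal3_def jacobian_ideal_def
proof (intro conjI ballI allI)
  show "0 \<in> {g1 * pd_x f + g2 * pd_y f + g3 * pd_z f |g1 g2 g3. True}"
    by (auto intro!: exI[of _ 0])
next
  fix a b assume "a \<in> {g1 * pd_x f + g2 * pd_y f + g3 * pd_z f |g1 g2 g3. True}"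
    "b \<in> {g1 * pd_x f + g2 * pd_y f + g3 * pd_z f |g1 g2 g3. True}"
  then obtain g1 g2 g3 h1 h2 h3 where "a = g1 * pd_x f + g2 * pd_y f + g3 * pd_z f"
    "b = h1 * pd_x f + h2 * pd_y f + h3 * pd_z f" by blast
  then have "a + b = (g1 + h1) * pd_x f + (g2 + h2) * pd_y f + (g3 + h3) * pd_z f"
    by (simp add: algebra_simps)
  then show "a + b \<in> {g1 * pd_x f + g2 * pd_y f + g3 * pd_z f |g1 g2 g3. True}" by blast
next
  fix a r assume "a \<in> {g1 * pd_x f + g2 * pd_y f + g3 * pd_z f |g1 g2 g3. True}"
  then obtain g1 g2 g3 where "a = g1 * pd_x f + g2 * pd_y f + g3 * pd_z f" by blast
  then have "r * a = (r * g1) * pd_x f + (r * g2) * pd_y f + (r * g3) * pd_z f"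
    by (simp add: algebra_simps)
  then show "r * a \<in> {g1 * pd_x f + g2 * pd_y f + g3 * pd_z f |g1 g2 g3. True}" by blast
qed

lemma jacobian_idealI: "g1 * pd_x f + g2 * pd_y f + g3 * pd_z f \<in> jacobian_ideal f"
  unfolding jacobian_ideal_def by blast

lemma pd_in_jacobian:
  "pd_x f \<in> jacobian_ideal f" "pd_y f \<in> jacobian_ideal f" "pd_z f \<in> jacobian_ideal f"
  using jacobian_idealI[of 1 f 0 0] jacobian_idealI[of 0 f 1 0] jacobian_idealI[of 0 f 0 1] by simp_all

lemma ideal3_colon: "ideal3 A \<Longrightarrow> ideal3 {u. u * h \<in> A}"
  by (auto simp: ideal3_def algebra_simps)

text \<open>This is the ideal A + (a). Working modulo a is expressed by membership in it, so that
  quotient rings never appear.\<close>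

definition ideal_join :: "poly3 set \<Rightarrow> poly3 \<Rightarrow> poly3 set" where
  "ideal_join A a = {u + w * a | u w. u \<in> A}"

lemma ideal_join_iff: "p \<in> ideal_join A a \<longleftrightarrow> (\<exists>w. p - w * a \<in> A)"
proof
  assume "p \<in> ideal_join A a"
  then obtain u w where "p = u + w * a" "u \<in> A" unfolding ideal_join_def by blast
  then have "p - w * a \<in> A" by simp
  then show "\<exists>w. p - w * a \<in> A" ..
next
  assume "\<exists>w. p - w * a \<in> A"
  then obtain w where "p - w * a \<in> A" ..
  moreover have "p = (p - w * a) + w * a" by simp
  ultimately show "p \<in> ideal_join A a" unfolding ideal_join_def by blast
qed

lemma ideal3_join: assumes "ideal3 A" shows "ideal3 (ideal_join A a)"
  unfolding ideal3_def
proof (intro conjI ballI allI)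
  show "0 \<in> ideal_join A a" unfolding ideal_join_iff using ideal3D(1)[OF assms] by (auto intro!: exI[of _ 0])
next
  fix p q assume "p \<in> ideal_join A a" "q \<in> ideal_join A a"
  then obtain w1 w2 where "p - w1 * a \<in> A" "q - w2 * a \<in> A" unfolding ideal_join_iff by blast
  from ideal3D(2)[OF assms this] have "(p + q) - (w1 + w2) * a \<in> A" by (simp add: algebra_simps)
  then show "p + q \<in> ideal_join A a" unfolding ideal_join_iff ..
next
  fix p r assume "p \<in> ideal_join A a"
  then obtain w where "p - w * a \<in> A" unfolding ideal_join_iff by blast
  from ideal3D(3)[OF assms this, of r] have "r * p - (r * w) * a \<in> A" by (simp add: algebra_simps)
  then show "r * p \<in> ideal_join A a" unfolding ideal_join_iff ..
qed

lemma ideal_join_gen: "ideal3 A \<Longrightarrow> a \<in> ideal_join A a"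
  unfolding ideal_join_iff using ideal3D(1)[of A] by (auto intro!: exI[of _ 1])
lemma ideal_join_super: "A \<subseteq> ideal_join A a"
  by (auto simp: ideal_join_iff intro!: exI[of _ 0])
lemma ideal_join_absorb: assumes "ideal3 A" "a \<in> A" shows "ideal_join A a = A"
proof
  show "ideal_join A a \<subseteq> A" using assms unfolding ideal_join_def by (auto intro: ideal3D)
qed (rule ideal_join_super)

text \<open>\<open>irrelevant_in A\<close>: some power of the ideal $(x,y,z)$ is contained in \<open>A\<close>.\<close>
definition irrelevant_in :: "poly3 set \<Rightarrow> bool" where
  "irrelevant_in A \<longleftrightarrow> (\<exists>N. \<forall>m. tdeg m = N \<longrightarrow> Poly_Mapping.single m 1 \<in> A)"

lemma saturation_iff: "h \<in> saturation J \<longleftrightarrow> irrelevant_in {u. u * h \<in> J}"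
  by (simp add: saturation_def irrelevant_in_def)

lemma tdeg_add: "tdeg (m + n) = tdeg m + tdeg n"
  by (simp add: tdeg_def)

lemma tdeg_split:
  assumes "tdeg m = M + N"
  obtains m1 m2 where "m = m1 + m2" "tdeg m1 = M" "tdeg m2 = N"
proof -
  obtain a b c where m: "m = (a,b,c)" by (metis prod_cases3)
  \<comment> \<open>The factor of degree M is filled greedily, exhausting one exponent before the
    next.\<close>
  define a1 where "a1 = min a M"
  define b1 where "b1 = min b (M - a1)"
  define c1 where "c1 = M - a1 - b1"
  have "m = (a1,b1,c1) + (a - a1, b - b1, c - c1)" "tdeg (a1,b1,c1) = M" "tdeg (a - a1, b - b1, c - c1) = N"
    using assms by (auto simp: m tdeg_def a1_def b1_def c1_def)
  then show ?thesis by (rule that)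
qed

text \<open>The product of A + (a) and A + (b) lies in A + (ab), and every monomial of degree M + N
  splits into factors of degrees M and N.\<close>

lemma irrelevant_in_join_mult:
  assumes A: "ideal3 A" and "irrelevant_in (ideal_join A a)" "irrelevant_in (ideal_join A b)"
  shows "irrelevant_in (ideal_join A (a * b))"
proof -
  obtain M N where M: "\<And>m. tdeg m = M \<Longrightarrow> Poly_Mapping.single m 1 \<in> ideal_join A a"
    and N: "\<And>m. tdeg m = N \<Longrightarrow> Poly_Mapping.single m 1 \<in> ideal_join A b"
    using assms unfolding irrelevant_in_def by metis
  have "Poly_Mapping.single m 1 \<in> ideal_join A (a * b)" if m: "tdeg m = M + N" for m
  proof -
    from m obtain m1 m2 where mm: "m = m1 + m2" "tdeg m1 = M" "tdeg m2 = N" by (rule tdeg_split)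
    from M[OF mm(2)] obtain u1 w1 where 1: "Poly_Mapping.single m1 1 = u1 + w1 * a" "u1 \<in> A"
      unfolding ideal_join_def by blast
    from N[OF mm(3)] obtain u2 w2 where 2: "Poly_Mapping.single m2 1 = u2 + w2 * b" "u2 \<in> A"
      unfolding ideal_join_def by blast
    have "Poly_Mapping.single m 1 = Poly_Mapping.single m1 1 * Poly_Mapping.single m2 (1::complex)"
      by (simp add: mult_single mm)
    also have "\<dots> = ((u2 + w2 * b) * u1 + w1 * a * u2) + (w1 * w2) * (a * b)"
      by (simp add: 1 2 algebra_simps)
    finally show ?thesis unfolding ideal_join_def
      using ideal3D(2)[OF A ideal3D(3)[OF A 1(2)] ideal3D(3)[OF A 2(2)]] by blast
  qed
  then show ?thesis unfolding irrelevant_in_def by blast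
qed

lemma irrelevant_in_join_prod:
  assumes A: "ideal3 A" and "finite F" "\<And>i. i \<in> F \<Longrightarrow> irrelevant_in (ideal_join A (l i))"
  shows "irrelevant_in (ideal_join A (\<Prod>i\<in>F. l i))"
  using assms(2,3)
proof (induction F)
  case empty
  have "1 \<in> ideal_join A 1" using ideal_join_gen[OF A] .
  then have "r * 1 \<in> ideal_join A 1" for r using ideal3D(3)[OF ideal3_join[OF A]] by blast
  then show ?case by (simp add: irrelevant_in_def)
next
  case (insert i F)
  then show ?case using irrelevant_in_join_mult[OF A] by simp
qed

lemma irrelevant_in_vars:
  assumes A: "ideal3 A" and "var_x \<in> A" "var_y \<in> A" "var_z \<in> A"
  shows "irrelevant_in A"
proof -
  have "Poly_Mapping.single m 1 \<in> A" if "tdeg m = 1" for m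
  proof -
    from that have "m = (1,0,0) \<or> m = (0,1,0) \<or> m = (0,0,1)"
      by (cases m) (auto simp: tdeg_def)
    then show ?thesis using assms(2-4) by (auto simp: var_x_def var_y_def var_z_def)
  qed
  then show ?thesis unfolding irrelevant_in_def by blast
qed

section \<open>Determinants and linear forms without a common zero\<close>

definition det3 :: "vec3 \<Rightarrow> vec3 \<Rightarrow> vec3 \<Rightarrow> complex" where
  "det3 u v w = xc u * (yc v * zc w - zc v * yc w) + yc u * (zc v * xc w - xc v * zc w)
     + zc u * (xc v * yc w - yc v * xc w)"

text \<open>For two distinct lines this is their point of intersection.\<close>

definition cross :: "vec3 \<Rightarrow> vec3 \<Rightarrow> vec3" where
  "cross v w = (yc v * zc w - zc v * yc w, zc v * xc w - xc v * zc w, xc v * yc w - yc v * xc w)"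

text \<open>Cramer's rule with the determinant cleared; the cross products form the adjugate
  matrix.\<close>

lemma cramer_var:
  "C3 (det3 u v w) * var_x = C3 (xc (cross v w)) * lin_form u + C3 (xc (cross w u)) * lin_form v + C3 (xc (cross u v)) * lin_form w"
  "C3 (det3 u v w) * var_y = C3 (yc (cross v w)) * lin_form u + C3 (yc (cross w u)) * lin_form v + C3 (yc (cross u v)) * lin_form w"
  "C3 (det3 u v w) * var_z = C3 (zc (cross v w)) * lin_form u + C3 (zc (cross w u)) * lin_form v + C3 (zc (cross u v)) * lin_form w"
  by (simp_all add: det3_def cross_def lin_form_eq C3_hom algebra_simps)

lemma ideal3_C3_cancel:
  assumes "ideal3 A" "C3 c * p \<in> A" "c \<noteq> 0"
  shows "p \<in> A"
  using ideal3D(3)[OF assms(1,2), of "C3 (inverse c)"] assms(3)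
  by (simp add: mult.assoc[symmetric] C3_inverse)

lemma irrelevant_in_three_lines:
  assumes A: "ideal3 A" and "lin_form u \<in> A" "lin_form v \<in> A" "lin_form w \<in> A" and d: "det3 u v w \<noteq> 0"
  shows "irrelevant_in A"
proof (rule irrelevant_in_vars[OF A])
  have "C3 (det3 u v w) * var_x \<in> A" "C3 (det3 u v w) * var_y \<in> A" "C3 (det3 u v w) * var_z \<in> A"
    unfolding cramer_var by (intro ideal3D(2,3)[OF A] assms)+
  then show "var_x \<in> A" "var_y \<in> A" "var_z \<in> A" using ideal3_C3_cancel[OF A _ d] by auto
qed

text \<open>Euler's relation writes \<open>card F\<close> times the product through its partial
  derivatives, and \<open>card F\<close> is invertible in the complex numbers.\<close>

lemma prod_lin_form_in_jacobian:
  assumes "finite F" "F \<noteq> {}"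
  shows "(\<Prod>i\<in>F. lin_form (v i)) \<in> jacobian_ideal (\<Prod>i\<in>F. lin_form (v i))" (is "?f \<in> _")
proof (rule ideal3_C3_cancel[OF ideal3_jacobian])
  show "of_nat (card F) \<noteq> (0::complex)" using assms by simp
  have "C3 (of_nat (card F)) * ?f = euler3 ?f" using euler3_prod_lin_form[OF assms(1)] by simp
  also have "\<dots> \<in> jacobian_ideal ?f" unfolding euler3_def by (rule jacobian_idealI)
  finally show "C3 (of_nat (card F)) * ?f \<in> jacobian_ideal ?f" .
qed

text \<open>This is the quotient rule: for q = f/g one has g^2 Dq = g Df - f Dg, and both terms lie
  in the Jacobian ideal of f.\<close>

lemma jacobian_mult_square:
  assumes "f = q * g" "f \<in> jacobian_ideal f" "h \<in> jacobian_ideal q"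
  shows "g\<^sup>2 * h \<in> jacobian_ideal f"
proof -
  have *: "g\<^sup>2 * D q \<in> jacobian_ideal f" if D: "derivation3 D" "D f \<in> jacobian_ideal f" for D
  proof -
    have "g * D f - D g * f \<in> jacobian_ideal f" by (intro ideal3D[OF ideal3_jacobian] D assms(2))
    also have "g * D f - D g * f = g\<^sup>2 * D q"
      by (simp add: assms(1) derivation3D[OF D(1)] power2_eq_square algebra_simps)
    finally show ?thesis .
  qed
  from assms(3) obtain g1 g2 g3 where "h = g1 * pd_x q + g2 * pd_y q + g3 * pd_z q"
    unfolding jacobian_ideal_def by blast
  then have "g\<^sup>2 * h = g1 * (g\<^sup>2 * pd_x q) + g2 * (g\<^sup>2 * pd_y q) + g3 * (g\<^sup>2 * pd_z q)"
    by (simp add: algebra_simps)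
  also have "\<dots> \<in> jacobian_ideal f"
    by (intro ideal3D(2,3)[OF ideal3_jacobian] * derivation_pd pd_in_jacobian)
  finally show ?thesis .
qed

text \<open>Modulo the form l of line i, a derivative Df of the product equals D(l) times the
  cofactor, and some partial derivative of l is a nonzero constant.\<close>

lemma cofactor_in_join:
  assumes "v i \<noteq> 0" "finite F" "i \<in> F"
  shows "(\<Prod>j\<in>F-{i}. lin_form (v j)) \<in> ideal_join (jacobian_ideal (\<Prod>j\<in>F. lin_form (v j))) (lin_form (v i))"
    (is "?g \<in> ?J")
proof -
  let ?f = "\<Prod>j\<in>F. lin_form (v j)"
  have f: "?f = lin_form (v i) * ?g" using assms by (simp add: prod.remove)
  have J: "ideal3 ?J" by (intro ideal3_join ideal3_jacobian)
  have *: "c = 0 \<or> ?g \<in> ?J" if D: "derivation3 D" "D ?f \<in> jacobian_ideal ?f" "D (lin_form (v i)) = C3 c" for D c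
  proof (cases "c = 0")
    case False
    have "D ?f - lin_form (v i) * D ?g \<in> ?J"
      by (intro ideal3D[OF J] ideal_join_gen ideal3_jacobian) (use D ideal_join_super in blast)
    also have "D ?f - lin_form (v i) * D ?g = C3 c * ?g"
      by (subst f) (simp add: derivation3D(2)[OF D(1)] D(3))
    finally show ?thesis using ideal3_C3_cancel[OF J] False by blast
  qed simp
  have "xc (v i) = 0 \<or> ?g \<in> ?J" "yc (v i) = 0 \<or> ?g \<in> ?J" "zc (v i) = 0 \<or> ?g \<in> ?J"
    by (rule *[OF derivation_pd(1) pd_in_jacobian(1) pd_lin_form(1)],
        rule *[OF derivation_pd(2) pd_in_jacobian(2) pd_lin_form(2)],
        rule *[OF derivation_pd(3) pd_in_jacobian(3) pd_lin_form(3)])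
  moreover have "\<not> (xc (v i) = 0 \<and> yc (v i) = 0 \<and> zc (v i) = 0)"
    using assms(1) by (auto simp: prod_eq_iff)
  ultimately show ?thesis by blast
qed

text \<open>The ideal $A$ of all $u$ with $uh \in J_f$ contains $J_f$ and every $g_p^2$. A product lemma for
powers of $(x,y,z)$ replaces the Nullstellensatz: modulo two lines $l_i, l_j$ the square $g_p^2$
is a product of further lines, modulo one line $l_i$ the product of the other lines lies in $A$, and finally $f \in A$.\<close>
theorem local_to_saturation:
  fixes v :: "nat \<Rightarrow> vec3"
  assumes F: "finite F" "F \<noteq> {}" and nz: "\<And>i. i \<in> F \<Longrightarrow> v i \<noteq> 0"
    and h: "\<And>i j. i \<in> F \<Longrightarrow> j \<in> F \<Longrightarrow> i \<noteq> j \<Longrightarrow>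
      h \<in> jacobian_ideal (\<Prod>k\<in>{k\<in>F. det3 (v i) (v j) (v k) = 0}. lin_form (v k))"
  shows "h \<in> sat_jacobian (\<Prod>i\<in>F. lin_form (v i))"
proof -
  define f where "f = (\<Prod>i\<in>F. lin_form (v i))"
  define A where "A = {u. u * h \<in> jacobian_ideal f}"
  have A: "ideal3 A" unfolding A_def by (intro ideal3_colon ideal3_jacobian)
  have JA: "jacobian_ideal f \<subseteq> A" unfolding A_def using ideal3D(4)[OF ideal3_jacobian] by blast
  have fJ: "f \<in> jacobian_ideal f" unfolding f_def by (rule prod_lin_form_in_jacobian[OF F])
  have pair: "irrelevant_in (ideal_join (ideal_join A (lin_form (v i))) (lin_form (v j)))"
    if ij: "i \<in> F" "j \<in> F" "i \<noteq> j" for i j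
  proof -
    let ?A = "ideal_join (ideal_join A (lin_form (v i))) (lin_form (v j))"
    let ?B = "{k\<in>F. det3 (v i) (v j) (v k) = 0}"
    let ?g = "\<Prod>k\<in>F-?B. lin_form (v k)"
    have A': "ideal3 ?A" by (intro ideal3_join A)
    have "irrelevant_in (ideal_join ?A (lin_form (v k)))" if k: "k \<in> F - ?B" for k
    proof (rule irrelevant_in_three_lines[of _ "v i" "v j" "v k"])
      show "ideal3 (ideal_join ?A (lin_form (v k)))" by (intro ideal3_join A)
      show "lin_form (v k) \<in> ideal_join ?A (lin_form (v k))" by (intro ideal_join_gen A')
      show "lin_form (v j) \<in> ideal_join ?A (lin_form (v k))"
        using ideal_join_gen[OF ideal3_join[OF A]] ideal_join_super by blast
      show "lin_form (v i) \<in> ideal_join ?A (lin_form (v k))"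
        using ideal_join_gen[OF A] ideal_join_super by blast
      show "det3 (v i) (v j) (v k) \<noteq> 0" using k by blast
    qed
    then have "irrelevant_in (ideal_join ?A ?g)"
      by (intro irrelevant_in_join_prod A') (use F in auto)
    then have "irrelevant_in (ideal_join ?A (?g * ?g))" by (intro irrelevant_in_join_mult A')
    moreover have "?g * ?g \<in> A"
    proof -
      have "f = (\<Prod>k\<in>?B. lin_form (v k)) * ?g" unfolding f_def
        using prod.subset_diff[of ?B F "\<lambda>k. lin_form (v k)"] F by (simp add: mult.commute)
      from jacobian_mult_square[OF this fJ h[OF ij]] show ?thesis
        by (simp add: A_def power2_eq_square)
    qed
    then have "?g * ?g \<in> ?A" using ideal_join_super by blast
    ultimately show ?thesis using ideal_join_absorb[OF A'] by simp
  qed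
  have line: "irrelevant_in (ideal_join A (lin_form (v i)))" if i: "i \<in> F" for i
  proof -
    let ?A = "ideal_join A (lin_form (v i))"
    have A': "ideal3 ?A" by (intro ideal3_join A)
    have "irrelevant_in (ideal_join ?A (\<Prod>j\<in>F-{i}. lin_form (v j)))"
      by (intro irrelevant_in_join_prod A' pair) (use F i in auto)
    moreover have "(\<Prod>j\<in>F-{i}. lin_form (v j)) \<in> ?A"
      using cofactor_in_join[of v i F] nz i F JA unfolding f_def[symmetric] ideal_join_iff by blast
    ultimately show ?thesis using ideal_join_absorb[OF A'] by simp
  qed
  have "irrelevant_in (ideal_join A f)"
    unfolding f_def by (intro irrelevant_in_join_prod A line F)
  then have "irrelevant_in A" using ideal_join_absorb[OF A] fJ JA by auto
  then show ?thesis unfolding sat_jacobian_def saturation_iff A_def f_def .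
qed

section \<open>Dimension counts\<close>

lemma cscale_C3: "cscale c p = C3 c * p"
  by (simp add: cscale_eq C3_def)

interpretation poly3: vector_space cscale
  by unfold_locales (simp_all add: cscale_C3 C3_hom algebra_simps)

lemma ideal3_subspace: "ideal3 A \<Longrightarrow> poly3.subspace A"
  unfolding poly3.subspace_def cscale_C3 using ideal3D by blast

lemma subspace_homog: "poly3.subspace (homog k)"
  unfolding poly3.subspace_def homog_def cscale_def
proof (intro conjI ballI allI CollectI)
  fix x y m assume "x \<in> {p. \<forall>m\<in>Poly_Mapping.keys p. tdeg m = k}" "y \<in> {p. \<forall>m\<in>Poly_Mapping.keys p. tdeg m = k}"
    "m \<in> Poly_Mapping.keys (x + y)"
  then show "tdeg m = k" using keys_add[of x y] by blast
next
  fix c x m assume "x \<in> {p. \<forall>m\<in>Poly_Mapping.keys p. tdeg m = k}" "m \<in> Poly_Mapping.keys (Poly_Mapping.map ((*) c) x)"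
  then show "tdeg m = k" by (auto simp: in_keys_iff map.rep_eq when_def split: if_splits)
qed simp

text \<open>For subspaces this bounds the codimension of V \<inter> W in V. Spanning vectors are
  counted because W will be an ideal, where the dimension function carries no information, and W is
  not contained in V.\<close>

definition codim_le :: "poly3 set \<Rightarrow> poly3 set \<Rightarrow> nat \<Rightarrow> bool" where
  "codim_le V W n \<longleftrightarrow> (\<exists>T. finite T \<and> card T \<le> n \<and> V \<subseteq> poly3.span (W \<union> T))"

text \<open>This is the isomorphism of V/(V \<inter> W) with (V + W)/W in terms of generators.
  Removing one vector t from T cuts V down to a subspace U of codimension at most 1.\<close>

lemma span_inter_complement:
  assumes "finite T" "poly3.subspace V" "poly3.subspace W" "V \<subseteq> poly3.span (W \<union> T)"
  shows "\<exists>T'. finite T' \<and> card T' \<le> card T \<and> V \<subseteq> poly3.span ((V \<inter> W) \<union> T')"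
  using assms(1,2,4)
proof (induction T arbitrary: V rule: finite_induct)
  case empty
  then have "V \<inter> W = V" using poly3.span_eq_iff[THEN iffD2, OF assms(3)] by auto
  then show ?case using poly3.span_superset by (intro exI[of _ "{}"]) auto
next
  case (insert t T)
  define U where "U = V \<inter> poly3.span (W \<union> T)"
  have U: "poly3.subspace U" unfolding U_def using insert.prems poly3.subspace_inter by auto
  obtain T' where T': "finite T'" "card T' \<le> card T" "U \<subseteq> poly3.span ((U \<inter> W) \<union> T')"
    using insert.IH[OF U] unfolding U_def by blast
  have UW: "U \<inter> W = V \<inter> W" unfolding U_def using poly3.span_superset[of "W \<union> T"] by blast
  show ?case
  proof (cases "V \<subseteq> U")
    case True
    then show ?thesis using T' UW insert.hyps by (intro exI[of _ T']) auto
  next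
    case False
    \<comment> \<open>Any such s involves t with a nonzero coefficient, so subtracting a multiple of
      s moves every element of V into U.\<close>
    then obtain s where s: "s \<in> V" "s \<notin> U" by blast
    obtain a where a: "s - cscale a t \<in> poly3.span (W \<union> T)"
      using s insert.prems(2) poly3.span_breakdown_eq[of s t "W \<union> T"] by auto
    have "a \<noteq> 0" using a s unfolding U_def by auto
    have "V \<subseteq> poly3.span ((V \<inter> W) \<union> insert s T')"
    proof
      fix x assume x: "x \<in> V"
      obtain b where b: "x - cscale b t \<in> poly3.span (W \<union> T)"
        using x insert.prems(2) poly3.span_breakdown_eq[of x t "W \<union> T"] by auto
      have "x - cscale (b / a) s = (x - cscale b t) - cscale (b / a) (s - cscale a t)"
        using \<open>a \<noteq> 0\<close> by (simp add: poly3.scale_right_diff_distrib)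
      also have "\<dots> \<in> poly3.span (W \<union> T)"
        using a b by (intro poly3.span_diff[OF b poly3.span_scale[OF a]])
      finally have "x - cscale (b / a) s \<in> U" unfolding U_def
        using x s insert.prems(1) by (auto intro: poly3.subspace_diff poly3.subspace_scale)
      then have "x - cscale (b / a) s \<in> poly3.span ((V \<inter> W) \<union> T')" using T'(3) UW by auto
      then show "x \<in> poly3.span ((V \<inter> W) \<union> insert s T')"
        using poly3.span_breakdown_eq[of x s "(V \<inter> W) \<union> T'"] by auto
    qed
    moreover have "card (insert s T') \<le> card (insert t T)"
      using insert.hyps T' by (simp add: card_insert_if)
    ultimately show ?thesis using T'(1) by (intro exI[of _ "insert s T'"]) auto
  qed
qed

text \<open>Codimensions add along V, V \<inter> W1, V \<inter> W1 \<inter> W2. The exchange lemma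
  is applied to each of the two inclusions.\<close>

lemma codim_le_inter:
  assumes V: "poly3.subspace V" and W: "poly3.subspace W1" "poly3.subspace W2"
    and "codim_le V W1 m" "codim_le V W2 n"
  shows "codim_le V (W1 \<inter> W2) (m + n)"
proof -
  obtain S T where S: "finite S" "card S \<le> m" "V \<subseteq> poly3.span (W1 \<union> S)"
    and T: "finite T" "card T \<le> n" "V \<subseteq> poly3.span (W2 \<union> T)"
    using assms(4,5) unfolding codim_le_def by blast
  obtain S' where S': "finite S'" "card S' \<le> card S" "V \<subseteq> poly3.span ((V \<inter> W1) \<union> S')"
    using span_inter_complement[OF S(1) V W(1) S(3)] by blast
  have VW: "poly3.subspace (V \<inter> W1)" using V W poly3.subspace_inter by blast
  obtain T' where T': "finite T'" "card T' \<le> card T" "V \<inter> W1 \<subseteq> poly3.span ((V \<inter> W1 \<inter> W2) \<union> T')"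
    using span_inter_complement[OF T(1) VW W(2)] T(3) by blast
  let ?U = "poly3.span ((W1 \<inter> W2) \<union> (S' \<union> T'))"
  have "V \<inter> W1 \<subseteq> ?U" using T'(3) poly3.span_mono[of "(V \<inter> W1 \<inter> W2) \<union> T'" "(W1 \<inter> W2) \<union> (S' \<union> T')"] by blast
  moreover have "S' \<subseteq> ?U" using poly3.span_superset[of "(W1 \<inter> W2) \<union> (S' \<union> T')"] by blast
  ultimately have "poly3.span ((V \<inter> W1) \<union> S') \<subseteq> ?U" by (intro poly3.span_minimal) auto
  then have "V \<subseteq> ?U" using S'(3) by blast
  moreover have "card (S' \<union> T') \<le> m + n" using card_Un_le[of S' T'] S S' T T' by linarith
  ultimately show ?thesis unfolding codim_le_def using S'(1) T'(1) by blast
qed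

lemma codim_le_INTER:
  assumes "finite F" "poly3.subspace V" "\<And>i. i \<in> F \<Longrightarrow> poly3.subspace (W i)"
    and "\<And>i. i \<in> F \<Longrightarrow> codim_le V (W i) (c i)"
  shows "codim_le V (\<Inter>i\<in>F. W i) (\<Sum>i\<in>F. c i)"
  using assms(1,3,4)
proof (induction F)
  case empty
  then show ?case unfolding codim_le_def by (auto intro!: exI[of _ "{}"] poly3.span_base)
next
  case (insert i F)
  have "poly3.subspace (\<Inter>i\<in>F. W i)" by (rule poly3.subspace_Inter) (use insert in auto)
  from codim_le_inter[OF assms(2) _ this, of "W i" "c i" "\<Sum>i\<in>F. c i"] insert
  show ?case by simp
qed

section \<open>Forms of fixed degree and graded pieces of the Jacobian ideal\<close>

lemma finite_tdeg: "finite {m. tdeg m = k}"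
proof (rule finite_subset)
  show "{m. tdeg m = k} \<subseteq> {..k} \<times> {..k} \<times> {..k}" by (auto simp: tdeg_def)
qed simp

text \<open>The count is doubled to avoid division of natural numbers.\<close>

lemma card_tdeg: "2 * card {m. tdeg m = k} = (k + 1) * (k + 2)"
proof -
  have "bij_betw (\<lambda>(a,b). (a, b, k - a - b)) (SIGMA a:{..k}. {..k-a}) {m. tdeg m = k}"
    by (rule bij_betw_byWitness[where f' = "\<lambda>(a,b,c). (a,b)"]) (auto simp: tdeg_def)
  then have "card {m. tdeg m = k} = card (SIGMA a:{..k}. {..k-a})" by (rule bij_betw_same_card[symmetric])
  also have "\<dots> = (\<Sum>a\<le>k. k - a + 1)" by simp
  also have "\<dots> = (\<Sum>a\<le>k. a + 1)"
    by (rule sum.reindex_bij_witness[of _ "\<lambda>a. k - a" "\<lambda>a. k - a"]) auto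
  also have "2 * \<dots> = (k + 1) * (k + 2)" by (induction k) auto
  finally show ?thesis .
qed

lemma independent_monomials: "poly3.independent ((\<lambda>m. Poly_Mapping.single m 1) ` {m. tdeg m = k})"
  (is "poly3.independent ?B")
proof (rule poly3.independent_if_scalars_zero)
  show "finite ?B" using finite_tdeg by simp
  fix u p assume u: "(\<Sum>x\<in>?B. cscale (u x) x) = 0" and p: "p \<in> ?B"
  then obtain n where n: "p = Poly_Mapping.single n 1" "tdeg n = k" by blast
  have inj: "inj_on (\<lambda>m. Poly_Mapping.single m (1::complex)) A" for A
    by (rule inj_onI) (metis keys_single singleton_inject zero_neq_one)
  have "0 = Poly_Mapping.lookup (\<Sum>m | tdeg m = k. cscale (u (Poly_Mapping.single m 1)) (Poly_Mapping.single m 1)) n"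
    using u by (simp add: sum.reindex[OF inj])
  also have "\<dots> = (\<Sum>m | tdeg m = k. u (Poly_Mapping.single m 1) when m = n)"
    by (simp add: lookup_sum cscale_eq mult_single lookup_single)
  also have "\<dots> = u p" using n finite_tdeg[of k] by (simp add: when_def)
  finally show "u p = 0" by simp
qed

lemma homog_subset_span:
  assumes "\<And>m. tdeg m = k \<Longrightarrow> Poly_Mapping.single m 1 \<in> poly3.span S"
  shows "homog k \<subseteq> poly3.span S"
proof
  fix p assume p: "p \<in> homog k"
  have "(\<Sum>m\<in>Poly_Mapping.keys p. Poly_Mapping.single m (Poly_Mapping.lookup p m)) \<in> poly3.span S"
  proof (rule poly3.span_sum)
    fix m assume "m \<in> Poly_Mapping.keys p"
    then have "tdeg m = k" using p by (auto simp: homog_def)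
    from poly3.span_scale[OF assms[OF this], of "Poly_Mapping.lookup p m"]
    show "Poly_Mapping.single m (Poly_Mapping.lookup p m) \<in> poly3.span S"
      by (simp add: cscale_eq mult_single)
  qed
  then show "p \<in> poly3.span S" using poly_mapping_sum_single[of p] by simp
qed

lemma homog_mult: "p \<in> homog i \<Longrightarrow> q \<in> homog j \<Longrightarrow> p * q \<in> homog (i + j)"
  unfolding homog_def by (auto simp: tdeg_add simp del: add_Pair dest!: subsetD[OF keys_mult[of p q]])

lemma lin_form_homog: "lin_form v \<in> homog 1"
  unfolding lin_form_def split_def
  by (intro poly3.subspace_add[OF subspace_homog]) (auto simp: homog_def tdeg_def)

lemma prod_lin_form_homog: "finite F \<Longrightarrow> (\<Prod>i\<in>F. lin_form (v i)) \<in> homog (card F)"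
proof (induction F rule: finite_induct)
  case empty
  then show ?case by (auto simp: homog_def tdeg_def)
next
  case (insert i F)
  then show ?case using homog_mult[OF lin_form_homog, of "prod (\<lambda>i. lin_form (v i)) F" "card F" "v i"] by simp
qed

lemma pd_homog:
  assumes "f \<in> homog (Suc e)"
  shows "pd_x f \<in> homog e" "pd_y f \<in> homog e" "pd_z f \<in> homog e"
proof -
  have "case m of (a,b,c) \<Rightarrow> a + b + c = Suc e" if "m \<in> Poly_Mapping.keys f" for m
    using assms that by (auto simp: homog_def tdeg_def)
  then show "pd_x f \<in> homog e" "pd_y f \<in> homog e" "pd_z f \<in> homog e"
    unfolding pd_x_def pd_y_def pd_z_def
    by (fastforce intro!: poly3.subspace_sum[OF subspace_homog] simp: homog_def tdeg_def split: if_splits)+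
qed

definition hcomp :: "nat \<Rightarrow> poly3 \<Rightarrow> poly3" where
  "hcomp k p = Poly_Mapping.mapp (\<lambda>m c. if tdeg m = k then c else 0) p"

lemma lookup_hcomp: "Poly_Mapping.lookup (hcomp k p) m = (if tdeg m = k then Poly_Mapping.lookup p m else 0)"
  by (simp add: hcomp_def lookup_mapp when_def in_keys_iff)

lemma hcomp_add: "hcomp k (p + q) = hcomp k p + hcomp k q"
  by (rule poly_mapping_eqI) (simp add: lookup_hcomp lookup_add)

lemma hcomp_homog: "p \<in> homog j \<Longrightarrow> hcomp k p = (if j = k then p else 0)"
  by (rule poly_mapping_eqI) (auto simp: lookup_hcomp homog_def in_keys_iff)

text \<open>Only the part of g of degree k - e contributes. For k < e the left-hand side is 0, so
  the truncated difference does no harm.\<close>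

lemma hcomp_mult_in_span:
  assumes "q \<in> homog e"
  shows "hcomp k (g * q) \<in> poly3.span ((\<lambda>m. Poly_Mapping.single m 1 * q) ` {m. tdeg m = k - e})"
proof (induction g rule: poly_mapping_induct)
  case zero
  then show ?case by (simp add: hcomp_homog[of 0 k] homog_def poly3.span_zero)
next
  case (add p p')
  then show ?case by (simp add: distrib_right hcomp_add poly3.span_add)
next
  case (single m c)
  have "Poly_Mapping.single m c \<in> homog (tdeg m)" by (auto simp: homog_def)
  then have "Poly_Mapping.single m c * q \<in> homog (tdeg m + e)" by (rule homog_mult) (rule assms)
  then have *: "hcomp k (Poly_Mapping.single m c * q) = (if tdeg m + e = k then Poly_Mapping.single m c * q else 0)"
    by (rule hcomp_homog)
  have **: "Poly_Mapping.single m c * q = cscale c (Poly_Mapping.single m 1 * q)"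
    by (simp add: cscale_eq mult.assoc[symmetric] mult_single)
  show ?case
  proof (cases "tdeg m + e = k")
    case True
    then have "Poly_Mapping.single m 1 * q \<in> (\<lambda>m. Poly_Mapping.single m 1 * q) ` {m. tdeg m = k - e}" by auto
    then show ?thesis using True by (simp only: * if_True) (simp add: ** poly3.span_scale poly3.span_base)
  qed (simp add: * poly3.span_zero)
qed

text \<open>Taking components of degree k makes the three coefficients forms of degree k - e. Their
  syzygies are ignored, which leaves an upper bound; for k < e the left-hand side is 0.\<close>

lemma dim_jacobian_homog:
  assumes "f \<in> homog (Suc e)"
  shows "poly3.dim (jacobian_ideal f \<inter> homog k) \<le> 3 * card {m. tdeg m = k - e}"
proof -
  let ?M = "\<lambda>q. (\<lambda>m. Poly_Mapping.single m (1::complex) * q) ` {m. tdeg m = k - e}"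
  let ?G = "?M (pd_x f) \<union> ?M (pd_y f) \<union> ?M (pd_z f)"
  have "jacobian_ideal f \<inter> homog k \<subseteq> poly3.span ?G"
  proof
    fix p assume "p \<in> jacobian_ideal f \<inter> homog k"
    then obtain g1 g2 g3 where p: "p = g1 * pd_x f + g2 * pd_y f + g3 * pd_z f" "p \<in> homog k"
      unfolding jacobian_ideal_def by blast
    have "p = hcomp k p" using hcomp_homog[OF p(2)] by simp
    also have "\<dots> = hcomp k (g1 * pd_x f) + hcomp k (g2 * pd_y f) + hcomp k (g3 * pd_z f)"
      by (simp add: p(1) hcomp_add)
    also have "\<dots> \<in> poly3.span ?G"
    proof (intro poly3.span_add)
      show "hcomp k (g1 * pd_x f) \<in> poly3.span ?G"
        by (rule subsetD[OF poly3.span_mono hcomp_mult_in_span[OF pd_homog(1)[OF assms]]]) blast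
      show "hcomp k (g2 * pd_y f) \<in> poly3.span ?G"
        by (rule subsetD[OF poly3.span_mono hcomp_mult_in_span[OF pd_homog(2)[OF assms]]]) blast
      show "hcomp k (g3 * pd_z f) \<in> poly3.span ?G"
        by (rule subsetD[OF poly3.span_mono hcomp_mult_in_span[OF pd_homog(3)[OF assms]]]) blast
    qed
    finally show "p \<in> poly3.span ?G" .
  qed
  moreover have "finite ?G" using finite_tdeg by simp
  ultimately have "poly3.dim (jacobian_ideal f \<inter> homog k) \<le> card ?G" by (rule poly3.dim_le_card)
  also have "\<dots> \<le> card (?M (pd_x f)) + card (?M (pd_y f)) + card (?M (pd_z f))"
    by (meson add_le_mono card_Un_le le_refl le_trans)
  also have "\<dots> \<le> 3 * card {m. tdeg m = k - e}"
  proof -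
    have "card (?M q) \<le> card {m. tdeg m = k - e}" for q by (rule card_image_le[OF finite_tdeg])
    from this[of "pd_x f"] this[of "pd_y f"] this[of "pd_z f"] show ?thesis by linarith
  qed
  finally show ?thesis .
qed

text \<open>Steinitz exchange: the independent monomials of degree k lie in the span of a basis of W
  \<inter> \<open>homog k\<close> and at most n further vectors.\<close>

lemma codim_le_dim:
  assumes "codim_le (homog k) W n" "poly3.subspace W"
  shows "card {m. tdeg m = k} \<le> poly3.dim (W \<inter> homog k) + n"
proof -
  let ?B = "(\<lambda>m. Poly_Mapping.single m (1::complex)) ` {m. tdeg m = k}"
  have inj: "inj_on (\<lambda>m. Poly_Mapping.single m (1::complex)) A" for A
    by (rule inj_onI) (metis keys_single singleton_inject zero_neq_one)
  have cB: "card ?B = card {m. tdeg m = k}" by (rule card_image[OF inj])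
  have Bh: "?B \<subseteq> homog k" by (auto simp: homog_def)
  have hB: "homog k \<subseteq> poly3.span ?B" by (intro homog_subset_span poly3.span_base) auto
  obtain T where T: "finite T" "card T \<le> n" "homog k \<subseteq> poly3.span (W \<union> T)"
    using assms unfolding codim_le_def by blast
  obtain T' where T': "finite T'" "card T' \<le> card T" "homog k \<subseteq> poly3.span ((homog k \<inter> W) \<union> T')"
    using span_inter_complement[OF T(1) subspace_homog assms(2) T(3)] by blast
  obtain E where E: "E \<subseteq> W \<inter> homog k" "poly3.independent E" "W \<inter> homog k \<subseteq> poly3.span E"
    "card E = poly3.dim (W \<inter> homog k)"
    using poly3.basis_exists by blast
  have "finite E" using poly3.independent_span_bound[of ?B E] E hB finite_tdeg by auto
  have "poly3.span ((homog k \<inter> W) \<union> T') \<subseteq> poly3.span (E \<union> T')"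
  proof (rule poly3.span_minimal)
    show "homog k \<inter> W \<union> T' \<subseteq> poly3.span (E \<union> T')"
      using E(3) poly3.span_mono[of E "E \<union> T'"] poly3.span_superset[of "E \<union> T'"] by blast
  qed simp
  then have "?B \<subseteq> poly3.span (E \<union> T')" using Bh T'(3) by blast
  then have "card ?B \<le> card (E \<union> T')"
    using poly3.independent_span_bound[of "E \<union> T'" ?B] independent_monomials \<open>finite E\<close> T'(1) by blast
  also have "\<dots> \<le> card E + card T'" by (rule card_Un_le)
  finally show ?thesis using E(4) T'(2) T(2) cB by linarith
qed

section \<open>Local codimension at a node and at a triple point\<close>

text \<open>Three independent linear forms are coordinates: Cramer's rule expresses each variable
  through them, and a monomial is built up one variable at a time.\<close>

lemma linear_monomials_span:
  assumes "det3 u v w \<noteq> 0"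
  shows "homog k \<subseteq> poly3.span {lin_form u ^ i * lin_form v ^ j * lin_form w ^ l | i j l. i + j + l = k}"
proof -
  define M where "M k = poly3.span {lin_form u ^ i * lin_form v ^ j * lin_form w ^ l | i j l. i + j + l = k}" for k
  have step: "lin_form z * p \<in> M (Suc k)" if "p \<in> M k" "z \<in> {u,v,w}" for p k z
  proof -
    have "p \<in> {p. lin_form z * p \<in> M (Suc k)}"
    proof (rule poly3.span_induct_alt[OF that(1)[unfolded M_def]])
      show "0 \<in> {p. lin_form z * p \<in> M (Suc k)}" by (simp add: M_def poly3.span_zero)
    next
      fix c x y
      assume x: "x \<in> {lin_form u ^ i * lin_form v ^ j * lin_form w ^ l | i j l. i + j + l = k}"
        and y: "y \<in> {p. lin_form z * p \<in> M (Suc k)}"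
      from x obtain i j l where ijl: "x = lin_form u ^ i * lin_form v ^ j * lin_form w ^ l" "i + j + l = k" by blast
      have eqs: "lin_form u * x = lin_form u ^ Suc i * lin_form v ^ j * lin_form w ^ l"
        "lin_form v * x = lin_form u ^ i * lin_form v ^ Suc j * lin_form w ^ l"
        "lin_form w * x = lin_form u ^ i * lin_form v ^ j * lin_form w ^ Suc l"
        by (simp_all add: ijl(1) algebra_simps)
      have mem: "lin_form u ^ i * lin_form v ^ j * lin_form w ^ l \<in> M (Suc k)" if "i + j + l = Suc k" for i j l
        unfolding M_def by (rule poly3.span_base) (use that in blast)
      have "lin_form u * x \<in> M (Suc k)" "lin_form v * x \<in> M (Suc k)" "lin_form w * x \<in> M (Suc k)"
        unfolding eqs using ijl(2) by (intro mem; simp)+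
      then have "lin_form z * x \<in> M (Suc k)" using that(2) by auto
      moreover have "lin_form z * (cscale c x + y) = cscale c (lin_form z * x) + lin_form z * y"
        by (simp add: cscale_C3 algebra_simps)
      ultimately show "cscale c x + y \<in> {p. lin_form z * p \<in> M (Suc k)}"
        using y by (auto simp: M_def intro: poly3.span_add poly3.span_scale)
    qed
    then show ?thesis by simp
  qed
  have var: "r * p \<in> M (Suc k)" if "p \<in> M k" "r \<in> {var_x, var_y, var_z}" for p r k
  proof -
    have comb: "(C3 a * lin_form u + C3 b * lin_form v + C3 c * lin_form w) * p \<in> M (Suc k)" for a b c
    proof -
      have "cscale a (lin_form u * p) + cscale b (lin_form v * p) + cscale c (lin_form w * p) \<in> M (Suc k)"
        unfolding M_def by (intro poly3.span_add poly3.span_scale step[OF that(1), unfolded M_def]) auto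
      then show ?thesis by (simp add: cscale_C3 algebra_simps)
    qed
    have "C3 (det3 u v w) * r * p \<in> M (Suc k)"
      using that(2) by (auto simp: cramer_var intro: comb)
    then have "cscale (inverse (det3 u v w)) (cscale (det3 u v w) (r * p)) \<in> M (Suc k)"
      unfolding M_def cscale_C3[of "det3 u v w"] by (intro poly3.span_scale) (simp only: mult.assoc)
    moreover have "cscale (inverse (det3 u v w)) (cscale (det3 u v w) (r * p)) = r * p"
      using assms by simp
    ultimately show ?thesis by simp
  qed
  have "Poly_Mapping.single m 1 \<in> M k" if "tdeg m = k" for m
    using that
  proof (induction k arbitrary: m)
    case 0
    then have "m = 0" by (cases m) (auto simp: tdeg_def zero_prod_def)
    then show ?case by (auto simp: M_def intro!: poly3.span_base)
  next
    case (Suc k)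
    then have "tdeg m = 1 + k" by simp
    then obtain m1 m2 where m: "m = m1 + m2" "tdeg m1 = 1" "tdeg m2 = k" by (rule tdeg_split)
    from m(2) have "m1 = (1,0,0) \<or> m1 = (0,1,0) \<or> m1 = (0,0,1)"
      by (cases m1) (auto simp: tdeg_def)
    then have "Poly_Mapping.single m1 1 \<in> {var_x, var_y, var_z}" by (auto simp: var_x_def var_y_def var_z_def)
    from var[OF Suc.IH[OF m(3)] this] show ?case by (simp add: mult_single m(1))
  qed
  then show ?thesis using homog_subset_span unfolding M_def by blast
qed

text \<open>Modulo the two lines through the node only the pure power of the third coordinate
  survives.\<close>

lemma codim_node:
  assumes "det3 u v w \<noteq> 0" and W: "ideal3 W" and "lin_form u \<in> W" "lin_form v \<in> W"
  shows "codim_le (homog k) W 1"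
proof -
  let ?T = "{lin_form w ^ k}"
  have "lin_form u ^ i * lin_form v ^ j * lin_form w ^ l \<in> poly3.span (W \<union> ?T)" if "i + j + l = k" for i j l
  proof (cases "i = 0 \<and> j = 0")
    case True
    then show ?thesis using that by (auto intro: poly3.span_base)
  next
    case False
    then have "lin_form u ^ i * lin_form v ^ j * lin_form w ^ l \<in> W"
      using assms(3,4) by (cases i; cases j) (auto intro!: ideal3D(3,4)[OF W] simp: mult.assoc)
    then show ?thesis by (auto intro: poly3.span_base)
  qed
  then have "{lin_form u ^ i * lin_form v ^ j * lin_form w ^ l | i j l. i + j + l = k} \<subseteq> poly3.span (W \<union> ?T)" by blast
  then have "homog k \<subseteq> poly3.span (W \<union> ?T)"
    using linear_monomials_span[OF assms(1), of k] poly3.span_minimal[OF _ poly3.subspace_span] by blast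
  then show ?thesis unfolding codim_le_def by (intro exI[of _ ?T]) auto
qed

text \<open>With a and b the forms of u and v, and third line \<alpha> a + \<beta> b, the two given
  elements are the partial derivatives in a and b of q = ab(\<alpha> a + \<beta> b). They are two
  quadrics in a, b without common factor, and 1, a, b, ab represent a basis of the quotient, whence
  4 = 2 * 2.\<close>

lemma codim_triple:
  fixes \<alpha> \<beta> :: complex
  assumes "det3 u v w \<noteq> 0" and W: "ideal3 W" and nz: "\<alpha> \<noteq> 0" "\<beta> \<noteq> 0"
    and 1: "lin_form v * (2 * C3 \<alpha> * lin_form u + C3 \<beta> * lin_form v) \<in> W"
    and 2: "lin_form u * (C3 \<alpha> * lin_form u + 2 * C3 \<beta> * lin_form v) \<in> W"
  shows "codim_le (homog k) W 4"
proof -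
  define a b t where "a = lin_form u" and "b = lin_form v" and "t = lin_form w"
  \<comment> \<open>For k < 2 some exponents are truncated and the vectors have the wrong degree;
    they only enlarge the span.\<close>
  let ?T = "{t ^ k, a * t ^ (k - 1), b * t ^ (k - 1), a * b * t ^ (k - 2)}"
  let ?S = "poly3.span (W \<union> ?T)"
  note 12 = 1[folded a_def b_def] 2[folded a_def b_def]
  \<comment> \<open>The multiples of the two derivatives by a and b are combined so that one of the
    monomials a^2 b and a b^2 cancels. From these two the cubes follow, so every monomial of degree
    3 in a and b lies in W.\<close>
  have "2 * (a * (b * (2 * C3 \<alpha> * a + C3 \<beta> * b))) - b * (a * (C3 \<alpha> * a + 2 * C3 \<beta> * b)) \<in> W"
    by (intro ideal3D[OF W] 12)
  also have "2 * (a * (b * (2 * C3 \<alpha> * a + C3 \<beta> * b))) - b * (a * (C3 \<alpha> * a + 2 * C3 \<beta> * b)) = C3 (3 * \<alpha>) * (a^2 * b)"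
    by (simp add: C3_hom power2_eq_square algebra_simps)
  finally have aab: "a^2 * b \<in> W" by (rule ideal3_C3_cancel[OF W]) (use nz in auto)
  have "2 * (b * (a * (C3 \<alpha> * a + 2 * C3 \<beta> * b))) - a * (b * (2 * C3 \<alpha> * a + C3 \<beta> * b)) \<in> W"
    by (intro ideal3D[OF W] 12)
  also have "2 * (b * (a * (C3 \<alpha> * a + 2 * C3 \<beta> * b))) - a * (b * (2 * C3 \<alpha> * a + C3 \<beta> * b)) = C3 (3 * \<beta>) * (a * b^2)"
    by (simp add: C3_hom power2_eq_square algebra_simps)
  finally have abb: "a * b^2 \<in> W" by (rule ideal3_C3_cancel[OF W]) (use nz in auto)
  have "a * (a * (C3 \<alpha> * a + 2 * C3 \<beta> * b)) - 2 * C3 \<beta> * (a^2 * b) \<in> W"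
    by (intro ideal3D(3,5)[OF W] 12 aab)
  also have "a * (a * (C3 \<alpha> * a + 2 * C3 \<beta> * b)) - 2 * C3 \<beta> * (a^2 * b) = C3 \<alpha> * a^3"
    by (simp add: power2_eq_square power3_eq_cube algebra_simps)
  finally have aaa: "a^3 \<in> W" by (rule ideal3_C3_cancel[OF W]) (use nz in auto)
  have "b * (b * (2 * C3 \<alpha> * a + C3 \<beta> * b)) - 2 * C3 \<alpha> * (a * b^2) \<in> W"
    by (intro ideal3D(3,5)[OF W] 12 abb)
  also have "b * (b * (2 * C3 \<alpha> * a + C3 \<beta> * b)) - 2 * C3 \<alpha> * (a * b^2) = C3 \<beta> * b^3"
    by (simp add: power2_eq_square power3_eq_cube algebra_simps)
  finally have bbb: "b^3 \<in> W" by (rule ideal3_C3_cancel[OF W]) (use nz in auto)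
  have inW: "p \<in> ?S" if "p \<in> W" for p using that by (auto intro: poly3.span_base)
  have inT: "p \<in> ?S" if "p \<in> ?T" for p using that by (auto intro: poly3.span_base)
  have "a ^ i * b ^ j * t ^ l \<in> ?S" if ijl: "i + j + l = k" for i j l
  proof -
    \<comment> \<open>The first four cases are the basis vectors. The squares of a and b reduce to
      multiples of ab modulo W, and every other monomial has degree at least 3 in a and b.\<close>
    consider "i = 0" "j = 0" | "i = 1" "j = 0" | "i = 0" "j = 1" | "i = 1" "j = 1" | "i = 2" "j = 0" | "i = 0" "j = 2"
      | "i \<ge> 3" | "j \<ge> 3" | "i \<ge> 2" "j \<ge> 1" | "i \<ge> 1" "j \<ge> 2"
    proof -
      have "i = 0 \<or> i = 1 \<or> i = 2 \<or> i \<ge> 3" "j = 0 \<or> j = 1 \<or> j = 2 \<or> j \<ge> 3" by linarith+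
      then show thesis using that by (elim disjE) auto
    qed
    then show ?thesis
    proof cases
      case 5
      let ?w = "a * (C3 \<alpha> * a + 2 * C3 \<beta> * b) * t ^ (k - 2)"
      have "cscale (inverse \<alpha>) ?w - cscale (inverse \<alpha> * (2 * \<beta>)) (a * b * t ^ (k - 2)) \<in> ?S"
        by (intro poly3.span_diff poly3.span_scale inW ideal3D(4)[OF W] 12 inT) auto
      also have "cscale (inverse \<alpha>) ?w - cscale (inverse \<alpha> * (2 * \<beta>)) (a * b * t ^ (k - 2))
          = (C3 (inverse \<alpha>) * C3 \<alpha>) * (a^2 * t ^ (k - 2))"
        by (simp add: cscale_C3 C3_hom power2_eq_square algebra_simps)
      also have "\<dots> = a ^ i * b ^ j * t ^ l" using 5 ijl C3_inverse[OF nz(1)] by auto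
      finally show ?thesis .
    next
      case 6
      let ?w = "b * (2 * C3 \<alpha> * a + C3 \<beta> * b) * t ^ (k - 2)"
      have "cscale (inverse \<beta>) ?w - cscale (inverse \<beta> * (2 * \<alpha>)) (a * b * t ^ (k - 2)) \<in> ?S"
        by (intro poly3.span_diff poly3.span_scale inW ideal3D(4)[OF W] 12 inT) auto
      also have "cscale (inverse \<beta>) ?w - cscale (inverse \<beta> * (2 * \<alpha>)) (a * b * t ^ (k - 2))
          = (C3 (inverse \<beta>) * C3 \<beta>) * (b^2 * t ^ (k - 2))"
        by (simp add: cscale_C3 C3_hom power2_eq_square algebra_simps)
      also have "\<dots> = a ^ i * b ^ j * t ^ l" using 6 ijl C3_inverse[OF nz(2)] by auto
      finally show ?thesis .
    next
      case 7
      then have "a ^ i * b ^ j * t ^ l = a^3 * (a ^ (i - 3) * b ^ j * t ^ l)"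
        by (simp add: mult.assoc[symmetric] power_add[symmetric])
      then show ?thesis using inW ideal3D(4)[OF W aaa] by presburger
    next
      case 8
      then have "a ^ i * b ^ j * t ^ l = b^3 * (a ^ i * b ^ (j - 3) * t ^ l)"
        by (simp add: ac_simps power_add[symmetric])
      then show ?thesis using inW ideal3D(4)[OF W bbb] by presburger
    next
      case 9
      then have "a ^ i = a ^ 2 * a ^ (i - 2)" "b ^ j = b * b ^ (j - 1)"
        by (metis le_add_diff_inverse power_add, metis le_add_diff_inverse power_add power_one_right)
      then have "a ^ i * b ^ j * t ^ l = (a^2 * b) * (a ^ (i - 2) * b ^ (j - 1) * t ^ l)"
        by (simp add: ac_simps)
      then show ?thesis using inW ideal3D(4)[OF W aab] by presburger
    next
      case 10
      then have "a ^ i = a * a ^ (i - 1)" "b ^ j = b^2 * b ^ (j - 2)"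
        by (metis le_add_diff_inverse power_add power_one_right, metis le_add_diff_inverse power_add)
      then have "a ^ i * b ^ j * t ^ l = (a * b^2) * (a ^ (i - 1) * b ^ (j - 2) * t ^ l)"
        by (simp add: ac_simps)
      then show ?thesis using inW ideal3D(4)[OF W abb] by presburger
    qed (rule poly3.span_base, use ijl in force)+
  qed
  then have "{a ^ i * b ^ j * t ^ l | i j l. i + j + l = k} \<subseteq> ?S" by blast
  then have "homog k \<subseteq> ?S"
    using linear_monomials_span[OF assms(1), of k, folded a_def b_def t_def]
      poly3.span_minimal[OF _ poly3.subspace_span] by blast
  moreover have "card ?T \<le> 4" by (auto simp: card_insert_if)
  ultimately show ?thesis unfolding codim_le_def by (intro exI[of _ ?T]) auto
qed

section \<open>Blocks of concurrent lines\<close>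

definition scale3 :: "complex \<Rightarrow> vec3 \<Rightarrow> vec3" where
  "scale3 c v = (c * xc v, c * yc v, c * zc v)"

lemma scale3_simps [simp]: "xc (scale3 c v) = c * xc v" "yc (scale3 c v) = c * yc v" "zc (scale3 c v) = c * zc v"
  by (simp_all add: scale3_def)

lemma vec3_eq_iff: "v = w \<longleftrightarrow> xc v = xc w \<and> yc v = yc w \<and> zc v = zc w" for v w :: vec3
  by (simp add: prod_eq_iff)

lemma cross_simps [simp]: "xc (cross v w) = yc v * zc w - zc v * yc w"
  "yc (cross v w) = zc v * xc w - xc v * zc w" "zc (cross v w) = xc v * yc w - yc v * xc w"
  by (simp_all add: cross_def)

lemma proportional_scale3: "proportional v w \<longleftrightarrow> (\<exists>t. w = scale3 t v)"
  by (simp add: proportional_def scale3_def)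

lemma eval_lin_eq: "eval_lin v p = xc v * xc p + yc v * yc p + zc v * zc p"
  by (simp add: eval_lin_def split_def)

lemma eval_lin_cross: "eval_lin w (cross u v) = det3 u v w"
  by (simp add: eval_lin_eq det3_def algebra_simps)

lemma cross_nonzero:
  assumes "u \<noteq> 0" "\<not> proportional u v"
  shows "cross u v \<noteq> 0"
proof
  assume "cross u v = 0"
  then have eqs: "yc u * zc v = zc u * yc v" "zc u * xc v = xc u * zc v" "xc u * yc v = yc u * xc v"
    by (auto simp: vec3_eq_iff)
  from assms(1) consider "xc u \<noteq> 0" | "yc u \<noteq> 0" | "zc u \<noteq> 0" by (auto simp: vec3_eq_iff)
  then have "\<exists>t. v = scale3 t u"
  proof cases
    case 1 then show ?thesis using eqs by (intro exI[of _ "xc v / xc u"]) (auto simp: vec3_eq_iff field_simps)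
  next
    case 2 then show ?thesis using eqs by (intro exI[of _ "yc v / yc u"]) (auto simp: vec3_eq_iff field_simps)
  next
    case 3 then show ?thesis using eqs by (intro exI[of _ "zc v / zc u"]) (auto simp: vec3_eq_iff field_simps)
  qed
  then show False using assms(2) by (simp add: proportional_scale3)
qed

lemma exists_third:
  assumes "u \<noteq> 0" "\<not> proportional u v"
  obtains w where "det3 u v w \<noteq> 0"
proof -
  from cross_nonzero[OF assms] consider "xc (cross u v) \<noteq> 0" | "yc (cross u v) \<noteq> 0" | "zc (cross u v) \<noteq> 0"
    unfolding vec3_eq_iff by auto
  then have "det3 u v (1,0,0) \<noteq> 0 \<or> det3 u v (0,1,0) \<noteq> 0 \<or> det3 u v (0,0,1) \<noteq> 0"
    by cases (auto simp: eval_lin_cross[symmetric] eval_lin_eq)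
  then show ?thesis using that by blast
qed

lemma cramer_vec:
  "scale3 (det3 u v t) w = scale3 (det3 w v t) u + scale3 (det3 u w t) v + scale3 (det3 u v w) t"
  by (simp add: vec3_eq_iff det3_def algebra_simps)

lemma in_span_of_det3:
  assumes u: "u \<noteq> 0" "\<not> proportional u v" and d: "det3 u v w = 0"
  obtains \<alpha> \<beta> where "w = scale3 \<alpha> u + scale3 \<beta> v"
proof -
  from u obtain t where t: "det3 u v t \<noteq> 0" by (rule exists_third)
  have "w = scale3 (det3 w v t / det3 u v t) u + scale3 (det3 u w t / det3 u v t) v"
  proof -
    have "scale3 (det3 u v t) w = scale3 (det3 w v t) u + scale3 (det3 u w t) v"
      using cramer_vec[of u v t w] d by (simp add: scale3_def zero_prod_def)
    moreover have "x = y / c + z / c" if "c \<noteq> 0" "c * x = y + z" for x y z c :: complex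
      using that by (simp add: field_simps)
    ultimately show ?thesis using t by (simp add: vec3_eq_iff)
  qed
  then show ?thesis by (rule that)
qed

lemma lin_form_comb: "lin_form (scale3 a u + scale3 b v) = C3 a * lin_form u + C3 b * lin_form v"
  by (simp add: lin_form_eq C3_hom algebra_simps)

lemma lin_form_scale: "lin_form (scale3 a u) = C3 a * lin_form u"
  by (simp add: lin_form_eq C3_hom algebra_simps)

definition dirderiv :: "vec3 \<Rightarrow> poly3 \<Rightarrow> poly3" where
  "dirderiv e p = C3 (xc e) * pd_x p + C3 (yc e) * pd_y p + C3 (zc e) * pd_z p"

lemma dirderiv_mult: "dirderiv e (p * q) = p * dirderiv e q + q * dirderiv e p"
  by (simp add: dirderiv_def derivation3D(2)[OF derivation_pd(1)] derivation3D(2)[OF derivation_pd(2)]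
      derivation3D(2)[OF derivation_pd(3)] algebra_simps)

lemma dirderiv_lin_form: "dirderiv e (lin_form v) = C3 (eval_lin v e)"
  by (simp add: dirderiv_def pd_lin_form eval_lin_eq C3_hom algebra_simps)

lemma dirderiv_in_jacobian: "dirderiv e q \<in> jacobian_ideal q"
  unfolding dirderiv_def by (rule jacobian_idealI)

lemma det3_self [simp]: "det3 u v u = 0" "det3 u v v = 0" "det3 u u v = 0"
  by (simp_all add: det3_def algebra_simps)

lemma det3_rotate: "det3 u v w = det3 v w u"
  by (simp add: det3_def algebra_simps)

text \<open>On polynomials in the forms of u and v, the directional derivatives along e and e' act
  as the partial derivatives in these two forms, so no coordinate change is needed at a singular
  point.\<close>

lemma exists_dual_vectors:
  assumes "u \<noteq> 0" "\<not> proportional u v"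
  obtains e e' where "eval_lin u e = 1" "eval_lin v e = 0" "eval_lin u e' = 0" "eval_lin v e' = 1"
proof -
  from assms obtain t where t: "det3 u v t \<noteq> 0" by (rule exists_third)
  have "eval_lin x (scale3 c p) = c * eval_lin x p" for x c p
    by (simp add: eval_lin_eq algebra_simps)
  then have "eval_lin u (scale3 (1 / det3 u v t) (cross v t)) = 1" "eval_lin v (scale3 (1 / det3 u v t) (cross v t)) = 0"
    "eval_lin u (scale3 (1 / det3 u v t) (cross t u)) = 0" "eval_lin v (scale3 (1 / det3 u v t) (cross t u)) = 1"
    using t det3_rotate[of u v t] det3_rotate[of v t u] by (simp_all add: eval_lin_cross)
  then show ?thesis by (rule that)
qed

text \<open>A singular point is encoded by the set of lines through it, named by two of them. This
  avoids projective points and their representatives.\<close>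

definition block :: "nat \<Rightarrow> (nat \<Rightarrow> vec3) \<Rightarrow> nat \<Rightarrow> nat \<Rightarrow> nat set" where
  "block d v i j = {k. k < d \<and> det3 (v i) (v j) (v k) = 0}"

lemma finite_block [simp]: "finite (block d v i j)"
  by (simp add: block_def)

lemma distinct_linesD:
  assumes "distinct_lines d v" "i < d"
  shows "v i \<noteq> 0" "j < d \<Longrightarrow> i \<noteq> j \<Longrightarrow> \<not> proportional (v i) (v j)"
  using assms by (auto simp: distinct_lines_def)

lemma block_mem: "i < d \<Longrightarrow> i \<in> block d v i j" "j < d \<Longrightarrow> j \<in> block d v i j"
  by (auto simp: block_def)

lemma card_block:
  assumes "distinct_lines d v" "only_nodes_triple d v" "i < d" "j < d" "i \<noteq> j"
  shows "card (block d v i j) = 2 \<or> card (block d v i j) = 3"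
proof -
  have "mult_at d v (cross (v i) (v j)) = card (block d v i j)"
    by (simp add: mult_at_def eval_lin_cross block_def)
  moreover have "2 \<le> card (block d v i j)"
    using card_mono[of "block d v i j" "{i,j}"] block_mem assms(3-5) by auto
  moreover have "cross (v i) (v j) \<noteq> 0"
    using cross_nonzero distinct_linesD[OF assms(1)] assms(3-5) by blast
  ultimately show ?thesis using assms(2) unfolding only_nodes_triple_def by fastforce
qed

text \<open>Both \<open>v k\<close> and \<open>v l\<close> lie in the pencil of \<open>v i\<close>
  and \<open>v j\<close>, so their cross product is a multiple of the old one. It is a nonzero
  multiple since the lines are distinct.\<close>

lemma block_eq:
  assumes v: "distinct_lines d v" and ij: "i < d" "j < d" "i \<noteq> j"
    and k: "k \<in> block d v i j" and l: "l \<in> block d v i j" and kl: "k \<noteq> l"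
  shows "block d v k l = block d v i j"
proof -
  obtain \<alpha> \<beta> where 1: "v k = scale3 \<alpha> (v i) + scale3 \<beta> (v j)"
    using in_span_of_det3[of "v i" "v j" "v k"] distinct_linesD[OF v] ij k by (auto simp: block_def)
  obtain \<gamma> \<delta> where 2: "v l = scale3 \<gamma> (v i) + scale3 \<delta> (v j)"
    using in_span_of_det3[of "v i" "v j" "v l"] distinct_linesD[OF v] ij l by (auto simp: block_def)
  have c: "cross (v k) (v l) = scale3 (\<alpha> * \<delta> - \<beta> * \<gamma>) (cross (v i) (v j))"
    unfolding 1 2 by (simp add: vec3_eq_iff algebra_simps)
  have "cross (v k) (v l) \<noteq> 0"
    using cross_nonzero distinct_linesD[OF v] k l kl by (auto simp: block_def)
  then have "\<alpha> * \<delta> - \<beta> * \<gamma> \<noteq> 0" using c by (auto simp: vec3_eq_iff)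
  moreover have "det3 (v k) (v l) w = (\<alpha> * \<delta> - \<beta> * \<gamma>) * det3 (v i) (v j) w" for w
    unfolding eval_lin_cross[symmetric] c by (simp add: eval_lin_eq algebra_simps)
  ultimately show ?thesis by (simp add: block_def)
qed

text \<open>The derivatives along the dual vectors of \<open>v i\<close> and \<open>v j\<close> are,
  for a node, the two forms themselves and, for a triple point, the two quadrics of
  \<open>codim_triple\<close>.\<close>

lemma codim_block:
  assumes v: "distinct_lines d v" and o: "only_nodes_triple d v" and ij: "i < d" "j < d" "i \<noteq> j"
  shows "codim_le (homog n) (jacobian_ideal (\<Prod>k\<in>block d v i j. lin_form (v k)))
     (if card (block d v i j) = 3 then 4 else 1)"
proof -
  let ?B = "block d v i j" and ?q = "\<Prod>k\<in>block d v i j. lin_form (v k)"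
  have J: "ideal3 (jacobian_ideal ?q)" by (rule ideal3_jacobian)
  have ui: "v i \<noteq> 0" "\<not> proportional (v i) (v j)" using distinct_linesD[OF v] ij by auto
  obtain t where t: "det3 (v i) (v j) t \<noteq> 0" using exists_third[OF ui] .
  obtain e e' where e: "eval_lin (v i) e = 1" "eval_lin (v j) e = 0" "eval_lin (v i) e' = 0" "eval_lin (v j) e' = 1"
    using exists_dual_vectors[OF ui] .
  have sub: "{i,j} \<subseteq> ?B" using block_mem ij by auto
  have mem: "dirderiv e ?q \<in> jacobian_ideal ?q" "dirderiv e' ?q \<in> jacobian_ideal ?q"
    by (rule dirderiv_in_jacobian)+
  from card_block[OF v o ij] show ?thesis
  proof
    assume c: "card ?B = 2"
    then have "?B = {i,j}" using sub ij(3) by (metis card_2_iff card_subset_eq finite_block)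
    then have q: "?q = lin_form (v i) * lin_form (v j)" using ij by simp
    have "lin_form (v j) \<in> jacobian_ideal ?q" "lin_form (v i) \<in> jacobian_ideal ?q"
      using mem by (simp_all add: q dirderiv_mult dirderiv_lin_form e)
    then show ?thesis using codim_node[OF t J] c by simp
  next
    assume c: "card ?B = 3"
    have "card (?B - {i,j}) = 1" using sub c ij(3) by (simp add: card_Diff_subset)
    then obtain k where "?B - {i,j} = {k}" by (auto simp: card_1_singleton_iff)
    then have k: "?B = {i,j,k}" "k \<noteq> i" "k \<noteq> j" using sub by auto
    have kd: "k < d" "det3 (v i) (v j) (v k) = 0" using k(1) by (auto simp: block_def)
    then obtain \<alpha> \<beta> where w: "v k = scale3 \<alpha> (v i) + scale3 \<beta> (v j)" using in_span_of_det3[OF ui] by blast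
    have "\<alpha> \<noteq> 0"
    proof
      assume "\<alpha> = 0"
      then have "proportional (v j) (v k)" unfolding proportional_scale3 by (auto simp: w vec3_eq_iff)
      then show False using distinct_linesD[OF v] ij kd k by auto
    qed
    have "\<beta> \<noteq> 0"
    proof
      assume "\<beta> = 0"
      then have "proportional (v i) (v k)" unfolding proportional_scale3 by (auto simp: w vec3_eq_iff)
      then show False using distinct_linesD[OF v] ij kd k by auto
    qed
    have q: "?q = lin_form (v i) * (lin_form (v j) * lin_form (v k))" using ij k by simp
    have ek: "eval_lin (v k) e = \<alpha>" "eval_lin (v k) e' = \<beta>"
    proof -
      have "eval_lin (v k) p = \<alpha> * eval_lin (v i) p + \<beta> * eval_lin (v j) p" for p
        by (simp add: w eval_lin_eq algebra_simps)
      then show "eval_lin (v k) e = \<alpha>" "eval_lin (v k) e' = \<beta>" using e by simp_all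
    qed
    have lk: "lin_form (v k) = C3 \<alpha> * lin_form (v i) + C3 \<beta> * lin_form (v j)"
      by (simp add: w lin_form_comb)
    have "lin_form (v j) * (2 * C3 \<alpha> * lin_form (v i) + C3 \<beta> * lin_form (v j)) = dirderiv e ?q"
      by (simp add: q dirderiv_mult dirderiv_lin_form e ek) (simp add: lk algebra_simps)
    moreover have "lin_form (v i) * (C3 \<alpha> * lin_form (v i) + 2 * C3 \<beta> * lin_form (v j)) = dirderiv e' ?q"
      by (simp add: q dirderiv_mult dirderiv_lin_form e ek) (simp add: lk algebra_simps)
    ultimately show ?thesis
      using codim_triple[OF t J \<open>\<alpha> \<noteq> 0\<close> \<open>\<beta> \<noteq> 0\<close>] mem c by simp
  qed
qed

section \<open>Counting singular points and bounding the number of lines\<close>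

definition blocks :: "nat \<Rightarrow> (nat \<Rightarrow> vec3) \<Rightarrow> nat set set" where
  "blocks d v = {block d v i j | i j. i < d \<and> j < d \<and> i \<noteq> j}"

definition nodes_count :: "nat \<Rightarrow> (nat \<Rightarrow> vec3) \<Rightarrow> nat" where
  "nodes_count d v = card {B \<in> blocks d v. card B = 2}"
definition triple_count :: "nat \<Rightarrow> (nat \<Rightarrow> vec3) \<Rightarrow> nat" where
  "triple_count d v = card {B \<in> blocks d v. card B = 3}"

lemma finite_blocks: "finite (blocks d v)"
  by (rule finite_subset[of _ "Pow {..<d}"]) (auto simp: blocks_def block_def)

lemma sum_blocks:
  fixes g :: "nat \<Rightarrow> nat"
  assumes "distinct_lines d v" "only_nodes_triple d v"
  shows "(\<Sum>B\<in>blocks d v. g (card B)) = nodes_count d v * g 2 + triple_count d v * g 3"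
proof -
  have "blocks d v = {B \<in> blocks d v. card B = 2} \<union> {B \<in> blocks d v. card B = 3}"
    using card_block[OF assms] by (auto simp: blocks_def)
  then have "(\<Sum>B\<in>blocks d v. g (card B)) =
    (\<Sum>B\<in>{B \<in> blocks d v. card B = 2} \<union> {B \<in> blocks d v. card B = 3}. g (card B))" by simp
  also have "\<dots> = (\<Sum>B\<in>{B \<in> blocks d v. card B = 2}. g (card B)) + (\<Sum>B\<in>{B \<in> blocks d v. card B = 3}. g (card B))"
    by (rule sum.union_disjoint) (use finite_blocks in auto)
  finally show ?thesis by (simp add: nodes_count_def triple_count_def)
qed

text \<open>Each ordered pair of distinct lines lies in exactly one block; a node accounts for 2
  such pairs, a triple point for 6.\<close>

lemma pair_count:
  assumes v: "distinct_lines d v" and o: "only_nodes_triple d v"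
  shows "2 * nodes_count d v + 6 * triple_count d v = d * (d - 1)"
proof -
  let ?P = "\<lambda>B. {(i,j). i \<in> B \<and> j \<in> B \<and> i \<noteq> (j::nat)}"
  have cardP: "card (?P B) = card B * (card B - 1)" if "finite B" for B
  proof -
    have "?P B = (SIGMA i:B. B - {i})" by auto
    then have "card (?P B) = card (SIGMA i:B. B - {i})" by simp
    also have "\<dots> = (\<Sum>i\<in>B. card (B - {i}))" using that by simp
    also have "\<dots> = card B * (card B - 1)" using that by simp
    finally show ?thesis .
  qed
  have U: "?P {..<d} = (\<Union>B\<in>blocks d v. ?P B)"
  proof (intro equalityI subsetI)
    fix x assume "x \<in> ?P {..<d}"
    then obtain i j where x: "x = (i,j)" "i < d" "j < d" "i \<noteq> j" by auto
    then show "x \<in> (\<Union>B\<in>blocks d v. ?P B)"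
      using block_mem[of i d v j] block_mem[of j d v i] by (auto simp: blocks_def intro!: exI[of _ "block d v i j"] block_mem)
  qed (auto simp: blocks_def block_def)
  have "d * (d - 1) = card (?P {..<d})" using cardP[of "{..<d}"] by simp
  also have "\<dots> = (\<Sum>B\<in>blocks d v. card (?P B))" unfolding U
  proof (rule card_UN_disjoint)
    show "finite (blocks d v)" by (rule finite_blocks)
    show "\<forall>B\<in>blocks d v. finite (?P B)"
    proof
      fix B assume "B \<in> blocks d v"
      then have "finite (B \<times> B)" by (auto simp: blocks_def)
      then show "finite (?P B)" by (rule rev_finite_subset) auto
    qed
    show "\<forall>B\<in>blocks d v. \<forall>B'\<in>blocks d v. B \<noteq> B' \<longrightarrow> ?P B \<inter> ?P B' = {}"
    proof (intro ballI impI)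
      fix B B' assume B: "B \<in> blocks d v" "B' \<in> blocks d v" "B \<noteq> B'"
      have "block d v k l = C" if "C \<in> blocks d v" "k \<in> C" "l \<in> C" "k \<noteq> l" for C k l
      proof -
        from that(1) obtain i j where C: "C = block d v i j" "i < d" "j < d" "i \<noteq> j" by (auto simp: blocks_def)
        show ?thesis unfolding C(1) by (rule block_eq[OF v C(2-4)]) (use that C(1) in auto)
      qed
      from this[OF B(1)] this[OF B(2)] B(3) show "?P B \<inter> ?P B' = {}" by fast
    qed
  qed
  also have "\<dots> = (\<Sum>B\<in>blocks d v. card B * (card B - 1))"
    by (rule sum.cong[OF refl cardP]) (auto simp: blocks_def)
  also have "\<dots> = nodes_count d v * 2 + triple_count d v * 6"
    using sum_blocks[OF v o, of "\<lambda>n. n * (n - 1)"] by simp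
  finally show ?thesis by simp
qed

theorem nearly_free_bound:
  assumes v: "distinct_lines d v" and o: "only_nodes_triple d v" and d: "d = Suc e"
    and nf: "dimN (arrangement_poly d v) k \<le> 1"
  shows "card {m. tdeg m = k} \<le> nodes_count d v + 4 * triple_count d v + 1 + 3 * card {m. tdeg m = k - e}"
proof -
  let ?f = "arrangement_poly d v"
  let ?W = "\<Inter>B\<in>blocks d v. jacobian_ideal (\<Prod>k\<in>B. lin_form (v k))"
  have "codim_le (homog k) ?W (\<Sum>B\<in>blocks d v. if card B = 3 then 4 else 1)"
  proof (rule codim_le_INTER[OF finite_blocks subspace_homog])
    fix B assume "B \<in> blocks d v"
    then obtain i j where "B = block d v i j" "i < d" "j < d" "i \<noteq> j" by (auto simp: blocks_def)
    then show "codim_le (homog k) (jacobian_ideal (\<Prod>k\<in>B. lin_form (v k))) (if card B = 3 then 4 else 1)"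
      using codim_block[OF v o] by simp
  qed (intro ideal3_subspace ideal3_jacobian)
  then have "codim_le (homog k) ?W (nodes_count d v + 4 * triple_count d v)"
    using sum_blocks[OF v o, of "\<lambda>n. if n = 3 then 4 else 1"] by (simp add: mult.commute)
  moreover have "poly3.subspace ?W"
    by (rule poly3.subspace_Inter) (auto intro: ideal3_subspace ideal3_jacobian)
  ultimately have "card {m. tdeg m = k} \<le> poly3.dim (?W \<inter> homog k) + (nodes_count d v + 4 * triple_count d v)"
    by (rule codim_le_dim)
  also have "poly3.dim (?W \<inter> homog k) \<le> poly3.dim (sat_jacobian ?f \<inter> homog k)"
  proof -
    have "?W \<subseteq> sat_jacobian ?f"
    proof
      fix h assume h: "h \<in> ?W"
      show "h \<in> sat_jacobian ?f" unfolding arrangement_poly_def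
      proof (rule local_to_saturation)
        fix i j assume ij: "i \<in> {..<d}" "j \<in> {..<d}" "i \<noteq> j"
        have "{k \<in> {..<d}. det3 (v i) (v j) (v k) = 0} = block d v i j" by (auto simp: block_def)
        moreover have "block d v i j \<in> blocks d v" using ij by (auto simp: blocks_def)
        ultimately show "h \<in> jacobian_ideal (\<Prod>k\<in>{k \<in> {..<d}. det3 (v i) (v j) (v k) = 0}. lin_form (v k))"
          using h by simp
      qed (use d distinct_linesD[OF v] in auto)
    qed
    moreover obtain E where E: "E \<subseteq> sat_jacobian ?f \<inter> homog k" "poly3.independent E"
      "sat_jacobian ?f \<inter> homog k \<subseteq> poly3.span E" "card E = poly3.dim (sat_jacobian ?f \<inter> homog k)"
      using poly3.basis_exists by blast
    moreover have "finite E"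
    proof -
      have "homog k \<subseteq> poly3.span ((\<lambda>m. Poly_Mapping.single m 1) ` {m. tdeg m = k})"
        by (intro homog_subset_span poly3.span_base) auto
      then show ?thesis using poly3.independent_span_bound[OF _ E(2)] E(1) finite_tdeg by blast
    qed
    ultimately show ?thesis using poly3.dim_le_card[of "?W \<inter> homog k" E] by auto
  qed
  \<comment> \<open>The truncated difference in \<open>dimN\<close> still yields this
    inequality.\<close>
  also have "poly3.dim (sat_jacobian ?f \<inter> homog k) \<le> poly3.dim (jacobian_ideal ?f \<inter> homog k) + 1"
    using nf unfolding dimN_def by linarith
  also have "poly3.dim (jacobian_ideal ?f \<inter> homog k) \<le> 3 * card {m. tdeg m = k - e}"
    by (rule dim_jacobian_homog) (use prod_lin_form_homog[of "{..<d}" v] d in \<open>simp add: arrangement_poly_def\<close>)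
  finally show ?thesis by simp
qed

theorem degree_bound:
  assumes v: "distinct_lines d v" and o: "only_nodes_triple d v"
    and nf: "\<And>k. dimN (arrangement_poly d v) k \<le> 1"
  shows "d \<le> 10" "d = 10 \<Longrightarrow> nodes_count d v = 0" "d = 9 \<Longrightarrow> nodes_count d v = 0 \<or> nodes_count d v = 3"
proof -
  define N T where "N = nodes_count d v" and "T = triple_count d v"
  have pc: "2 * N + 6 * T = d * (d - 1)" using pair_count[OF v o] by (simp add: N_def T_def)
  have bound: "(k + 1) * (k + 2) \<le> 2 * N + 8 * T + 2 + 3 * ((k - (d - 1) + 1) * (k - (d - 1) + 2))" if "d \<ge> 1" for k
    using nearly_free_bound[OF v o, of "d - 1" k] nf[of k] that card_tdeg[of k] card_tdeg[of "k - (d - 1)"]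
    by (simp add: N_def T_def)
  have that_q: "\<exists>q. r = q + 4" if "r \<ge> 4" for r :: nat
    using that by (intro exI[of _ "r - 4"]) simp
  have odd: "s \<le> 4" "s = 4 \<Longrightarrow> N = 0 \<or> N = 3" if d: "d = 2 * s + 1" "s \<ge> 1" for s
  proof -
    define r where "r = s - 1"
    have s: "s = r + 1" using d by (simp add: r_def)
    have e: "3 * r + 2 - (d - 1) = r" using d s by auto
    \<comment> \<open>For odd d the maximum is attained at two neighbouring integers, of which k =
      3r + 2 is the larger; here d = 2r + 3.\<close>
    have 1: "(3 * r + 2 + 1) * (3 * r + 2 + 2) \<le> 2 * N + 8 * T + 2 + 3 * ((r + 1) * (r + 2))"
      using bound[of "3 * r + 2", unfolded e] d by simp
    have 2: "2 * N + 6 * T = (2 * r + 3) * (2 * r + 2)" using pc d s by (simp add: algebra_simps)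
    \<comment> \<open>Eliminating T between the two relations leaves r^2 - 2r - 6 + N \<le> 0.
      Substituting r = q + 4 gives q^2 + 6q + 2 + N \<le> 0, where all coefficients are
      positive.\<close>
    show "s \<le> 4"
    proof (rule ccontr)
      assume "\<not> s \<le> 4"
      then obtain q where q: "r = q + 4" using s that_q[of r] by auto
      show False using 1 2 unfolding q by (simp add: algebra_simps)
    qed
    show "N = 0 \<or> N = 3" if "s = 4"
    proof -
      have "r = 3" using that s by simp
      \<comment> \<open>The inequality gives N \<le> 3, and N + 3T = 36 makes N divisible by
        3.\<close>
      then show ?thesis using 1 2 by simp presburger
    qed
  qed
  have even: "s \<le> 4" "s = 4 \<Longrightarrow> N = 0" if d: "d = 2 * s + 2" "s \<ge> 1" for s
  proof -
    define r where "r = s - 1"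
    have s: "s = r + 1" using d by (simp add: r_def)
    have e: "3 * r + 3 - (d - 1) = r" using d s by auto
    have 1: "(3 * r + 3 + 1) * (3 * r + 3 + 2) \<le> 2 * N + 8 * T + 2 + 3 * ((r + 1) * (r + 2))"
      using bound[of "3 * r + 3", unfolded e] d by simp
    have 2: "2 * N + 6 * T = (2 * r + 4) * (2 * r + 3)" using pc d s by (simp add: algebra_simps)
    \<comment> \<open>Here d = 2r + 4, and eliminating T leaves (r - 3)(r + 2) + N \<le> 0, which at
      r = 3 also forces N = 0.\<close>
    show "s \<le> 4"
    proof (rule ccontr)
      assume "\<not> s \<le> 4"
      then obtain q where q: "r = q + 4" using s that_q[of r] by auto
      show False using 1 2 unfolding q by (simp add: algebra_simps)
    qed
    show "N = 0" if "s = 4"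
    proof -
      have "r = 3" using that s by simp
      then show ?thesis using 1 2 by simp
    qed
  qed
  show "d \<le> 10"
  proof (cases "even d")
    case True
    then obtain t where t: "d = 2 * t" by blast
    then have "t \<ge> 2 \<Longrightarrow> d = 2 * (t - 1) + 2 \<and> 1 \<le> t - 1" by presburger
    then show ?thesis using even(1)[of "t - 1"] t by (cases "t \<ge> 2") auto
  next
    case False
    then obtain t where "d = 2 * t + 1" by (rule oddE)
    then show ?thesis using odd(1)[of t] by (cases "t \<ge> 1") auto
  qed
  show "d = 10 \<Longrightarrow> nodes_count d v = 0" using even(2)[of 4] by (simp add: N_def)
  show "d = 9 \<Longrightarrow> nodes_count d v = 0 \<or> nodes_count d v = 3" using odd(2)[of 4] by (simp add: N_def)
qed

section \<open>Saito's criterion and saturation\<close>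

definition subst3 :: "poly3 \<Rightarrow> poly3 \<Rightarrow> poly3 \<Rightarrow> poly3 \<Rightarrow> poly3" where
  "subst3 a b c p = (\<Sum>m\<in>Poly_Mapping.keys p. C3 (Poly_Mapping.lookup p m) * (a ^ fst m * b ^ fst (snd m) * c ^ snd (snd m)))"

lemma subst3_add: "subst3 a b c (p + q) = subst3 a b c p + subst3 a b c q"
  unfolding subst3_def
  by (rule setsum_keys_plus_distrib) (simp_all add: C3_hom algebra_simps)

lemma subst3_single: "subst3 a b c (Poly_Mapping.single m e) = C3 e * (a ^ fst m * b ^ fst (snd m) * c ^ snd (snd m))"
  by (simp add: subst3_def)

lemma subst3_0 [simp]: "subst3 a b c 0 = 0"
  by (simp add: subst3_def)

lemma subst3_mult: "subst3 a b c (p * q) = subst3 a b c p * subst3 a b c q"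
proof (induction p rule: poly_mapping_induct)
  case (single m e)
  show ?case
    by (induction q rule: poly_mapping_induct)
       (simp_all add: subst3_single subst3_add mult_single C3_mult power_add algebra_simps)
qed (simp_all add: subst3_add algebra_simps)

lemma subst3_var: "subst3 a b c var_x = a" "subst3 a b c var_y = b" "subst3 a b c var_z = c" "subst3 a b c (C3 e) = C3 e"
  by (simp_all add: subst3_single var_x_def var_y_def var_z_def C3_def[of e])

lemma subst3_lin_form: "subst3 a b c (lin_form v) = C3 (xc v) * a + C3 (yc v) * b + C3 (zc v) * c"
  by (simp add: lin_form_eq subst3_add subst3_mult subst3_var)

text \<open>The substitution a, b, c is the inverse coordinate change from Cramer's rule. It turns
  questions about two distinct lines into questions about the variables x and y.\<close>

lemma lin_form_inverse:
  assumes "det3 u v w \<noteq> 0"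
  obtains a b c where "subst3 a b c (lin_form u) = var_x" "subst3 a b c (lin_form v) = var_y"
    "\<And>p. subst3 (lin_form u) (lin_form v) (lin_form w) (subst3 a b c p) = p"
proof -
  let ?l = "C3 (1 / det3 u v w)"
  have l: "?l * C3 (det3 u v w) = 1" using assms by (simp add: C3_mult[symmetric])
  define a where "a = ?l * (C3 (xc (cross v w)) * var_x + C3 (xc (cross w u)) * var_y + C3 (xc (cross u v)) * var_z)"
  define b where "b = ?l * (C3 (yc (cross v w)) * var_x + C3 (yc (cross w u)) * var_y + C3 (yc (cross u v)) * var_z)"
  define c where "c = ?l * (C3 (zc (cross v w)) * var_x + C3 (zc (cross w u)) * var_y + C3 (zc (cross u v)) * var_z)"
  have "subst3 a b c (lin_form u) = (?l * C3 (det3 u v w)) * var_x"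
    unfolding subst3_lin_form a_def b_def c_def det3_def by (simp add: C3_hom algebra_simps)
  moreover have "subst3 a b c (lin_form v) = (?l * C3 (det3 u v w)) * var_y"
    unfolding subst3_lin_form a_def b_def c_def det3_def by (simp add: C3_hom algebra_simps)
  moreover have "subst3 (lin_form u) (lin_form v) (lin_form w) (subst3 a b c p) = p" for p
  proof (induction p rule: poly_mapping_induct)
    case (single m e)
    have lx: "subst3 (lin_form u) (lin_form v) (lin_form w) a = (?l * C3 (det3 u v w)) * var_x"
      unfolding mult.assoc cramer_var by (simp add: a_def subst3_add subst3_mult subst3_var)
    have ly: "subst3 (lin_form u) (lin_form v) (lin_form w) b = (?l * C3 (det3 u v w)) * var_y"
      unfolding mult.assoc cramer_var by (simp add: b_def subst3_add subst3_mult subst3_var)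
    have lz: "subst3 (lin_form u) (lin_form v) (lin_form w) c = (?l * C3 (det3 u v w)) * var_z"
      unfolding mult.assoc cramer_var by (simp add: c_def subst3_add subst3_mult subst3_var)
    have pw: "subst3 x y z (p ^ n) = subst3 x y z p ^ n" for x y z p n
      using subst3_var(4)[of x y z 1] by (induction n) (simp_all add: subst3_mult)
    have xp: "var_x ^ n = Poly_Mapping.single (n,0,0) 1" "var_y ^ n = Poly_Mapping.single (0,n,0) 1"
      "var_z ^ n = Poly_Mapping.single (0,0,n) 1" for n
      by (induction n) (simp_all add: var_x_def var_y_def var_z_def mult_single flip: zero_prod_def)
    show ?case
      by (simp add: subst3_single subst3_mult subst3_var pw lx ly lz l)
         (simp add: xp C3_def mult_single)
  qed (simp_all add: subst3_add)
  ultimately show ?thesis using that l by simp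
qed

section \<open>Regular sequences and the Koszul complex\<close>

lemma lookup_single_times:
  fixes p :: poly3
  shows "Poly_Mapping.lookup (Poly_Mapping.single m c * p) (m + n) = c * Poly_Mapping.lookup p n"
proof (induction p rule: poly_mapping_induct)
  case (single k e)
  show ?case by (simp only: mult_single lookup_single) (auto simp: when_def simp del: add_Pair)
qed (simp_all add: algebra_simps lookup_add)

lemma lookup_single_times_0:
  fixes p :: poly3
  assumes "\<And>n. k \<noteq> m + n"
  shows "Poly_Mapping.lookup (Poly_Mapping.single m c * p) k = 0"
proof (induction p rule: poly_mapping_induct)
  case (single n e)
  then show ?case using assms[of n] by (simp only: mult_single lookup_single) (auto simp: when_def simp del: add_Pair)
qed (simp_all add: algebra_simps lookup_add)

lemma in_ideal3_by_keys:
  assumes "ideal3 A" "\<And>m. Poly_Mapping.lookup p m \<noteq> 0 \<Longrightarrow> Poly_Mapping.single m 1 \<in> A"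
  shows "p \<in> A"
proof -
  have "(\<Sum>m\<in>Poly_Mapping.keys p. Poly_Mapping.single m (Poly_Mapping.lookup p m)) \<in> A"
  proof (rule poly3.subspace_sum[OF ideal3_subspace[OF assms(1)]])
    fix m assume "m \<in> Poly_Mapping.keys p"
    then have "Poly_Mapping.single m 1 \<in> A" using assms(2) by (simp add: in_keys_iff)
    from ideal3D(3)[OF assms(1) this, of "C3 (Poly_Mapping.lookup p m)"]
    show "Poly_Mapping.single m (Poly_Mapping.lookup p m) \<in> A" by (simp add: C3_def mult_single)
  qed
  then show ?thesis using poly_mapping_sum_single[of p] by simp
qed

lemma ideal3_dvd: "ideal3 {p. a dvd p}"
  by (auto simp: ideal3_def)

lemma var_x_dvd:
  assumes "\<And>j k. Poly_Mapping.lookup u (0,j,k) = 0"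
  shows "var_x dvd u"
proof -
  have "u \<in> {p. var_x dvd p}"
  proof (rule in_ideal3_by_keys[OF ideal3_dvd])
    fix m assume m: "Poly_Mapping.lookup u m \<noteq> 0"
    obtain i j k where ijk: "m = (i,j,k)" by (metis prod_cases3)
    then obtain n where "i = Suc n" using m assms by (cases i) auto
    then have "Poly_Mapping.single m 1 = var_x * Poly_Mapping.single (n,j,k) 1"
      by (simp add: ijk var_x_def mult_single)
    then show "Poly_Mapping.single m 1 \<in> {p. var_x dvd p}" by simp
  qed
  then show ?thesis by simp
qed

text \<open>The monomials of u without x reappear, shifted by y, on the right of the equation, where
  the left-hand side has none.\<close>

lemma var_x_var_y_regular:
  assumes "var_x * w = var_y * u"
  shows "var_x dvd u"
proof (rule var_x_dvd)
  fix j k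
  have "Poly_Mapping.lookup u (0,j,k) = Poly_Mapping.lookup (var_y * u) ((0,1,0) + (0,j,k))"
    unfolding var_y_def lookup_single_times by simp
  also have "\<dots> = Poly_Mapping.lookup (var_x * w) (0, j + 1, k)" by (simp add: assms)
  also have "\<dots> = 0" unfolding var_x_def by (rule lookup_single_times_0) auto
  finally show "Poly_Mapping.lookup u (0,j,k) = 0" .
qed

text \<open>A pure power of z in p would survive on the left but cannot occur on the right; all
  other monomials lie in (x, y).\<close>

lemma var_z_regular_mod:
  assumes "var_z * p = var_y * q - var_x * r"
  obtains s t where "p = var_y * s - var_x * t"
proof -
  let ?A = "{var_y * s - var_x * t | s t. True}"
  have A: "ideal3 ?A"
    unfolding ideal3_def
  proof (intro conjI ballI allI)
    show "0 \<in> ?A" by (auto intro!: exI[of _ 0])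
  next
    fix a b assume "a \<in> ?A" "b \<in> ?A"
    then obtain s t s' t' where "a = var_y * s - var_x * t" "b = var_y * s' - var_x * t'" by blast
    then have "a + b = var_y * (s + s') - var_x * (t + t')" by (simp only:) (simp add: algebra_simps)
    then show "a + b \<in> ?A" by blast
  next
    fix a r assume "a \<in> ?A"
    then obtain s t where "a = var_y * s - var_x * t" by blast
    then have "r * a = var_y * (r * s) - var_x * (r * t)" by (simp only:) (simp add: algebra_simps)
    then show "r * a \<in> ?A" by blast
  qed
  have "p \<in> ?A"
  proof (rule in_ideal3_by_keys[OF A])
    fix m assume m: "Poly_Mapping.lookup p m \<noteq> 0"
    obtain i j k where ijk: "m = (i,j,k)" by (metis prod_cases3)
    have "i \<noteq> 0 \<or> j \<noteq> 0"
    proof (rule ccontr)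
      assume "\<not> (i \<noteq> 0 \<or> j \<noteq> 0)"
      then have "Poly_Mapping.lookup p m = Poly_Mapping.lookup (var_z * p) ((0,0,1) + (0,0,k))"
        unfolding var_z_def lookup_single_times by (simp add: ijk)
      also have "\<dots> = Poly_Mapping.lookup (var_y * q) (0,0,k+1) - Poly_Mapping.lookup (var_x * r) (0,0,k+1)"
        by (simp add: assms lookup_minus)
      also have "Poly_Mapping.lookup (var_y * q) (0,0,k+1) = 0"
        unfolding var_y_def by (rule lookup_single_times_0) auto
      also have "Poly_Mapping.lookup (var_x * r) (0,0,k+1) = 0"
        unfolding var_x_def by (rule lookup_single_times_0) auto
      finally show False using m by simp
    qed
    then show "Poly_Mapping.single m 1 \<in> ?A"
    proof
      assume "i \<noteq> 0"
      then obtain n where "i = Suc n" by (cases i) auto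
      then have "Poly_Mapping.single m 1 = var_y * 0 - var_x * (- Poly_Mapping.single (n,j,k) 1)"
        by (simp add: ijk var_x_def mult_single)
      then show ?thesis by blast
    next
      assume "j \<noteq> 0"
      then obtain n where "j = Suc n" by (cases j) auto
      then have "Poly_Mapping.single m 1 = var_y * (Poly_Mapping.single (i,n,k) 1) - var_x * 0"
        by (simp add: ijk var_y_def mult_single)
      then show ?thesis by blast
    qed
  qed
  then show ?thesis using that by blast
qed

lemma var_nonzero: "var_x \<noteq> 0" "var_y \<noteq> 0" "var_z \<noteq> 0"
  by (simp_all add: var_x_def var_y_def var_z_def flip: keys_eq_empty)

text \<open>The first syzygies of the regular sequence x, y, z are the Koszul ones: regularity of z
  modulo (x, y) produces s and t, regularity of y modulo x produces w.\<close>

lemma koszul_exact: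
  assumes "var_z * p - var_y * q + var_x * r = 0"
  obtains s t w where "p = var_y * s - var_x * t" "q = var_z * s - var_x * w" "r = var_z * t - var_y * w"
proof -
  have "var_z * p = var_y * q - var_x * r" using assms by (simp add: algebra_simps)
  then obtain s t where p: "p = var_y * s - var_x * t" by (rule var_z_regular_mod)
  have 1: "var_x * (var_z * t - r) = var_y * (var_z * s - q)" using assms by (simp add: p algebra_simps)
  then obtain w where w: "var_z * s - q = var_x * w" using var_x_var_y_regular by (metis dvdE)
  have "var_x * (var_z * t - r) = var_x * (var_y * w)" using 1 by (simp add: w algebra_simps)
  then have "var_z * t - r = var_y * w" using var_nonzero by simp
  then show ?thesis using that[of s t w] p w by (simp add: algebra_simps)
qed

section \<open>Divisibility by products of distinct lines\<close>

lemma lin_form_nonzero: "v \<noteq> 0 \<Longrightarrow> lin_form v \<noteq> 0"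
proof
  assume v: "v \<noteq> 0" "lin_form v = 0"
  then have "pd_x (lin_form v) = 0" "pd_y (lin_form v) = 0" "pd_z (lin_form v) = 0" by simp_all
  then show False using v(1) by (simp add: pd_lin_form vec3_eq_iff)
qed

lemma lin_form_regular:
  assumes "u \<noteq> 0" "\<not> proportional u v" "lin_form u dvd lin_form v * p"
  shows "lin_form u dvd p"
proof -
  obtain w where "det3 u v w \<noteq> 0" using exists_third assms by blast
  then obtain a b c where s: "subst3 a b c (lin_form u) = var_x" "subst3 a b c (lin_form v) = var_y"
    "\<And>p. subst3 (lin_form u) (lin_form v) (lin_form w) (subst3 a b c p) = p"
    by (rule lin_form_inverse) blast
  obtain q where "lin_form v * p = lin_form u * q" using assms(3) by (rule dvdE)
  from arg_cong[OF this, of "subst3 a b c"] have "var_x * subst3 a b c q = var_y * subst3 a b c p"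
    by (simp add: subst3_mult s)
  then obtain r where "subst3 a b c p = var_x * r" using var_x_var_y_regular by (metis dvdE)
  from arg_cong[OF this, of "subst3 (lin_form u) (lin_form v) (lin_form w)"]
  show ?thesis by (simp add: s subst3_mult subst3_var)
qed

lemma lin_form_dvd_prod_cancel:
  assumes "finite G" "u \<noteq> 0" "\<And>j. j \<in> G \<Longrightarrow> \<not> proportional u (v j)" "lin_form u dvd (\<Prod>j\<in>G. lin_form (v j)) * p"
  shows "lin_form u dvd p"
  using assms
proof (induction G arbitrary: p)
  case (insert j G)
  have "lin_form u dvd (\<Prod>j\<in>G. lin_form (v j)) * (lin_form (v j) * p)"
    using insert.prems(3) insert.hyps by (simp add: algebra_simps)
  then have "lin_form u dvd lin_form (v j) * p" using insert by blast
  then show ?case using lin_form_regular insert.prems by blast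
qed simp

lemma prod_lin_form_dvd:
  assumes "finite G" "\<And>i. i \<in> G \<Longrightarrow> v i \<noteq> 0" "\<And>i j. i \<in> G \<Longrightarrow> j \<in> G \<Longrightarrow> i \<noteq> j \<Longrightarrow> \<not> proportional (v i) (v j)"
    "\<And>i. i \<in> G \<Longrightarrow> lin_form (v i) dvd p"
  shows "(\<Prod>i\<in>G. lin_form (v i)) dvd p"
  using assms
proof (induction G)
  case (insert i G)
  then obtain q where q: "p = (\<Prod>i\<in>G. lin_form (v i)) * q" by (auto elim: dvdE)
  have "lin_form (v i) dvd (\<Prod>i\<in>G. lin_form (v i)) * q" using insert.prems(3)[of i] q by simp
  then have "lin_form (v i) dvd q"
    using lin_form_dvd_prod_cancel[of G "v i" v q] insert by auto
  then show ?case using q insert.hyps by (simp add: mult.commute mult_dvd_mono)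
qed simp

text \<open>Derivations of S, given by their coefficients. \<open>vpair v \<theta>\<close> is the
  value of \<theta> on the form of v; \<theta> is logarithmic when each line divides its own value.
  \<open>pdet\<close> is the coefficient determinant in Saito's criterion.\<close>

type_synonym pvec = "poly3 \<times> poly3 \<times> poly3"

definition vpair :: "vec3 \<Rightarrow> pvec \<Rightarrow> poly3" where
  "vpair v \<theta> = C3 (xc v) * fst \<theta> + C3 (yc v) * fst (snd \<theta>) + C3 (zc v) * snd (snd \<theta>)"

definition act :: "pvec \<Rightarrow> poly3 \<Rightarrow> poly3" where
  "act \<theta> p = fst \<theta> * pd_x p + fst (snd \<theta>) * pd_y p + snd (snd \<theta>) * pd_z p"

definition pdet :: "pvec \<Rightarrow> pvec \<Rightarrow> pvec \<Rightarrow> poly3" where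
  "pdet u v w = fst u * (fst (snd v) * snd (snd w) - snd (snd v) * fst (snd w))
     + fst (snd u) * (snd (snd v) * fst w - fst v * snd (snd w))
     + snd (snd u) * (fst v * fst (snd w) - fst (snd v) * fst w)"

definition pscale :: "poly3 \<Rightarrow> pvec \<Rightarrow> pvec" where
  "pscale p \<theta> = (p * fst \<theta>, p * fst (snd \<theta>), p * snd (snd \<theta>))"

definition eulerv :: pvec where "eulerv = (var_x, var_y, var_z)"

lemma pscale_simps [simp]: "fst (pscale p \<theta>) = p * fst \<theta>" "fst (snd (pscale p \<theta>)) = p * fst (snd \<theta>)"
  "snd (snd (pscale p \<theta>)) = p * snd (snd \<theta>)"
  by (simp_all add: pscale_def)

lemma pvec_eq_iff: "v = w \<longleftrightarrow> fst v = fst w \<and> fst (snd v) = fst (snd w) \<and> snd (snd v) = snd (snd w)" for v w :: pvec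
  by (simp add: prod_eq_iff)

lemma act_mult: "act \<theta> (p * q) = p * act \<theta> q + q * act \<theta> p"
  by (simp add: act_def derivation3D(2)[OF derivation_pd(1)] derivation3D(2)[OF derivation_pd(2)]
      derivation3D(2)[OF derivation_pd(3)] algebra_simps)

lemma act_lin_form: "act \<theta> (lin_form v) = vpair v \<theta>"
  by (simp add: act_def pd_lin_form vpair_def algebra_simps)

lemma act_add: "act (\<theta> + \<eta>) p = act \<theta> p + act \<eta> p"
  and act_diff: "act (\<theta> - \<eta>) p = act \<theta> p - act \<eta> p"
  and act_pscale: "act (pscale r \<theta>) p = r * act \<theta> p"
  by (simp_all add: act_def algebra_simps)

lemma act_eulerv: "act eulerv p = euler3 p"
  by (simp add: act_def eulerv_def euler3_def)

lemma vpair_eulerv: "vpair v eulerv = lin_form v"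
  by (simp add: vpair_def eulerv_def lin_form_eq)

lemma act_1: "act \<theta> 1 = 0"
  using derivation3D(4)[OF derivation_pd(1)] derivation3D(4)[OF derivation_pd(2)] derivation3D(4)[OF derivation_pd(3)]
  by (simp add: act_def)

lemma dvd_act:
  assumes "finite G" "\<And>i. i \<in> G \<Longrightarrow> lin_form (v i) dvd vpair (v i) \<theta>"
  shows "(\<Prod>i\<in>G. lin_form (v i)) dvd act \<theta> (\<Prod>i\<in>G. lin_form (v i))"
  using assms
proof (induction G)
  case empty
  then show ?case by simp
next
  case (insert i G)
  then show ?case by (simp add: act_mult act_lin_form)
qed

text \<open>By the product rule the form of line i divides the cofactor times its own derivative,
  and it is coprime to the cofactor. Thus syzygies of the partial derivatives are
  logarithmic.\<close>

lemma act_zero_dvd: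
  assumes G: "finite G" "i \<in> G" and nz: "v i \<noteq> 0" and np: "\<And>j. j \<in> G \<Longrightarrow> i \<noteq> j \<Longrightarrow> \<not> proportional (v i) (v j)"
    and a: "act \<theta> (\<Prod>i\<in>G. lin_form (v i)) = 0"
  shows "lin_form (v i) dvd vpair (v i) \<theta>"
proof (rule lin_form_dvd_prod_cancel[of "G - {i}"])
  have "(\<Prod>j\<in>G. lin_form (v j)) = lin_form (v i) * (\<Prod>j\<in>G - {i}. lin_form (v j))"
    using G by (simp add: prod.remove)
  with a have "lin_form (v i) * act \<theta> (\<Prod>j\<in>G - {i}. lin_form (v j)) + (\<Prod>j\<in>G - {i}. lin_form (v j)) * vpair (v i) \<theta> = 0"
    by (simp add: act_mult act_lin_form)
  then have "(\<Prod>j\<in>G - {i}. lin_form (v j)) * vpair (v i) \<theta> = lin_form (v i) * (- act \<theta> (\<Prod>j\<in>G - {i}. lin_form (v j)))"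
    by (simp add: eq_neg_iff_add_eq_0 add.commute)
  then show "lin_form (v i) dvd (\<Prod>j\<in>G - {i}. lin_form (v j)) * vpair (v i) \<theta>" by simp
qed (use G nz np in auto)

text \<open>Each coordinate of v times the determinant is a combination of the three pairings with
  v, and some coordinate is invertible.\<close>

lemma dvd_pdet:
  assumes v: "v \<noteq> 0" and d: "l dvd vpair v X" "l dvd vpair v Y" "l dvd vpair v Z"
  shows "l dvd pdet X Y Z"
proof -
  obtain x y z where e: "vpair v X = l * x" "vpair v Y = l * y" "vpair v Z = l * z" using d by (metis dvdE)
  have c: "l dvd pdet X Y Z" if "C3 c * pdet X Y Z = vpair v X * p + vpair v Y * q + vpair v Z * r" "c \<noteq> 0" for c p q r
  proof -
    have "l dvd C3 c * pdet X Y Z" unfolding that(1) e by simp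
    then have "l dvd C3 (inverse c) * (C3 c * pdet X Y Z)" by (rule dvd_mult)
    then show ?thesis using C3_inverse[OF that(2)] by (simp add: mult.assoc[symmetric])
  qed
  have 1: "C3 (xc v) * pdet X Y Z = vpair v X * (fst (snd Y) * snd (snd Z) - snd (snd Y) * fst (snd Z))
     + vpair v Y * (fst (snd Z) * snd (snd X) - snd (snd Z) * fst (snd X))
     + vpair v Z * (fst (snd X) * snd (snd Y) - snd (snd X) * fst (snd Y))"
    by (simp add: vpair_def pdet_def algebra_simps)
  have 2: "C3 (yc v) * pdet X Y Z = vpair v X * (snd (snd Y) * fst Z - fst Y * snd (snd Z))
     + vpair v Y * (snd (snd Z) * fst X - fst Z * snd (snd X))
     + vpair v Z * (snd (snd X) * fst Y - fst X * snd (snd Y))"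
    by (simp add: vpair_def pdet_def algebra_simps)
  have 3: "C3 (zc v) * pdet X Y Z = vpair v X * (fst Y * fst (snd Z) - fst (snd Y) * fst Z)
     + vpair v Y * (fst Z * fst (snd X) - fst (snd Z) * fst X)
     + vpair v Z * (fst X * fst (snd Y) - fst (snd X) * fst Y)"
    by (simp add: vpair_def pdet_def algebra_simps)
  from v have "xc v \<noteq> 0 \<or> yc v \<noteq> 0 \<or> zc v \<noteq> 0" by (auto simp: vec3_eq_iff)
  then show ?thesis using c[OF 1] c[OF 2] c[OF 3] by blast
qed

lemma pdet_cramer:
  "pscale (pdet X Y Z) W = pscale (pdet W Y Z) X + pscale (pdet X W Z) Y + pscale (pdet X Y W) Z"
  by (simp add: pvec_eq_iff pdet_def algebra_simps)

text \<open>Induction on the power: if all monomials of degree N + 1 carry h into J, then the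
  hypothesis applies to every monomial of degree N times h.\<close>

lemma saturated_if_irrelevant_torsion_free:
  assumes J: "ideal3 J" and h: "\<And>h. var_x * h \<in> J \<Longrightarrow> var_y * h \<in> J \<Longrightarrow> var_z * h \<in> J \<Longrightarrow> h \<in> J"
  shows "saturation J = J"
proof
  have "h \<in> J" if "\<forall>m. tdeg m = N \<longrightarrow> Poly_Mapping.single m 1 * h \<in> J" for N h
    using that
  proof (induction N)
    case 0
    from this[rule_format, of 0] have "Poly_Mapping.single 0 1 * h \<in> J" by (simp add: tdeg_def)
    then show ?case by simp
  next
    case (Suc N)
    have "Poly_Mapping.single m 1 * h \<in> J" if "tdeg m = N" for m
    proof (rule assms(2))
      show "var_x * (Poly_Mapping.single m 1 * h) \<in> J"
        using Suc.prems[rule_format, of "(1,0,0) + m"] that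
        by (simp add: var_x_def mult_single mult.assoc[symmetric] tdeg_add) (simp add: tdeg_def)
      show "var_y * (Poly_Mapping.single m 1 * h) \<in> J"
        using Suc.prems[rule_format, of "(0,1,0) + m"] that
        by (simp add: var_y_def mult_single mult.assoc[symmetric] tdeg_add) (simp add: tdeg_def)
      show "var_z * (Poly_Mapping.single m 1 * h) \<in> J"
        using Suc.prems[rule_format, of "(0,0,1) + m"] that
        by (simp add: var_z_def mult_single mult.assoc[symmetric] tdeg_add) (simp add: tdeg_def)
    qed
    then show ?case using Suc.IH by blast
  qed
  then show "saturation J \<subseteq> J" unfolding saturation_def by blast
  show "J \<subseteq> saturation J" unfolding saturation_def using ideal3D(3)[OF J] by blast
qed

lemma jacobian_ideal_act: "h \<in> jacobian_ideal f \<longleftrightarrow> (\<exists>\<theta>. h = act \<theta> f)"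
  unfolding jacobian_ideal_def act_def by force

text \<open>Let xh, yh, zh be the values of A, B, C on f. Then yA - xB, zA - xC and zB - yC are
  syzygies; freeness passes the Koszul relation among them to their coefficients.\<close>

lemma saturated_if_free_syzygies:
  assumes gen: "\<And>\<delta>. act \<delta> f = 0 \<Longrightarrow> \<exists>p q. \<delta> = pscale p \<rho>1 + pscale q \<rho>2"
    and r: "act \<rho>1 f = 0" "act \<rho>2 f = 0"
    and ind: "\<And>p q. pscale p \<rho>1 + pscale q \<rho>2 = 0 \<Longrightarrow> p = 0 \<and> q = 0"
  shows "sat_jacobian f = jacobian_ideal f"
  unfolding sat_jacobian_def
proof (rule saturated_if_irrelevant_torsion_free[OF ideal3_jacobian])
  fix h assume "var_x * h \<in> jacobian_ideal f" "var_y * h \<in> jacobian_ideal f" "var_z * h \<in> jacobian_ideal f"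
  then obtain A B C where ABC: "var_x * h = act A f" "var_y * h = act B f" "var_z * h = act C f"
    unfolding jacobian_ideal_act by blast
  have "act (pscale var_y A - pscale var_x B) f = 0" "act (pscale var_z A - pscale var_x C) f = 0"
    "act (pscale var_z B - pscale var_y C) f = 0"
    by (simp_all add: act_diff act_pscale ABC[symmetric] algebra_simps)
  then obtain p1 p2 q1 q2 r1 r2 where
    P: "pscale var_y A - pscale var_x B = pscale p1 \<rho>1 + pscale p2 \<rho>2" and
    Q: "pscale var_z A - pscale var_x C = pscale q1 \<rho>1 + pscale q2 \<rho>2" and
    R: "pscale var_z B - pscale var_y C = pscale r1 \<rho>1 + pscale r2 \<rho>2" using gen by metis
  have "pscale (var_z * p1 - var_y * q1 + var_x * r1) \<rho>1 + pscale (var_z * p2 - var_y * q2 + var_x * r2) \<rho>2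
    = pscale var_z (pscale p1 \<rho>1 + pscale p2 \<rho>2) - pscale var_y (pscale q1 \<rho>1 + pscale q2 \<rho>2)
      + pscale var_x (pscale r1 \<rho>1 + pscale r2 \<rho>2)"
    by (simp add: pvec_eq_iff algebra_simps)
  also have "\<dots> = 0" unfolding P[symmetric] Q[symmetric] R[symmetric] by (simp add: pvec_eq_iff algebra_simps)
  finally have k: "var_z * p1 - var_y * q1 + var_x * r1 = 0" "var_z * p2 - var_y * q2 + var_x * r2 = 0"
    using ind by blast+
  obtain s1 t1 w1 where 1: "p1 = var_y * s1 - var_x * t1" "q1 = var_z * s1 - var_x * w1" "r1 = var_z * t1 - var_y * w1"
    using koszul_exact[OF k(1)] .
  obtain s2 t2 w2 where 2: "p2 = var_y * s2 - var_x * t2" "q2 = var_z * s2 - var_x * w2" "r2 = var_z * t2 - var_y * w2"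
    using koszul_exact[OF k(2)] .
  \<comment> \<open>Subtracting syzygies leaves the value on f unchanged and achieves y A' = x B'.
    Hence A' = x E, and the value of E on f is h.\<close>
  define A' where "A' = A - pscale s1 \<rho>1 - pscale s2 \<rho>2"
  define B' where "B' = B - pscale t1 \<rho>1 - pscale t2 \<rho>2"
  have AB: "pscale var_y A' = pscale var_x B'"
    using P unfolding A'_def B'_def 1 2 by (simp add: pvec_eq_iff algebra_simps)
  have "var_x dvd fst A'" "var_x dvd fst (snd A')" "var_x dvd snd (snd A')"
    using AB by (auto simp: pvec_eq_iff intro: var_x_var_y_regular[OF sym])
  then obtain E where E: "A' = pscale var_x E"
  proof -
    assume a: "\<And>E. A' = pscale var_x E \<Longrightarrow> thesis"
      and "var_x dvd fst A'" "var_x dvd fst (snd A')" "var_x dvd snd (snd A')"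
    then obtain e1 e2 e3 where "fst A' = var_x * e1" "fst (snd A') = var_x * e2" "snd (snd A') = var_x * e3"
      by (metis dvdE)
    then show thesis by (intro a[of "(e1,e2,e3)"]) (simp add: pvec_eq_iff)
  qed
  have "var_x * h = act A' f" by (simp add: A'_def act_diff act_pscale r ABC)
  also have "\<dots> = var_x * act E f" by (simp add: E act_pscale)
  finally have "h = act E f" using var_nonzero by simp
  then show "h \<in> jacobian_ideal f" unfolding jacobian_ideal_act by blast
qed

text \<open>By Cramer's rule the syzygies of the partial derivatives are freely generated by two corrections of
$\theta_1, \theta_2$ by multiples of the Euler field; exactness of the Koszul complex then gives saturation.\<close>
theorem saito_saturated:
  fixes v :: "nat \<Rightarrow> vec3"
  assumes G: "finite G" "G \<noteq> {}" and nz: "\<And>i. i \<in> G \<Longrightarrow> v i \<noteq> 0"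
    and np: "\<And>i j. i \<in> G \<Longrightarrow> j \<in> G \<Longrightarrow> i \<noteq> j \<Longrightarrow> \<not> proportional (v i) (v j)"
    and t1: "\<And>i. i \<in> G \<Longrightarrow> lin_form (v i) dvd vpair (v i) \<theta>1"
    and t2: "\<And>i. i \<in> G \<Longrightarrow> lin_form (v i) dvd vpair (v i) \<theta>2"
    and det: "pdet eulerv \<theta>1 \<theta>2 = C3 c * (\<Prod>i\<in>G. lin_form (v i))" "c \<noteq> 0"
  shows "sat_jacobian (\<Prod>i\<in>G. lin_form (v i)) = jacobian_ideal (\<Prod>i\<in>G. lin_form (v i))"
proof -
  define f where "f = (\<Prod>i\<in>G. lin_form (v i))"
  have f0: "f \<noteq> 0" unfolding f_def using G lin_form_nonzero nz by simp
  define n :: complex where "n = of_nat (card G)"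
  have n0: "n \<noteq> 0" using G by (simp add: n_def)
  have Ef: "act eulerv f = C3 n * f"
    unfolding act_eulerv f_def euler3_prod_lin_form[OF G(1)] by (simp add: n_def)
  obtain \<mu>1 where m1: "act \<theta>1 f = f * \<mu>1" using dvd_act[of G v \<theta>1, OF G(1) t1] unfolding f_def by (auto elim: dvdE)
  obtain \<mu>2 where m2: "act \<theta>2 f = f * \<mu>2" using dvd_act[of G v \<theta>2, OF G(1) t2] unfolding f_def by (auto elim: dvdE)
  define \<rho>1 where "\<rho>1 = \<theta>1 - pscale (C3 (inverse n) * \<mu>1) eulerv"
  define \<rho>2 where "\<rho>2 = \<theta>2 - pscale (C3 (inverse n) * \<mu>2) eulerv"
  have inv: "C3 (inverse n) * C3 n = 1" "C3 (inverse c) * C3 c = 1" using C3_inverse n0 det(2) by auto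
  have invx: "C3 (inverse n) * (C3 n * x) = x" "C3 (inverse c) * (C3 c * x) = x" for x
    using inv by (simp_all add: mult.assoc[symmetric])
  have r: "act \<rho>1 f = 0" "act \<rho>2 f = 0"
    unfolding \<rho>1_def \<rho>2_def act_diff act_pscale Ef m1 m2 using inv(1)
    by (simp_all add: algebra_simps invx)
  \<comment> \<open>Adding multiples of the first row does not change the determinant.\<close>
  have detr: "pdet eulerv \<rho>1 \<rho>2 = C3 c * f"
    unfolding f_def det(1)[symmetric] by (simp add: \<rho>1_def \<rho>2_def pdet_def algebra_simps)
  show ?thesis unfolding f_def[symmetric]
  proof (rule saturated_if_free_syzygies[OF _ r])
    fix \<delta> assume \<delta>: "act \<delta> f = 0"
    have d: "lin_form (v i) dvd vpair (v i) \<delta>" if "i \<in> G" for i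
      by (rule act_zero_dvd[of G]) (use G nz np that \<delta> in \<open>auto simp: f_def\<close>)
    have e: "lin_form (v i) dvd vpair (v i) eulerv" for i by (simp add: vpair_eulerv)
    have "f dvd pdet \<delta> \<theta>1 \<theta>2" "f dvd pdet eulerv \<delta> \<theta>2" "f dvd pdet eulerv \<theta>1 \<delta>"
      unfolding f_def by (rule prod_lin_form_dvd[OF G(1) nz np dvd_pdet[OF nz]]; use d e t1 t2 in blast)+
    then obtain w0 w1 w2 where w: "pdet \<delta> \<theta>1 \<theta>2 = f * w0" "pdet eulerv \<delta> \<theta>2 = f * w1" "pdet eulerv \<theta>1 \<delta> = f * w2"
      by (metis dvdE)
    \<comment> \<open>Cramer's rule expresses \<delta> over the field of fractions; since f divides
      all three numerators, f cancels and the coefficients are polynomials.\<close>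
    have "pscale f (pscale (C3 c) \<delta>) = pscale (pdet eulerv \<theta>1 \<theta>2) \<delta>"
      by (simp add: det(1) f_def[symmetric] pvec_eq_iff algebra_simps)
    also have "\<dots> = pscale f (pscale w0 eulerv + pscale w1 \<theta>1 + pscale w2 \<theta>2)"
      unfolding pdet_cramer[of eulerv \<theta>1 \<theta>2] w by (simp add: pvec_eq_iff algebra_simps)
    finally have cd: "pscale (C3 c) \<delta> = pscale w0 eulerv + pscale w1 \<theta>1 + pscale w2 \<theta>2"
      using f0 by (simp add: pvec_eq_iff)
    have "0 = act (pscale (C3 c) \<delta>) f" by (simp add: act_pscale \<delta>)
    also have "\<dots> = f * (C3 n * w0 + w1 * \<mu>1 + w2 * \<mu>2)"
      unfolding cd act_add act_pscale Ef m1 m2 by (simp add: algebra_simps)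
    \<comment> \<open>The condition that \<delta> kills f determines the Euler component w0, and
      inserting it replaces \<theta>1, \<theta>2 by \<rho>1, \<rho>2.\<close>
    finally have "C3 n * w0 + w1 * \<mu>1 + w2 * \<mu>2 = 0" using f0 by simp
    then have "C3 n * w0 = - (w1 * \<mu>1 + w2 * \<mu>2)"
      by (simp only: eq_neg_iff_add_eq_0 add.assoc)
    then have w0: "w0 = C3 (inverse n) * (- (w1 * \<mu>1 + w2 * \<mu>2))" using invx(1)[of w0] by simp
    have "pscale (C3 c) \<delta> = pscale w1 \<rho>1 + pscale w2 \<rho>2"
      unfolding cd w0 \<rho>1_def \<rho>2_def by (simp add: pvec_eq_iff algebra_simps)
    then have "pscale (C3 (inverse c)) (pscale (C3 c) \<delta>) = pscale (C3 (inverse c) * w1) \<rho>1 + pscale (C3 (inverse c) * w2) \<rho>2"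
      by (simp add: pvec_eq_iff algebra_simps)
    moreover have "pscale (C3 (inverse c)) (pscale (C3 c) \<delta>) = \<delta>" by (simp add: pvec_eq_iff invx)
    ultimately show "\<exists>p q. \<delta> = pscale p \<rho>1 + pscale q \<rho>2" by metis
  next
    fix p q assume z: "pscale p \<rho>1 + pscale q \<rho>2 = 0"
    have "p * (C3 c * f) = pdet eulerv (pscale p \<rho>1 + pscale q \<rho>2) \<rho>2"
      unfolding detr[symmetric] by (simp add: pdet_def algebra_simps)
    then have "p * (C3 c * f) = 0" by (simp add: z pdet_def)
    moreover have "q * (C3 c * f) = pdet eulerv \<rho>1 (pscale p \<rho>1 + pscale q \<rho>2)"
      unfolding detr[symmetric] by (simp add: pdet_def algebra_simps)
    then have "q * (C3 c * f) = 0" by (simp add: z pdet_def)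
    ultimately show "p = 0 \<and> q = 0" using f0 det(2) by simp
  qed
qed

section \<open>Free arrangements\<close>

definition cvec :: "vec3 \<Rightarrow> pvec" where
  "cvec e = (C3 (xc e), C3 (yc e), C3 (zc e))"

lemma vpair_cvec: "vpair v (cvec e) = C3 (eval_lin v e)"
  by (simp add: vpair_def cvec_def eval_lin_eq C3_hom)

lemma vpair_pscale: "vpair v (pscale p \<theta>) = p * vpair v \<theta>"
  by (simp add: vpair_def algebra_simps)

lemma vpair_add: "vpair v (\<theta> + \<eta>) = vpair v \<theta> + vpair v \<eta>"
  by (simp add: vpair_def algebra_simps)

lemma pdet_eulerv_cvec:
  "pdet eulerv (pscale p (cvec e)) (pscale q (cvec e')) = p * q * lin_form (cross e e')"
  by (simp add: pdet_def eulerv_def cvec_def lin_form_eq C3_hom algebra_simps)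

text \<open>The intersections of b with a and with c both lie on b, so the line joining them is
  b.\<close>

lemma cross_cross: "cross (cross a b) (cross b c) = scale3 (det3 a b c) b"
  by (simp add: vec3_eq_iff det3_def algebra_simps)

lemma pscale_1 [simp]: "pscale 1 \<theta> = \<theta>"
  by (simp add: pvec_eq_iff)

lemma saturated_small:
  assumes v: "distinct_lines d v" and "d \<le> 3"
  shows "sat_jacobian (arrangement_poly d v) = jacobian_ideal (arrangement_poly d v)"
proof -
  note nz = distinct_linesD(1)[OF v] and np = distinct_linesD(2)[OF v]
  consider "d = 0" | "d = 1" | "d = 2" | "d = 3" using assms(2) by linarith
  then show ?thesis
  proof cases
    case 1
    have "jacobian_ideal (arrangement_poly d v) = {0}"
      using act_1 unfolding jacobian_ideal_act set_eq_iff by (simp add: 1 arrangement_poly_def)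
    then show ?thesis unfolding sat_jacobian_def
      by (intro saturated_if_irrelevant_torsion_free[OF ideal3_jacobian]) (simp add: var_nonzero)
  next
    case 2
    have f: "arrangement_poly d v = lin_form (v 0)" by (simp add: 2 arrangement_poly_def)
    have "C3 c * 1 \<in> jacobian_ideal (lin_form (v 0))" if "c \<in> {xc (v 0), yc (v 0), zc (v 0)}" for c
      using pd_in_jacobian[of "lin_form (v 0)"] that by (auto simp: pd_lin_form)
    moreover have "\<exists>c\<in>{xc (v 0), yc (v 0), zc (v 0)}. c \<noteq> 0"
      using nz[of 0] 2 by (auto simp: vec3_eq_iff)
    ultimately have "1 \<in> jacobian_ideal (lin_form (v 0))"
      using ideal3_C3_cancel[OF ideal3_jacobian] by blast
    then have "h \<in> jacobian_ideal (lin_form (v 0))" for h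
      using ideal3D(3)[OF ideal3_jacobian, of 1 _ h] by simp
    then show ?thesis unfolding sat_jacobian_def f
      by (intro saturated_if_irrelevant_torsion_free[OF ideal3_jacobian]) simp
  next
    case 3
    have np01: "\<not> proportional (v 0) (v 1)" using np[of 0 1] 3 by simp
    obtain t where t: "det3 (v 0) (v 1) t \<noteq> 0" using exists_third[OF nz np01] 3 by auto
    show ?thesis unfolding arrangement_poly_def
    proof (rule saito_saturated)
      let ?\<theta>1 = "pscale 1 (cvec (cross (v 0) (v 1)))"
      let ?\<theta>2 = "pscale (lin_form (v 0)) (cvec (cross (v 1) t))"
      fix i assume "i \<in> {..<d}"
      then have "i = 0 \<or> i = 1" using 3 by auto
      then show "lin_form (v i) dvd vpair (v i) ?\<theta>1" "lin_form (v i) dvd vpair (v i) ?\<theta>2"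
        by (auto simp: vpair_cvec vpair_pscale eval_lin_cross)
    next
      show "pdet eulerv (pscale 1 (cvec (cross (v 0) (v 1)))) (pscale (lin_form (v 0)) (cvec (cross (v 1) t)))
        = C3 (det3 (v 0) (v 1) t) * (\<Prod>i<d. lin_form (v i))"
        unfolding pdet_eulerv_cvec cross_cross by (simp add: 3 lin_form_scale numeral_2_eq_2 algebra_simps)
    qed (use 3 nz np t in \<open>auto simp: lessThan_empty_iff bot_nat_def\<close>)
  next
    case 4
    have np01: "\<not> proportional (v 0) (v 1)" using np[of 0 1] 4 by simp
    have P: "(\<Prod>i<d. lin_form (v i)) = lin_form (v 0) * lin_form (v 1) * lin_form (v 2)"
      by (simp add: 4 numeral_3_eq_3 numeral_2_eq_2)
    show ?thesis
    proof (cases "det3 (v 0) (v 1) (v 2) = 0")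
      case True
      obtain t where t: "det3 (v 0) (v 1) t \<noteq> 0" using exists_third[OF nz np01] 4 by auto
      show ?thesis unfolding arrangement_poly_def
      proof (rule saito_saturated)
        let ?\<theta>1 = "pscale 1 (cvec (cross (v 0) (v 1)))"
        let ?\<theta>2 = "pscale (lin_form (v 0) * lin_form (v 2)) (cvec (cross (v 1) t))"
        fix i assume "i \<in> {..<d}"
        then have "i = 0 \<or> i = 1 \<or> i = 2" using 4 by auto
        then show "lin_form (v i) dvd vpair (v i) ?\<theta>1" "lin_form (v i) dvd vpair (v i) ?\<theta>2"
          using True by (auto simp: vpair_cvec vpair_pscale eval_lin_cross)
      next
        show "pdet eulerv (pscale 1 (cvec (cross (v 0) (v 1)))) (pscale (lin_form (v 0) * lin_form (v 2)) (cvec (cross (v 1) t)))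
          = C3 (det3 (v 0) (v 1) t) * (\<Prod>i<d. lin_form (v i))"
          unfolding pdet_eulerv_cvec cross_cross P by (simp add: lin_form_scale algebra_simps)
      qed (use 4 nz np t in \<open>auto simp: lessThan_empty_iff bot_nat_def\<close>)
    next
      case False
      show ?thesis unfolding arrangement_poly_def
      proof (rule saito_saturated)
        \<comment> \<open>In the coordinates given by the triangle these are, up to scalars, the
          fields x d/dx and y d/dy.\<close>
        let ?\<theta>1 = "pscale (lin_form (v 0)) (cvec (cross (v 1) (v 2)))"
        let ?\<theta>2 = "pscale (lin_form (v 1)) (cvec (cross (v 2) (v 0)))"
        fix i assume "i \<in> {..<d}"
        then have "i = 0 \<or> i = 1 \<or> i = 2" using 4 by auto
        then show "lin_form (v i) dvd vpair (v i) ?\<theta>1" "lin_form (v i) dvd vpair (v i) ?\<theta>2"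
          by (auto simp: vpair_cvec vpair_pscale eval_lin_cross)
      next
        show "pdet eulerv (pscale (lin_form (v 0)) (cvec (cross (v 1) (v 2)))) (pscale (lin_form (v 1)) (cvec (cross (v 2) (v 0))))
          = C3 (det3 (v 1) (v 2) (v 0)) * (\<Prod>i<d. lin_form (v i))"
          unfolding pdet_eulerv_cvec cross_cross P by (simp add: lin_form_scale algebra_simps)
        show "det3 (v 1) (v 2) (v 0) \<noteq> 0" using False by (simp add: det3_rotate[symmetric])
      qed (use 4 nz np in \<open>auto simp: lessThan_empty_iff bot_nat_def\<close>)
    qed
  qed
qed

section \<open>Freeness of the dual Hesse arrangement\<close>

lemma lin_form_diff_scale: "lin_form (a - scale3 w b) = lin_form a - C3 w * lin_form b"
  by (simp add: lin_form_eq C3_hom algebra_simps)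

definition hesse_lines :: "complex \<Rightarrow> vec3 \<Rightarrow> vec3 \<Rightarrow> vec3 \<Rightarrow> vec3 set" where
  "hesse_lines w a b c = {a - b, a - scale3 w b, a - scale3 (w\<^sup>2) b, b - c, b - scale3 w c, b - scale3 (w\<^sup>2) c,
     c - a, c - scale3 w a, c - scale3 (w\<^sup>2) a}"

lemma hesse_linesE:
  assumes "u \<in> hesse_lines w a b c" "w\<^sup>2 + w + 1 = 0"
  obtains t where "t ^ 3 = 1" "u = a - scale3 t b \<or> u = b - scale3 t c \<or> u = c - scale3 t a"
proof -
  have "w ^ 3 = 1"
  proof -
    have "w ^ 3 - 1 = (w - 1) * (w\<^sup>2 + w + 1)" by (simp add: power2_eq_square power3_eq_cube algebra_simps)
    then show ?thesis using assms(2) by simp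
  qed
  moreover have "(w\<^sup>2) ^ 3 = (w ^ 3)\<^sup>2" by (simp add: power_mult[symmetric])
  moreover have "scale3 1 x = x" for x by (simp add: vec3_eq_iff)
  ultimately show ?thesis using assms(1) that[of 1] that[of w] that[of "w\<^sup>2"]
    unfolding hesse_lines_def by auto
qed

text \<open>Besides the Euler field two derivations of degree 4 are used. The degrees 1, 4, 4 add up
  to 9, so Saito's determinant can be a scalar multiple of the product.\<close>

theorem hesse_saturated:
  fixes v :: "nat \<Rightarrow> vec3"
  assumes G: "finite G" "G \<noteq> {}" and nz: "\<And>i. i \<in> G \<Longrightarrow> v i \<noteq> 0"
    and np: "\<And>i j. i \<in> G \<Longrightarrow> j \<in> G \<Longrightarrow> i \<noteq> j \<Longrightarrow> \<not> proportional (v i) (v j)"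
    and w: "w\<^sup>2 + w + 1 = 0" and D: "det3 a b c \<noteq> 0"
    and lines: "\<And>i. i \<in> G \<Longrightarrow> \<exists>u\<in>hesse_lines w a b c. proportional u (v i)"
    and prod: "(\<Prod>i\<in>G. lin_form (v i)) = C3 k * ((lin_form a ^ 3 - lin_form b ^ 3) * (lin_form b ^ 3 - lin_form c ^ 3) * (lin_form c ^ 3 - lin_form a ^ 3))"
    and k: "k \<noteq> 0"
  shows "sat_jacobian (\<Prod>i\<in>G. lin_form (v i)) = jacobian_ideal (\<Prod>i\<in>G. lin_form (v i))"
proof -
  \<comment> \<open>Up to the factor \<open>det3 a b c\<close>, this is the field with values p, q,
    r on the forms of a, b, c.\<close>
  define \<theta> where "\<theta> p q r = pscale p (cvec (cross b c)) + (pscale q (cvec (cross c a)) + pscale r (cvec (cross a b)))" for p q r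
  define d where "d = det3 a b c"
  define A B C where "A = lin_form a" and "B = lin_form b" and "C = lin_form c"
  have d: "det3 b c a = d" "det3 c a b = d" 
    using det3_rotate[of a b c] det3_rotate[of b c a] by (simp_all add: d_def)
  have pair: "vpair a (\<theta> p q r) = C3 d * p" "vpair b (\<theta> p q r) = C3 d * q" "vpair c (\<theta> p q r) = C3 d * r" for p q r
    by (simp_all add: \<theta>_def vpair_add vpair_pscale vpair_cvec eval_lin_cross d d_def[symmetric])
  have pd: "vpair (x - scale3 t y) \<eta> = vpair x \<eta> - C3 t * vpair y \<eta>" for x y t \<eta>
    by (simp add: vpair_def C3_hom algebra_simps)
  have ps: "vpair (scale3 s x) \<eta> = C3 s * vpair x \<eta>" for s x \<eta>
    by (simp add: vpair_def C3_hom algebra_simps)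
  \<comment> \<open>the basic derivations of the reflection arrangement of type $G(3,3,3)$\<close>
  define \<theta>1 where "\<theta>1 = \<theta> (A^4) (B^4) (C^4)"
  define \<theta>2 where "\<theta>2 = \<theta> (B^2 * C^2) (C^2 * A^2) (A^2 * B^2)"
  have key: "x - C3 t * y dvd x^4 - C3 t * y^4" "x - C3 t * y dvd y^2 * z^2 - C3 t * (z^2 * x^2)" if t: "t ^ 3 = 1" for x y z t
  proof -
    have t3: "C3 t ^ 3 = 1" using t by (simp add: C3_power[symmetric])
    \<comment> \<open>Modulo x = ty both expressions acquire a factor t^3 - 1.\<close>
    have "x^4 - C3 t * y^4 = (x - C3 t * y) * (x^3 + x^2 * (C3 t * y) + x * (C3 t * y)^2 + (C3 t * y)^3) + C3 t * y^4 * (C3 t ^ 3 - 1)"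
      by (simp add: power2_eq_square power3_eq_cube power4_eq_xxxx algebra_simps)
    then show "x - C3 t * y dvd x^4 - C3 t * y^4" using t3 by simp
    have "y^2 * z^2 - C3 t * (z^2 * x^2) = (x - C3 t * y) * (- C3 t * z^2 * (x + C3 t * y)) - y^2 * z^2 * (C3 t ^ 3 - 1)"
      by (simp add: power2_eq_square power3_eq_cube algebra_simps)
    then show "x - C3 t * y dvd y^2 * z^2 - C3 t * (z^2 * x^2)" using t3 by simp
  qed
  have dv: "lin_form (v i) dvd vpair (v i) \<theta>1 \<and> lin_form (v i) dvd vpair (v i) \<theta>2" if i: "i \<in> G" for i
  proof -
    from lines[OF i] obtain u s where u: "u \<in> hesse_lines w a b c" "v i = scale3 s u"
      unfolding proportional_scale3 by blast
    from u(1) w obtain t where t: "t ^ 3 = 1" "u = a - scale3 t b \<or> u = b - scale3 t c \<or> u = c - scale3 t a"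
      by (rule hesse_linesE)
    have "lin_form u dvd vpair u \<theta>1"
      using t(2) key(1)[OF t(1)]
      by (auto simp: lin_form_diff_scale pd \<theta>1_def pair A_def B_def C_def mult.left_commute[of "C3 t"] right_diff_distrib[symmetric])
    moreover have "lin_form u dvd vpair u \<theta>2"
      using t(2) key(2)[OF t(1), of A B C] key(2)[OF t(1), of B C A] key(2)[OF t(1), of C A B]
      by (auto simp: lin_form_diff_scale pd \<theta>2_def pair A_def B_def C_def mult.left_commute[of "C3 t"] right_diff_distrib[symmetric])
    ultimately show ?thesis unfolding u(2) lin_form_scale ps by (simp add: mult_dvd_mono)
  qed
  have expand: "pdet eulerv (\<theta> p q r) (\<theta> p' q' r') = C3 d * ((q * r' - r * q') * A + (r * p' - p * r') * B + (p * q' - q * p') * C)" for p q r p' q' r'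
  proof -
    have "pdet eulerv (\<theta> p q r) (\<theta> p' q' r') =
        (q * r' - r * q') * lin_form (cross (cross c a) (cross a b))
      + (r * p' - p * r') * lin_form (cross (cross a b) (cross b c))
      + (p * q' - q * p') * lin_form (cross (cross b c) (cross c a))"
    proof -
      have add: "pdet X (Y + Y') Z = pdet X Y Z + pdet X Y' Z" "pdet X Y (Z + Z') = pdet X Y Z + pdet X Y Z'" for X Y Y' Z Z'
        by (simp_all add: pdet_def algebra_simps)
      have anti: "lin_form (cross x y) = - lin_form (cross y x)" "lin_form (cross x x) = 0" for x y
        by (simp_all add: lin_form_eq C3_hom algebra_simps)
      show ?thesis unfolding \<theta>_def add pdet_eulerv_cvec
        using anti(1)[of "cross b c" "cross a b"] anti(1)[of "cross c a" "cross b c"] anti(1)[of "cross a b" "cross c a"]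
        by (simp add: anti(2) algebra_simps)
    qed
    also have "\<dots> = C3 d * ((q * r' - r * q') * A + (r * p' - p * r') * B + (p * q' - q * p') * C)"
      unfolding cross_cross lin_form_scale d d_def[symmetric] by (simp add: A_def B_def C_def algebra_simps)
    finally show ?thesis .
  qed
  have poly: "(B^4 * (A^2 * B^2) - C^4 * (C^2 * A^2)) * A + (C^4 * (B^2 * C^2) - A^4 * (A^2 * B^2)) * B + (A^4 * (C^2 * A^2) - B^4 * (B^2 * C^2)) * C
      = (A ^ 3 - B ^ 3) * (B ^ 3 - C ^ 3) * (C ^ 3 - A ^ 3)"
    by (simp add: power2_eq_square power3_eq_cube power4_eq_xxxx algebra_simps)
  have "pdet eulerv \<theta>1 \<theta>2 = C3 d * ((A ^ 3 - B ^ 3) * (B ^ 3 - C ^ 3) * (C ^ 3 - A ^ 3))"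
    unfolding \<theta>1_def \<theta>2_def expand poly ..
  also have "\<dots> = C3 (d / k) * (C3 k * ((A ^ 3 - B ^ 3) * (B ^ 3 - C ^ 3) * (C ^ 3 - A ^ 3)))"
    using k by (simp add: mult.assoc[symmetric] C3_mult[symmetric])
  finally have det: "pdet eulerv \<theta>1 \<theta>2 = C3 (d / k) * (\<Prod>i\<in>G. lin_form (v i))"
    unfolding prod A_def B_def C_def .
  have "d / k \<noteq> 0" using D k by (simp add: d_def)
  with G nz np dv det show ?thesis by (intro saito_saturated[where c = "d / k"]) auto
qed

section \<open>Coordinates with respect to three independent lines\<close>

definition comb3 :: "vec3 \<Rightarrow> vec3 \<Rightarrow> vec3 \<Rightarrow> vec3 \<Rightarrow> vec3" where
  "comb3 p q r u = scale3 (xc u) p + scale3 (yc u) q + scale3 (zc u) r"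

lemma det3_comb3: "det3 (comb3 p q r x) (comb3 p q r y) (comb3 p q r z) = det3 x y z * det3 p q r"
  by (simp add: comb3_def det3_def algebra_simps)

lemma comb3_coords:
  assumes "det3 p q r \<noteq> 0"
  obtains u where "w = comb3 p q r u"
proof -
  have "scale3 (1 / det3 p q r) (scale3 (det3 p q r) w) = comb3 p q r (det3 w q r / det3 p q r, det3 p w r / det3 p q r, det3 p q w / det3 p q r)"
    by (subst cramer_vec) (simp add: comb3_def vec3_eq_iff add_divide_distrib)
  moreover have "scale3 (1 / det3 p q r) (scale3 (det3 p q r) w) = w"
    using assms by (simp add: vec3_eq_iff)
  ultimately show ?thesis using that by metis
qed

lemma comb3_scale: "comb3 p q r (scale3 s u) = scale3 s (comb3 p q r u)"
  and comb3_diff: "comb3 p q r (u - u') = comb3 p q r u - comb3 p q r u'"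
  by (simp_all add: comb3_def vec3_eq_iff algebra_simps)

section \<open>Nine lines\<close>

lemma det3_scale3: "det3 x (scale3 s y) (scale3 t z) = s * t * det3 x y z"
  "det3 (scale3 s x) (scale3 t y) z = s * t * det3 x y z"
  by (simp_all add: det3_def algebra_simps)

lemma proportional_scaleI: "w = scale3 t v \<Longrightarrow> proportional v w"
  by (auto simp: proportional_scale3)

lemma pencil_scaled:
  assumes "u \<noteq> 0" "\<not> proportional u v" "\<not> proportional u w" "\<not> proportional v w" "det3 u v w = 0"
  obtains r s where "r \<noteq> 0" "s \<noteq> 0" "w = scale3 r u + scale3 s v"
proof -
  obtain r s where w: "w = scale3 r u + scale3 s v" using in_span_of_det3 assms by metis
  moreover have "r \<noteq> 0" using assms(4) proportional_scaleI[of w s v] by (auto simp: w vec3_eq_iff)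
  moreover have "s \<noteq> 0" using assms(3) proportional_scaleI[of w r u] by (auto simp: w vec3_eq_iff)
  ultimately show ?thesis using that by blast
qed

text \<open>Three of the lines serve as coordinates, and Q1 has coordinates (x, y, w) up to scale.
  Concurrency along A forces x = -yw, along B it forces w^2 + w + 1 = 0, and two triples determine
  C. The remaining parameter y is absorbed into a, b, c.\<close>

theorem hesse_normal_form:
  fixes A B C P0 P1 P2 Q0 Q1 Q2 :: vec3
  assumes P: "P0 \<noteq> 0" "\<not> proportional P0 P1" "\<not> proportional P0 P2" "\<not> proportional P1 P2" "det3 P0 P1 P2 = 0"
    and Q: "Q0 \<noteq> 0" "\<not> proportional Q0 Q1" "\<not> proportional Q0 Q2" "\<not> proportional Q1 Q2" "det3 Q0 Q1 Q2 = 0"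
    and A: "det3 A P0 Q0 = 0" "det3 A P1 Q1 = 0" "det3 A P2 Q2 = 0" "\<not> proportional P0 A"
    and B: "det3 B P0 Q1 = 0" "det3 B P1 Q2 = 0" "det3 B P2 Q0 = 0" "B \<noteq> 0"
    and C: "det3 C P0 Q2 = 0" "det3 C P1 Q0 = 0"
    and nd: "det3 P0 P1 Q0 \<noteq> 0" "det3 P0 Q0 Q1 \<noteq> 0"
  obtains w a b c where "w\<^sup>2 + w + 1 = 0" "det3 a b c \<noteq> 0"
    "proportional (a - b) A" "proportional (a - scale3 w b) B" "proportional (a - scale3 (w\<^sup>2) b) C"
    "proportional (b - c) P0" "proportional (b - scale3 w c) P1" "proportional (b - scale3 (w\<^sup>2) c) P2"
    "proportional (c - a) Q0" "proportional (c - scale3 (w\<^sup>2) a) Q1" "proportional (c - scale3 w a) Q2"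
proof -
  obtain r0 r1 where r: "r0 \<noteq> 0" "r1 \<noteq> 0" "P2 = scale3 r0 P0 + scale3 r1 P1" using pencil_scaled[OF P] .
  obtain s0 s1 where s: "s0 \<noteq> 0" "s1 \<noteq> 0" "Q2 = scale3 s0 Q0 + scale3 s1 Q1" using pencil_scaled[OF Q] .
  \<comment> \<open>The scaling makes P2 = p0 + p1 and Q2 = q0 + q1, which removes the scalars of
    both pencils.\<close>
  define p0 p1 q0 q1 where "p0 = scale3 r0 P0" and "p1 = scale3 r1 P1" and "q0 = scale3 s0 Q0" and "q1 = scale3 s1 Q1"
  note defs = p0_def p1_def q0_def q1_def
  define D where "D = det3 p0 p1 q0"
  have D: "D \<noteq> 0" using nd(1) r s by (simp add: D_def defs det3_def algebra_simps) (simp add: det3_def algebra_simps flip: distrib_left)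
  define K where "K = comb3 p0 p1 q0"
  have detK: "det3 (K x) (K y) (K z) = 0 \<longleftrightarrow> det3 x y z = 0" for x y z
    using D by (simp add: K_def det3_comb3 D_def)
  have ex: "\<exists>u. V = K u" for V using comb3_coords[of p0 p1 q0 V] D unfolding K_def D_def by blast
  obtain x y w where q1: "q1 = K (x,y,w)" using ex[of q1] by auto
  obtain a1 a2 a3 where a: "A = K (a1,a2,a3)" using ex[of A] by auto
  obtain b1 b2 b3 where b: "B = K (b1,b2,b3)" using ex[of B] by auto
  obtain c1 c2 c3 where c: "C = K (c1,c2,c3)" using ex[of C] by auto
  have p0: "p0 = K (1,0,0)" and p1: "p1 = K (0,1,0)" and q0: "q0 = K (0,0,1)"
    by (simp_all add: K_def comb3_def vec3_eq_iff)
  have p2: "P2 = K (1,1,0)" using r(3) by (simp add: K_def comb3_def vec3_eq_iff defs)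
  have q2: "Q2 = K (x,y,1+w)" using s(3) q1 by (simp add: K_def comb3_def vec3_eq_iff defs) (simp add: algebra_simps)
  have dets: "det3 A p0 q0 = 0" "det3 A p1 q1 = 0" "det3 B p0 q1 = 0" "det3 C p1 q0 = 0"
    using A B C by (simp_all add: defs det3_scale3)
  have dets2: "det3 B p1 Q2 = 0" "det3 B P2 q0 = 0" "det3 C p0 Q2 = 0"
    using B C det3_scale3(1)[of B r1 P1 1 Q2] det3_scale3(1)[of B 1 P2 s0 Q0] det3_scale3(1)[of C r0 P0 1 Q2]
    by (simp_all add: defs scale3_def)
  have A2: "a2 = 0" using dets(1) unfolding a p0 q0 detK by (simp add: det3_def)
  have A3: "a1 * w = a3 * x" using dets(2) unfolding a p1 q1 detK by (simp add: det3_def)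
  have "a1 * (1 + w) + a3 * (y - x) = 0" using A(3) A2 unfolding a p2 q2 detK by (simp add: det3_def)
  with A3 have A1: "a1 = - a3 * y" by (simp add: algebra_simps eq_neg_iff_add_eq_0)
  have a3: "a3 \<noteq> 0"
  proof
    assume "a3 = 0"
    then have "A = scale3 (a1 * r0) P0" using A2 by (simp add: a K_def comb3_def vec3_eq_iff defs)
    then show False using A(4) proportional_scaleI by blast
  qed
  have "a3 * (x + y * w) = a3 * x - a1 * w" by (simp add: A1 algebra_simps)
  also have "\<dots> = 0" using A3 by simp
  finally have "a3 * (x + y * w) = 0" .
  then have x: "x = - y * w" using a3 by (simp add: eq_neg_iff_add_eq_0)
  have y: "y \<noteq> 0"
  proof
    assume "y = 0"
    then have "det3 p0 q0 q1 = 0" unfolding p0 q0 q1 detK by (simp add: det3_def)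
    then show False using nd(2) r s by (auto simp: defs det3_def algebra_simps) (simp add: det3_def algebra_simps flip: distrib_left)
  qed
  have B1: "b2 * w = b3 * y" using dets(3) unfolding b p0 q1 detK by (simp add: det3_def algebra_simps)
  have B2: "b1 * (1 + w) = b3 * x" using dets2(1) unfolding b p1 q2 detK by (simp add: det3_def)
  have B3: "b1 = b2" using dets2(2) unfolding b p2 q0 detK by (simp add: det3_def)
  have b1: "b1 \<noteq> 0"
  proof
    assume "b1 = 0"
    then have "B = 0" using B1 B3 y by (simp add: b K_def comb3_def vec3_eq_iff)
    then show False using B(4) by simp
  qed
  have "b1 * (w * w + w + 1) = b1 * (1 + w) + (b2 * w) * w" by (simp add: B3 algebra_simps)
  also have "\<dots> = 0" unfolding B1 B2 x by (simp add: algebra_simps)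
  finally have "b1 * (w * w + w + 1) = 0" .
  then have "w * w + w + 1 = 0" using b1 by (simp only: mult_eq_0_iff) simp
  \<comment> \<open>From here on w is a primitive cube root of unity, and powers of w are reduced by
    these rules.\<close>
  then have ww: "w * w = - 1 - w" by algebra
  have www: "w * (w * t) = - t - w * t" for t
    using ww by algebra
  have w2: "w\<^sup>2 = - 1 - w" using ww by (simp add: power2_eq_square)
  have C1: "c1 = 0" using dets(4) unfolding c p1 q0 detK by (simp add: det3_def)
  have C2: "c2 * (1 + w) = c3 * y" using dets2(3) unfolding c p0 q2 detK by (simp add: det3_def algebra_simps)
  \<comment> \<open>With e1, e2, e3 the unit vectors, ub and uc solve ub - uc = y e1 and ub - w uc =
    (y/w) e2, which fits P0 and P1; then ua = uc + e3 fits Q0.\<close>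
  define ub uc ua :: vec3 where "ub = (y * (1 - w) / 3, y * (- 1 - 2 * w) / 3, 0)"
    and "uc = (- y * (2 + w) / 3, - y * (1 + 2 * w) / 3, 0)"
    and "ua = (- y * (2 + w) / 3, - y * (1 + 2 * w) / 3, 1)"
  have Kd: "K u - scale3 t (K u') = K (u - scale3 t u')" for u u' t
    by (simp add: K_def comb3_diff comb3_scale)
  have Kd1: "K u - K u' = K (u - u')" for u u' by (simp add: K_def comb3_diff)
  have Ks: "scale3 t (K u) = K (scale3 t u)" for t u by (simp add: K_def comb3_scale)
  show ?thesis
  proof (rule that[of w "K ua" "K ub" "K uc"])
    show "w\<^sup>2 + w + 1 = 0" by (simp add: w2)
    show "det3 (K ua) (K ub) (K uc) \<noteq> 0"
    proof -
      have "det3 ua ub uc = - (y * y) * (1 + 2 * w) / 3"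
        by (simp add: det3_def ua_def ub_def uc_def field_simps ww www)
      moreover have "1 + 2 * w \<noteq> 0"
      proof
        assume "1 + 2 * w = 0"
        moreover have "(1 + 2 * w) * (1 + 2 * w) = - 3" using ww by algebra
        ultimately show False by simp
      qed
      ultimately show ?thesis using y unfolding detK by simp
    qed
    have "A = K (scale3 a3 (ua - ub))"
      unfolding a A2 A1 by (rule arg_cong[of _ _ K]) (simp add: vec3_eq_iff ua_def ub_def field_simps)
    then show "proportional (K ua - K ub) A" unfolding Kd1 by (intro proportional_scaleI[of _ a3]) (simp add: Ks)
    have b1_eq: "b1 = b3 * (y * (- 1 - w))"
    proof -
      have "b3 * (y * (- 1 - w)) = (b3 * y) * (- 1 - w)" by (simp add: algebra_simps)
      also have "\<dots> = (b1 * w) * (- 1 - w)" using B1 B3 by simp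
      also have "\<dots> = b1" by (simp add: algebra_simps ww www)
      finally show ?thesis by simp
    qed
    have "B = K (b3 * (y * (- 1 - w)), b3 * (y * (- 1 - w)), b3)"
      unfolding b B3[symmetric] b1_eq[symmetric] ..
    also have "\<dots> = K (scale3 b3 (ua - scale3 w ub))"
      by (intro arg_cong[of _ _ K]) (simp add: vec3_eq_iff ua_def ub_def field_simps ww www)
    finally show "proportional (K ua - scale3 w (K ub)) B" unfolding Kd by (intro proportional_scaleI[of _ b3]) (simp add: Ks)
    have c2_eq: "c2 = - c3 * (y * w)"
    proof -
      have "- c3 * (y * w) = - (c3 * y) * w" by (simp add: algebra_simps)
      also have "\<dots> = - (c2 * (1 + w)) * w" using C2 by simp
      also have "\<dots> = c2" by (simp add: algebra_simps ww www)
      finally show ?thesis by simp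
    qed
    have "C = K (0, - c3 * (y * w), c3)" unfolding c C1 c2_eq[symmetric] ..
    also have "\<dots> = K (scale3 c3 (ua - scale3 (w\<^sup>2) ub))"
      unfolding w2 by (intro arg_cong[of _ _ K]) (simp add: vec3_eq_iff ua_def ub_def field_simps ww www)
    finally show "proportional (K ua - scale3 (w\<^sup>2) (K ub)) C" unfolding Kd by (intro proportional_scaleI[of _ c3]) (simp add: Ks)
    have P01: "P0 = scale3 (1 / r0) p0" "P1 = scale3 (1 / r1) p1" "Q0 = scale3 (1 / s0) q0" "Q1 = scale3 (1 / s1) q1"
      using r s by (simp_all add: defs vec3_eq_iff)
    have ss: "scale3 m (scale3 n V) = scale3 (m * n) V" for m n V by (simp add: vec3_eq_iff)
    have "p0 = scale3 (1 / y) (K (ub - uc))" unfolding Ks p0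
      using y by (intro arg_cong[of _ _ K]) (simp add: vec3_eq_iff ub_def uc_def field_simps)
    then show "proportional (K ub - K uc) P0" unfolding Kd1 P01 by (simp only: ss) (rule proportional_scaleI, rule refl)
    have "p1 = scale3 (w / y) (K (ub - scale3 w uc))" unfolding Ks p1
      using y by (intro arg_cong[of _ _ K]) (simp add: vec3_eq_iff ub_def uc_def field_simps ww www)
    then show "proportional (K ub - scale3 w (K uc)) P1" unfolding Kd P01 by (simp only: ss) (rule proportional_scaleI, rule refl)
    have "P2 = scale3 ((1 + w) / y) (K (ub - scale3 (w\<^sup>2) uc))" unfolding Ks p2 w2
      using y by (intro arg_cong[of _ _ K]) (simp add: vec3_eq_iff ub_def uc_def field_simps ww www)
    then show "proportional (K ub - scale3 (w\<^sup>2) (K uc)) P2" unfolding Kd by (rule proportional_scaleI)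
    have "q0 = scale3 (- 1) (K (uc - ua))" unfolding Ks q0
      by (intro arg_cong[of _ _ K]) (simp add: vec3_eq_iff ua_def uc_def)
    then show "proportional (K uc - K ua) Q0" unfolding Kd1 P01 by (simp only: ss) (rule proportional_scaleI, rule refl)
    have "q1 = scale3 (1 + w) (K (uc - scale3 (w\<^sup>2) ua))" unfolding Ks q1 w2 x
      by (intro arg_cong[of _ _ K]) (simp add: vec3_eq_iff ua_def uc_def field_simps ww www)
    then show "proportional (K uc - scale3 (w\<^sup>2) (K ua)) Q1" unfolding Kd P01 by (simp only: ss) (rule proportional_scaleI, rule refl)
    have "Q2 = scale3 w (K (uc - scale3 w ua))" unfolding Ks q2 x
      by (intro arg_cong[of _ _ K]) (simp add: vec3_eq_iff ua_def uc_def field_simps ww www)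
    then show "proportional (K uc - scale3 w (K ua)) Q2" unfolding Kd by (rule proportional_scaleI)
  qed
qed

section \<open>The Steiner triple system on nine points\<close>

text \<open>This is the uniqueness of the affine plane of order 3. A point P0 off the block ABC is
  joined to A, B, C, which gives Q0, Q1, Q2; two points remain, and each further block follows by
  excluding pairs already covered.\<close>

lemma steiner9_labelling:
  fixes T :: "'a \<Rightarrow> 'a \<Rightarrow> 'a \<Rightarrow> bool"
  assumes U: "finite U" "card U = 9"
    and sym: "\<And>i j k. T i j k \<Longrightarrow> T j i k" "\<And>i j k. T i j k \<Longrightarrow> T i k j"
    and mem: "\<And>i j k. T i j k \<Longrightarrow> i \<in> U" "\<And>i j k. T i j k \<Longrightarrow> i \<noteq> j"
    and uniq: "\<And>i j k l. T i j k \<Longrightarrow> T i j l \<Longrightarrow> k = l"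
    and ex: "\<And>i j. i \<in> U \<Longrightarrow> j \<in> U \<Longrightarrow> i \<noteq> j \<Longrightarrow> \<exists>k. T i j k"
    and ABC: "T A B C"
  obtains P0 P1 P2 Q0 Q1 Q2 where "U = {A,B,C,P0,P1,P2,Q0,Q1,Q2}" "distinct [A,B,C,P0,P1,P2,Q0,Q1,Q2]"
    "T P0 P1 P2" "T Q0 Q1 Q2" "T A P0 Q0" "T A P1 Q1" "T A P2 Q2"
    "T B P0 Q1" "T B P1 Q2" "T B P2 Q0" "T C P0 Q2" "T C P1 Q0" "T C P2 Q1"
proof -
  have neq: "i \<noteq> j" "i \<noteq> k" "j \<noteq> k" "j \<noteq> i" "k \<noteq> i" "k \<noteq> j" and inU: "i \<in> U" "j \<in> U" "k \<in> U" if "T i j k" for i j k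
    using that sym mem by metis+
  have u2: "T i j k \<Longrightarrow> T i l k \<Longrightarrow> j = l" and u3: "T i j k \<Longrightarrow> T l j k \<Longrightarrow> i = l"
    and u4: "T i j k \<Longrightarrow> T j i l \<Longrightarrow> k = l" and u5: "T i j k \<Longrightarrow> T k j l \<Longrightarrow> i = l"
    and u6: "T i j k \<Longrightarrow> T j l i \<Longrightarrow> k = l" and u7: "T i j k \<Longrightarrow> T k l i \<Longrightarrow> j = l"
    and u8: "T i j k \<Longrightarrow> T l i j \<Longrightarrow> k = l" for i j k l
    using uniq sym by metis+
  note us = uniq u2 u3 u4 u5 u6 u7 u8
  have c3: "card {A,B,C} = 3" using neq[OF ABC] by simp
  then have "card (U - {A,B,C}) = 6" using U inU[OF ABC] by (simp add: card_Diff_subset)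
  then obtain P0 where P0: "P0 \<in> U" "P0 \<noteq> A" "P0 \<noteq> B" "P0 \<noteq> C"
    by (metis Diff_iff card.empty ex_in_conv insertCI zero_neq_numeral)
  obtain Q0 where Q0: "T A P0 Q0" using ex inU[OF ABC] P0 by metis
  obtain Q1 where Q1: "T B P0 Q1" using ex inU[OF ABC] P0 by metis
  obtain Q2 where Q2: "T C P0 Q2" using ex inU[OF ABC] P0 by metis
  have q: "Q0 \<noteq> B" "Q0 \<noteq> C" "Q1 \<noteq> A" "Q1 \<noteq> C" "Q2 \<noteq> A" "Q2 \<noteq> B" "Q0 \<noteq> Q1" "Q0 \<noteq> Q2" "Q1 \<noteq> Q2"
    using us ABC Q0 Q1 Q2 P0 neq[OF ABC] sym by metis+
  note nq = neq[OF ABC] neq[OF Q0] neq[OF Q1] neq[OF Q2] P0 q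
  have d7: "distinct [A,B,C,P0,Q0,Q1,Q2]" using nq by auto
  then have "card (set [A,B,C,P0,Q0,Q1,Q2]) = 7" by (simp only: distinct_card) simp
  moreover have s7: "set [A,B,C,P0,Q0,Q1,Q2] \<subseteq> U" using inU[OF ABC] inU[OF Q0] inU[OF Q1] inU[OF Q2] by auto
  ultimately have "card (U - set [A,B,C,P0,Q0,Q1,Q2]) = 2" using U by (simp add: card_Diff_subset del: set_simps)
  then obtain x y where xy: "U - set [A,B,C,P0,Q0,Q1,Q2] = {x,y}" "x \<noteq> y" by (auto simp: card_2_iff)
  have "U = set [A,B,C,P0,Q0,Q1,Q2] \<union> {x,y}" using s7 xy(1) by blast
  then have Uxy: "U = {A,B,C,P0,Q0,Q1,Q2,x,y}" by (simp add: insert_commute)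
  have dxy: "x \<notin> set [A,B,C,P0,Q0,Q1,Q2]" "y \<notin> set [A,B,C,P0,Q0,Q1,Q2]" using xy(1) by blast+
  obtain P1 where P1: "T A Q1 P1" using ex[of A Q1] inU[OF ABC] inU[OF Q1] q by metis
  \<comment> \<open>Three blocks through P0 cover the other six points, so its fourth block consists
    of P0 and the remaining two.\<close>
  have pair: "T P0 a b" if ab: "{a,b} = {x,y}" for a b
  proof -
    have "a \<noteq> P0" "a \<in> U" using ab dxy Uxy by (auto simp: doubleton_eq_iff)
    then obtain z where z: "T P0 a z" using ex P0(1) by metis
    have "z \<in> {A,B,C,P0,Q0,Q1,Q2,a,b}" using inU(3)[OF z] Uxy ab by auto
    moreover have "a \<notin> set [A,B,C,P0,Q0,Q1,Q2]" using ab dxy by (auto simp: doubleton_eq_iff)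
    then have na: "a \<noteq> A" "a \<noteq> B" "a \<noteq> C" "a \<noteq> Q0" "a \<noteq> Q1" "a \<noteq> Q2" by auto
    have "z \<noteq> P0" "z \<noteq> a" using neq[OF z] by auto
    moreover have "z \<noteq> A" "z \<noteq> Q0" using z Q0 na sym uniq by metis+
    moreover have "z \<noteq> B" "z \<noteq> Q1" using z Q1 na sym uniq by metis+
    moreover have "z \<noteq> C" "z \<noteq> Q2" using z Q2 na sym uniq by metis+
    ultimately show ?thesis using z by auto
  qed
  have Pxy: "T P0 x y" "T P0 y x" by (auto intro: pair)
  have rest: "T A x y \<Longrightarrow> False" "T B x y \<Longrightarrow> False" "T C x y \<Longrightarrow> False"
    using Pxy nq u3 by metis+
  have P1x: "P1 = x \<or> P1 = y"
  proof -
    have "P1 \<in> {A,B,C,P0,Q0,Q1,Q2,x,y}" using inU(3)[OF P1] Uxy by simp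
    moreover have "P1 \<noteq> A" "P1 \<noteq> Q1" using neq[OF P1] by auto
    moreover have "P1 \<noteq> B" "P1 \<noteq> C" using P1 ABC nq sym uniq by metis+
    moreover have "P1 \<noteq> P0" "P1 \<noteq> Q0" using P1 Q0 nq sym uniq by metis+
    moreover have "P1 \<noteq> Q2"
    proof
      \<comment> \<open>The blocks through A would then leave only x and y for its last block, but
        these are already joined to P0.\<close>
      assume 1: "P1 = Q2"
      have "x \<noteq> A" "x \<in> U" using dxy Uxy by auto
      then obtain z where z: "T A x z" using ex inU[OF ABC] by metis
      have "z \<in> {A,B,C,P0,Q0,Q1,Q2,x,y}" using inU(3)[OF z] Uxy by simp
      moreover have "x \<noteq> A" "x \<noteq> B" "x \<noteq> C" "x \<noteq> P0" "x \<noteq> Q0" "x \<noteq> Q1" "x \<noteq> Q2" using dxy by auto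
      moreover have "z \<noteq> A" "z \<noteq> x" using neq[OF z] by auto
      moreover have "z \<noteq> B" "z \<noteq> C" using z ABC sym uniq calculation by metis+
      moreover have "z \<noteq> P0" "z \<noteq> Q0" using z Q0 sym uniq calculation by metis+
      moreover have "z \<noteq> Q1" "z \<noteq> Q2" using z P1 1 sym uniq calculation by metis+
      ultimately have "z = y" by auto
      then show False using z rest by blast
    qed
    ultimately show ?thesis by auto
  qed
  then obtain P2 where P2: "{P1,P2} = {x,y}" "P1 \<noteq> P2" using xy(2) by auto
  have UU: "U = {A,B,C,P0,P1,P2,Q0,Q1,Q2}" using Uxy P2 by auto
  have d9: "distinct [A,B,C,P0,P1,P2,Q0,Q1,Q2]" using d7 dxy P2 by (auto simp: doubleton_eq_iff)
  have PP: "T P0 P1 P2" by (rule pair[OF P2(1)])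
  have nd: "A \<noteq> B" "A \<noteq> C" "A \<noteq> P0" "A \<noteq> P1" "A \<noteq> P2" "A \<noteq> Q0" "A \<noteq> Q1" "A \<noteq> Q2"
    "B \<noteq> C" "B \<noteq> P0" "B \<noteq> P1" "B \<noteq> P2" "B \<noteq> Q0" "B \<noteq> Q1" "B \<noteq> Q2"
    "C \<noteq> P0" "C \<noteq> P1" "C \<noteq> P2" "C \<noteq> Q0" "C \<noteq> Q1" "C \<noteq> Q2"
    "P0 \<noteq> P1" "P0 \<noteq> P2" "P0 \<noteq> Q0" "P0 \<noteq> Q1" "P0 \<noteq> Q2" "P1 \<noteq> P2" "P1 \<noteq> Q0" "P1 \<noteq> Q1" "P1 \<noteq> Q2"
    "P2 \<noteq> Q0" "P2 \<noteq> Q1" "P2 \<noteq> Q2" "Q0 \<noteq> Q1" "Q0 \<noteq> Q2" "Q1 \<noteq> Q2" using d9 by auto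
  have cases9: "k = A \<or> k = B \<or> k = C \<or> k = P0 \<or> k = P1 \<or> k = P2 \<or> k = Q0 \<or> k = Q1 \<or> k = Q2" if "T i j k" for i j k
    using inU(3)[OF that] UU by auto
  have third: "\<exists>k. T i j k" if "i \<in> {A,B,C,P0,P1,P2,Q0,Q1,Q2}" "j \<in> {A,B,C,P0,P1,P2,Q0,Q1,Q2}" "i \<noteq> j" for i j
    using ex that UU by blast
  have A1: "T A P1 Q1" using sym P1 by metis
  have A2: "T A P2 Q2"
  proof -
    obtain z where z: "T A P2 z" using third[of A P2] nd by auto
    have "z \<noteq> A" "z \<noteq> P2" using neq[OF z] by auto
    moreover have "z \<noteq> B" "z \<noteq> C" using z ABC sym uniq nd by metis+
    moreover have "z \<noteq> P0" "z \<noteq> Q0" using z Q0 sym uniq nd by metis+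
    moreover have "z \<noteq> P1" "z \<noteq> Q1" using z A1 sym uniq nd by metis+
    ultimately show ?thesis using cases9[OF z] z by auto
  qed
  have B1: "T B P1 Q2"
  proof -
    obtain z where z: "T B P1 z" using third[of B P1] nd by auto
    have "z \<noteq> B" "z \<noteq> P1" using neq[OF z] by auto
    moreover have "z \<noteq> A" "z \<noteq> C" using z ABC sym uniq nd by metis+
    moreover have "z \<noteq> P0" "z \<noteq> P2" using z PP sym uniq nd by metis+
    moreover have "z \<noteq> Q1" using z Q1 sym uniq nd by metis
    moreover have "z \<noteq> Q0"
    proof
      \<comment> \<open>Then Q2 would be the only partner left for P2 in a block with B, but P2 and
        Q2 already lie in a block with A.\<close>
      assume z0: "z = Q0"
      obtain t where t: "T B P2 t" using third[of B P2] nd by auto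
      have "t \<noteq> B" "t \<noteq> P2" using neq[OF t] by auto
      moreover have "t \<noteq> A" "t \<noteq> C" using t ABC sym uniq nd by metis+
      moreover have "t \<noteq> P0" "t \<noteq> P1" using t PP sym uniq nd by metis+
      moreover have "t \<noteq> Q1" using t Q1 sym uniq nd by metis
      moreover have "t \<noteq> Q0" using t z z0 sym uniq nd by metis
      moreover have "t \<noteq> Q2" using t A2 sym uniq nd by metis
      ultimately show False using cases9[OF t] by auto
    qed
    ultimately show ?thesis using cases9[OF z] z by auto
  qed
  have B2: "T B P2 Q0"
  proof -
    obtain t where t: "T B P2 t" using third[of B P2] nd by auto
    have "t \<noteq> B" "t \<noteq> P2" using neq[OF t] by auto
    moreover have "t \<noteq> A" "t \<noteq> C" using t ABC sym uniq nd by metis+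
    moreover have "t \<noteq> P0" "t \<noteq> P1" using t PP sym uniq nd by metis+
    moreover have "t \<noteq> Q1" using t Q1 sym uniq nd by metis
    moreover have "t \<noteq> Q2" using t A2 sym uniq nd by metis
    ultimately show ?thesis using cases9[OF t] t by auto
  qed
  have C1: "T C P1 Q0"
  proof -
    obtain t where t: "T C P1 t" using third[of C P1] nd by auto
    have "t \<noteq> C" "t \<noteq> P1" using neq[OF t] by auto
    moreover have "t \<noteq> A" "t \<noteq> B" using t ABC sym uniq nd by metis+
    moreover have "t \<noteq> P0" "t \<noteq> P2" using t PP sym uniq nd by metis+
    moreover have "t \<noteq> Q1" using t A1 sym uniq nd by metis
    moreover have "t \<noteq> Q2" using t B1 sym uniq nd by metis
    ultimately show ?thesis using cases9[OF t] t by auto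
  qed
  have C2: "T C P2 Q1"
  proof -
    obtain t where t: "T C P2 t" using third[of C P2] nd by auto
    have "t \<noteq> C" "t \<noteq> P2" using neq[OF t] by auto
    moreover have "t \<noteq> A" "t \<noteq> B" using t ABC sym uniq nd by metis+
    moreover have "t \<noteq> P0" "t \<noteq> P1" using t PP sym uniq nd by metis+
    moreover have "t \<noteq> Q0" using t B2 sym uniq nd by metis
    moreover have "t \<noteq> Q2" using t A2 sym uniq nd by metis
    ultimately show ?thesis using cases9[OF t] t by auto
  qed
  have QQ: "T Q0 Q1 Q2"
  proof -
    obtain t where t: "T Q0 Q1 t" using third[of Q0 Q1] nd by auto
    have "t \<noteq> Q0" "t \<noteq> Q1" using neq[OF t] by auto
    moreover have "t \<noteq> A" "t \<noteq> P0" using t Q0 sym uniq nd by metis+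
    moreover have "t \<noteq> B" "t \<noteq> P2" using t B2 sym uniq nd by metis+
    moreover have "t \<noteq> C" "t \<noteq> P1" using t C1 sym uniq nd by metis+
    ultimately show ?thesis using cases9[OF t] t by auto
  qed
  show ?thesis by (rule that[OF UU d9 PP QQ Q0 A1 A2 Q1 B1 B2 Q2 C1 C2])
qed

section \<open>Parity of the number of nodes on a line\<close>

text \<open>The other d - 1 lines are partitioned by the point where they meet line i: a node takes
  one of them, a triple point two.\<close>

lemma line_block_count:
  assumes v: "distinct_lines d v" and o: "only_nodes_triple d v" and i: "i < d"
  obtains t where "d - 1 = card {B \<in> blocks d v. card B = 2 \<and> i \<in> B} + 2 * t"
proof -
  let ?S = "{B \<in> blocks d v. i \<in> B}"
  let ?N = "{B \<in> blocks d v. card B = 2 \<and> i \<in> B}" and ?T = "{B \<in> blocks d v. card B = 3 \<and> i \<in> B}"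
  have fin: "finite ?S" using finite_blocks by simp
  have blk: "B = block d v i j" if B: "B \<in> blocks d v" "i \<in> B" "j \<in> B" "i \<noteq> j" for B j
  proof -
    from B(1) obtain k l where kl: "B = block d v k l" "k < d" "l < d" "k \<noteq> l" by (auto simp: blocks_def)
    have "block d v i j = block d v k l" by (rule block_eq[OF v kl(2-4)]) (use B kl(1) in auto)
    then show ?thesis using kl(1) by simp
  qed
  have U: "{..<d} - {i} = (\<Union>B\<in>?S. B - {i})"
  proof (intro equalityI subsetI)
    fix j assume j: "j \<in> {..<d} - {i}"
    then have "block d v i j \<in> ?S" "j \<in> block d v i j - {i}" using i block_mem by (auto simp: blocks_def)
    then show "j \<in> (\<Union>B\<in>?S. B - {i})" by blast
  qed (auto simp: blocks_def block_def)
  have fB: "finite B" if "B \<in> blocks d v" for B using that by (auto simp: blocks_def)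
  have "d - 1 = card ({..<d} - {i})" using i by simp
  also have "\<dots> = (\<Sum>B\<in>?S. card (B - {i}))" unfolding U
  proof (rule card_UN_disjoint[OF fin])
    show "\<forall>B\<in>?S. finite (B - {i})" using fB by auto
    show "\<forall>B\<in>?S. \<forall>B'\<in>?S. B \<noteq> B' \<longrightarrow> (B - {i}) \<inter> (B' - {i}) = {}"
    proof (intro ballI impI equals0I)
      fix B B' j assume "B \<in> ?S" "B' \<in> ?S" "B \<noteq> B'" "j \<in> (B - {i}) \<inter> (B' - {i})"
      then show False using blk[of B j] blk[of B' j] by auto
    qed
  qed
  also have "?S = ?N \<union> ?T" using card_block[OF v o] by (auto simp: blocks_def)
  also have "(\<Sum>B\<in>?N \<union> ?T. card (B - {i})) = (\<Sum>B\<in>?N. card (B - {i})) + (\<Sum>B\<in>?T. card (B - {i}))"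
    by (rule sum.union_disjoint) (use finite_blocks in auto)
  also have "(\<Sum>B\<in>?N. card (B - {i})) = (\<Sum>B\<in>?N. 1)" by (rule sum.cong) (use fB in auto)
  also have "(\<Sum>B\<in>?T. card (B - {i})) = (\<Sum>B\<in>?T. 2)" by (rule sum.cong) (use fB in auto)
  finally show ?thesis using that[of "card ?T"] by simp
qed

text \<open>A simple graph with three edges and all degrees even is a triangle.\<close>

lemma three_pairs_even_degree:
  assumes N: "card N = 3" "\<And>B. B \<in> N \<Longrightarrow> card B = 2"
    and even: "\<And>i. i \<in> \<Union>N \<Longrightarrow> even (card {B \<in> N. i \<in> B})"
  obtains a b c where "a \<noteq> b" "a \<noteq> c" "b \<noteq> c" "N = {{a,b},{a,c},{b,c}}"
proof -
  obtain X Y Z where XYZ: "N = {X,Y,Z}" "X \<noteq> Y" "Y \<noteq> Z" "X \<noteq> Z" using N(1) unfolding card_3_iff by auto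
  \<comment> \<open>Every vertex lies on none or exactly two of the edges, so X is the symmetric
    difference of Y and Z.\<close>
  have sd: "i \<in> X \<longleftrightarrow> (i \<in> Y \<longleftrightarrow> i \<notin> Z)" for i
  proof (cases "i \<in> \<Union>N")
    case True
    have "{B \<in> N. i \<in> B} = (if i \<in> X then {X} else {}) \<union> (if i \<in> Y then {Y} else {}) \<union> (if i \<in> Z then {Z} else {})"
      using XYZ by auto
    with even[OF True] XYZ(2-4) show ?thesis by (auto split: if_splits)
  next
    case False
    then show ?thesis using XYZ by auto
  qed
  obtain p q where X: "X = {p,q}" "p \<noteq> q" using N(2)[of X] XYZ by (auto simp: card_2_iff)
  obtain r s where Y: "Y = {r,s}" "r \<noteq> s" using N(2)[of Y] XYZ by (auto simp: card_2_iff)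
  obtain t u where Z: "Z = {t,u}" "t \<noteq> u" using N(2)[of Z] XYZ by (auto simp: card_2_iff)
  have "\<exists>a b c. a \<noteq> b \<and> a \<noteq> c \<and> b \<noteq> c \<and> X = {a,b} \<and> Y = {a,c} \<and> Z = {b,c}"
    using sd[of p] sd[of q] sd[of r] sd[of s] sd[of t] sd[of u] XYZ(2-4) X(2) Y(2) Z(2) unfolding X Y Z
    by (auto simp: doubleton_eq_iff)
  then show ?thesis using that XYZ(1) by blast
qed

lemma det3_perm: "det3 u v w = 0 \<Longrightarrow> det3 v u w = 0" "det3 u v w = 0 \<Longrightarrow> det3 u w v = 0"
  by (simp_all add: det3_def algebra_simps)

text \<open>All three lines belong to the pencil spanned by a and b.\<close>

lemma det3_prop_difference:
  assumes "proportional (a - b) u" "proportional (a - scale3 s b) v" "proportional (a - scale3 t b) w"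
  shows "det3 u v w = 0"
proof -
  from assms obtain x y z where "u = scale3 x (a - b)" "v = scale3 y (a - scale3 s b)" "w = scale3 z (a - scale3 t b)"
    unfolding proportional_scale3 by blast
  then show ?thesis by (simp add: det3_def algebra_simps)
qed

lemma cube_difference_factor:
  assumes "w\<^sup>2 + w + 1 = 0"
  shows "(a - b) * (a - C3 w * b) * (a - C3 (w\<^sup>2) * b) = a ^ 3 - b ^ 3"
proof -
  have w2: "C3 (w\<^sup>2) = - 1 - C3 w" and ww: "C3 w * C3 w = - 1 - C3 w"
  proof -
    have "w\<^sup>2 = - 1 - w" using assms by algebra
    then have *: "C3 (w\<^sup>2) = C3 (- 1 - w)" by simp
    then show "C3 (w\<^sup>2) = - 1 - C3 w" by (simp only: C3_diff C3_uminus C3_1)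
    with * show "C3 w * C3 w = - 1 - C3 w" by (simp add: C3_mult[symmetric] power2_eq_square)
  qed
  show ?thesis unfolding w2 using ww by algebra
qed

text \<open>The triple $A, B, C$ is either a genuine triple point or a triangle of nodes; adding it to the
concurrent triples gives a Steiner triple system in both cases.\<close>
theorem nine_lines:
  assumes v: "distinct_lines 9 v" and o: "only_nodes_triple 9 v"
    and ABC: "A < 9" "B < 9" "C < 9" "A \<noteq> B" "A \<noteq> C" "B \<noteq> C"
    and H1: "\<And>i j l. i \<in> {A,B,C} \<Longrightarrow> j \<in> {A,B,C} \<Longrightarrow> i \<noteq> j \<Longrightarrow> l \<in> block 9 v i j \<Longrightarrow> l \<in> {A,B,C}"
    and H2: "\<And>i j. i < 9 \<Longrightarrow> j < 9 \<Longrightarrow> i \<noteq> j \<Longrightarrow> \<not> {i,j} \<subseteq> {A,B,C} \<Longrightarrow> card (block 9 v i j) = 3"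
  shows "det3 (v A) (v B) (v C) = 0"
    and "sat_jacobian (arrangement_poly 9 v) = jacobian_ideal (arrangement_poly 9 v)"
proof -
  define T where "T i j k \<longleftrightarrow> i < 9 \<and> j < 9 \<and> k < 9 \<and> i \<noteq> j \<and> i \<noteq> k \<and> j \<noteq> k \<and>
    (det3 (v i) (v j) (v k) = 0 \<or> {i,j,k} \<subseteq> {A,B,C})" for i j k
  have symT: "T j i k" "T i k j" if "T i j k" for i j k
    using that det3_perm[of "v i" "v j" "v k"] by (auto simp: T_def)
  have memT: "i \<in> {..<9}" "i \<noteq> j" if "T i j k" for i j k using that by (auto simp: T_def)
  have uniqT: "k = l" if kl: "T i j k" "T i j l" for i j k l
  proof (cases "{i,j} \<subseteq> {A,B,C}")
    case True
    then have "k \<in> {A,B,C}" "l \<in> {A,B,C}" using kl H1[of i j k] H1[of i j l] by (auto simp: T_def block_def)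
    then show ?thesis using True kl by (auto simp: T_def)
  next
    case False
    show ?thesis
    proof (rule ccontr)
      assume "k \<noteq> l"
      then have "card {i,j,k,l} = 4" using kl by (simp add: T_def)
      moreover have "{i,j,k,l} \<subseteq> block 9 v i j" using False kl by (auto simp: T_def block_def)
      then have "card {i,j,k,l} \<le> card (block 9 v i j)" by (intro card_mono) simp
      ultimately show False using card_block[OF v o, of i j] kl by (auto simp: T_def)
    qed
  qed
  have exT: "\<exists>k. T i j k" if ij: "i \<in> {..<9}" "j \<in> {..<9}" "i \<noteq> j" for i j
  proof (cases "{i,j} \<subseteq> {A,B,C}")
    case True
    then have "\<exists>k\<in>{A,B,C}. k \<noteq> i \<and> k \<noteq> j" using ABC by auto
    then show ?thesis using True ABC ij by (auto simp: T_def)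
  next
    case False
    then have c: "card (block 9 v i j) = 3" using H2 ij by auto
    have "\<not> block 9 v i j \<subseteq> {i,j}" using card_mono[of "{i,j}" "block 9 v i j"] c ij by auto
    then obtain k where "k \<in> block 9 v i j" "k \<noteq> i" "k \<noteq> j" by blast
    then show ?thesis using ij by (auto simp: T_def block_def intro!: exI[of _ k])
  qed
  have TABC: "T A B C" using ABC by (auto simp: T_def)
  have fc: "finite {..<9::nat}" "card {..<9::nat} = 9" by simp_all
  obtain P0 P1 P2 Q0 Q1 Q2 where U: "{..<9} = {A,B,C,P0,P1,P2,Q0,Q1,Q2}" and dist: "distinct [A,B,C,P0,P1,P2,Q0,Q1,Q2]"
    and Ts: "T P0 P1 P2" "T Q0 Q1 Q2" "T A P0 Q0" "T A P1 Q1" "T A P2 Q2"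
    "T B P0 Q1" "T B P1 Q2" "T B P2 Q0" "T C P0 Q2" "T C P1 Q0" "T C P2 Q1"
    by (rule steiner9_labelling[where U = "{..<9}" and T = T and A = A and B = B and C = C, OF fc symT memT uniqT exT TABC])
  have d: "det3 (v i) (v j) (v k) = 0" if "T i j k" "j \<notin> {A,B,C}" for i j k using that by (auto simp: T_def)
  have nd: "det3 (v i) (v j) (v k) \<noteq> 0" if "T i j l" "k < 9" "k \<noteq> i" "k \<noteq> j" "k \<noteq> l" for i j k l
    using that uniqT[of i j l k] by (auto simp: T_def)
  have lt: "P0 < 9" "P1 < 9" "P2 < 9" "Q0 < 9" "Q1 < 9" "Q2 < 9" using U by auto
  have np: "\<not> proportional (v i) (v j)" if "i < 9" "j < 9" "i \<noteq> j" for i j using distinct_linesD[OF v] that by auto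
  have nz: "v i \<noteq> 0" if "i < 9" for i using distinct_linesD[OF v] that by auto
  obtain w a b c where w: "w\<^sup>2 + w + 1 = 0" and D: "det3 a b c \<noteq> 0" and
    pr: "proportional (a - b) (v A)" "proportional (a - scale3 w b) (v B)" "proportional (a - scale3 (w\<^sup>2) b) (v C)"
    "proportional (b - c) (v P0)" "proportional (b - scale3 w c) (v P1)" "proportional (b - scale3 (w\<^sup>2) c) (v P2)"
    "proportional (c - a) (v Q0)" "proportional (c - scale3 (w\<^sup>2) a) (v Q1)" "proportional (c - scale3 w a) (v Q2)"
  proof (rule hesse_normal_form[of "v P0" "v P1" "v P2" "v Q0" "v Q1" "v Q2" "v A" "v B" "v C"])
    show "det3 (v P0) (v P1) (v Q0) \<noteq> 0" by (rule nd[OF Ts(1)]) (use dist lt in auto)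
    have "T P0 Q0 A" using Ts(3) symT by blast
    then show "det3 (v P0) (v Q0) (v Q1) \<noteq> 0" by (rule nd) (use dist lt in auto)
    have off: "i \<notin> {A,B,C}" if "i \<in> {P0,P1,P2,Q0,Q1,Q2}" for i using that dist by auto
    show "det3 (v P0) (v P1) (v P2) = 0" "det3 (v Q0) (v Q1) (v Q2) = 0"
      "det3 (v A) (v P0) (v Q0) = 0" "det3 (v A) (v P1) (v Q1) = 0" "det3 (v A) (v P2) (v Q2) = 0"
      "det3 (v B) (v P0) (v Q1) = 0" "det3 (v B) (v P1) (v Q2) = 0" "det3 (v B) (v P2) (v Q0) = 0"
      "det3 (v C) (v P0) (v Q2) = 0" "det3 (v C) (v P1) (v Q0) = 0"
      by (rule d, rule Ts, rule off, simp)+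
    show "\<not> proportional (v P0) (v P1)" "\<not> proportional (v P0) (v P2)" "\<not> proportional (v P1) (v P2)"
      "\<not> proportional (v Q0) (v Q1)" "\<not> proportional (v Q0) (v Q2)" "\<not> proportional (v Q1) (v Q2)"
      "\<not> proportional (v P0) (v A)"
      by (rule np; use dist lt ABC in auto)+
    show "v P0 \<noteq> 0" "v Q0 \<noteq> 0" "v B \<noteq> 0" by (rule nz, rule lt ABC)+
  qed (rule that; assumption)
  \<comment> \<open>This is where a triangle of nodes breaks down: the other triples put A, B, C
    into one pencil although their concurrency was never assumed.\<close>
  show "det3 (v A) (v B) (v C) = 0" by (rule det3_prop_difference[OF pr(1-3)])
  have sc: "\<exists>s. s \<noteq> 0 \<and> lin_form (v i) = C3 s * lin_form u" if "proportional u (v i)" "i < 9" for u i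
  proof -
    from that(1) obtain s where s: "v i = scale3 s u" unfolding proportional_scale3 by blast
    then have "s \<noteq> 0" using nz[OF that(2)] by (auto simp: vec3_eq_iff)
    then show ?thesis using s lin_form_scale by auto
  qed
  obtain s1 s2 s3 where s: "s1 \<noteq> 0" "s2 \<noteq> 0" "s3 \<noteq> 0" "lin_form (v A) = C3 s1 * lin_form (a - b)"
    "lin_form (v B) = C3 s2 * lin_form (a - scale3 w b)" "lin_form (v C) = C3 s3 * lin_form (a - scale3 (w\<^sup>2) b)"
    using sc[OF pr(1)] sc[OF pr(2)] sc[OF pr(3)] ABC by blast
  obtain t1 t2 t3 where t: "t1 \<noteq> 0" "t2 \<noteq> 0" "t3 \<noteq> 0" "lin_form (v P0) = C3 t1 * lin_form (b - c)"
    "lin_form (v P1) = C3 t2 * lin_form (b - scale3 w c)" "lin_form (v P2) = C3 t3 * lin_form (b - scale3 (w\<^sup>2) c)"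
    using sc[OF pr(4)] sc[OF pr(5)] sc[OF pr(6)] lt by blast
  obtain r1 r2 r3 where r: "r1 \<noteq> 0" "r2 \<noteq> 0" "r3 \<noteq> 0" "lin_form (v Q0) = C3 r1 * lin_form (c - a)"
    "lin_form (v Q1) = C3 r2 * lin_form (c - scale3 (w\<^sup>2) a)" "lin_form (v Q2) = C3 r3 * lin_form (c - scale3 w a)"
    using sc[OF pr(7)] sc[OF pr(8)] sc[OF pr(9)] lt by blast
  define k where "k = s1 * s2 * s3 * (t1 * t2 * t3) * (r1 * r2 * r3)"
  have ld: "lin_form (x - y) = lin_form x - lin_form y" for x y
    by (simp add: lin_form_eq C3_hom algebra_simps)
  have "(\<Prod>i<9. lin_form (v i)) = lin_form (v A) * lin_form (v B) * lin_form (v C) *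
      (lin_form (v P0) * lin_form (v P1) * lin_form (v P2)) * (lin_form (v Q0) * lin_form (v Q1) * lin_form (v Q2))"
    unfolding U using dist by (simp add: mult.assoc)
  also have "\<dots> = C3 k * ((lin_form (a - b) * lin_form (a - scale3 w b) * lin_form (a - scale3 (w\<^sup>2) b)) *
      (lin_form (b - c) * lin_form (b - scale3 w c) * lin_form (b - scale3 (w\<^sup>2) c)) *
      (lin_form (c - a) * lin_form (c - scale3 w a) * lin_form (c - scale3 (w\<^sup>2) a)))"
    unfolding s(4-6) t(4-6) r(4-6) k_def C3_mult by (simp only: ac_simps)
  also have "\<dots> = C3 k * ((lin_form a ^ 3 - lin_form b ^ 3) * (lin_form b ^ 3 - lin_form c ^ 3) * (lin_form c ^ 3 - lin_form a ^ 3))"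
    unfolding ld lin_form_scale cube_difference_factor[OF w] ..
  finally have prod: "(\<Prod>i<9. lin_form (v i)) = \<dots>" .
  show "sat_jacobian (arrangement_poly 9 v) = jacobian_ideal (arrangement_poly 9 v)"
    unfolding arrangement_poly_def
  proof (rule hesse_saturated[OF _ _ _ _ w D _ prod])
    show "k \<noteq> 0" using s t r by (simp add: k_def)
    fix i :: nat assume "i \<in> {..<9}"
    then show "\<exists>u\<in>hesse_lines w a b c. proportional u (v i)"
      unfolding U using pr by (auto simp: hesse_lines_def)
  qed (use nz np in \<open>auto simp: lessThan_empty_iff bot_nat_def\<close>)
qed

section \<open>Exclusion of at most three, of nine and of ten lines\<close>

theorem mainTheorem1:
  fixes d :: nat and v :: "nat \<Rightarrow> complex \<times> complex \<times> complex"
  assumes "distinct_lines d v"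
    and "only_nodes_triple d v"
    and "nearly_free (arrangement_poly d v)"
  shows "d \<in> {4,5,6,7,8}"
proof -
  note v = assms(1) and o = assms(2)
  have ns: "sat_jacobian (arrangement_poly d v) \<noteq> jacobian_ideal (arrangement_poly d v)"
    and nf: "\<And>k. dimN (arrangement_poly d v) k \<le> 1"
    using assms(3) unfolding nearly_free_def by blast+
  note bounds = degree_bound[OF v o nf]
  have no_nodes: "card (block d v i j) = 3" if "nodes_count d v = 0" "i < d" "j < d" "i \<noteq> j" for i j
  proof -
    have "{B \<in> blocks d v. card B = 2} = {}" using that(1) finite_blocks by (simp add: nodes_count_def)
    moreover have "block d v i j \<in> blocks d v" using that by (auto simp: blocks_def)
    ultimately show ?thesis using card_block[OF v o that(2-4)] by blast
  qed
  have "d > 3" using saturated_small[OF v] ns by force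
  moreover have "d \<noteq> 10"
  proof
    assume d: "d = 10"
    obtain t where "d - 1 = card {B \<in> blocks d v. card B = 2 \<and> 0 \<in> B} + 2 * t"
      using line_block_count[OF v o, of 0] d by auto
    moreover have "{B \<in> blocks d v. card B = 2} = {}"
      using bounds(2)[OF d] finite_blocks by (simp add: nodes_count_def)
    then have e: "{B \<in> blocks d v. card B = 2 \<and> 0 \<in> B} = {}" by blast
    ultimately have "9 = 2 * t" unfolding e using d by simp
    then show False by presburger
  qed
  moreover have "d \<noteq> 9"
  proof
    assume d: "d = 9"
    have v9: "distinct_lines 9 v" and o9: "only_nodes_triple 9 v" using v o d by simp_all
    from bounds(3)[OF d] show False
    proof
      assume n: "nodes_count d v = 0"
      have c: "card (block 9 v 0 1) = 3" using no_nodes[OF n, of 0 1] d by simp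
      have "card (block 9 v 0 1 - {0,1}) = 1"
        using c block_mem[of 0 9 v 1] block_mem[of 1 9 v 0] by (simp add: card_Diff_subset)
      then obtain C where C: "block 9 v 0 1 - {0,1} = {C}" by (auto simp: card_1_singleton_iff)
      have m: "0 \<in> block 9 v 0 1" "1 \<in> block 9 v 0 1" by (rule block_mem; simp)+
      have "C \<in> block 9 v 0 1 - {0,1}" unfolding C by simp
      then have "C \<noteq> 0" "C \<noteq> 1" by simp_all
      moreover have "block 9 v 0 1 = insert 0 (insert 1 (block 9 v 0 1 - {0,1}))" using m by fast
      then have "block 9 v 0 1 = {0,1,C}" unfolding C .
      ultimately have bl: "block 9 v 0 1 = {0,1,C}" "C \<noteq> 0" "C \<noteq> 1" by blast+
      have "C < 9" using C by (auto simp: block_def)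
      have "sat_jacobian (arrangement_poly 9 v) = jacobian_ideal (arrangement_poly 9 v)"
      proof (rule nine_lines(2)[OF v9 o9, of 0 1 C])
        fix i j l assume ij: "i \<in> {0,1,C}" "j \<in> {0,1,C}" "i \<noteq> j" "l \<in> block 9 v i j"
        have "block 9 v i j = block 9 v 0 1"
          by (rule block_eq[OF v9]) (use ij bl in auto)
        then show "l \<in> {0,1,C}" using ij bl by simp
      next
        show "card (block 9 v i j) = 3" if "i < 9" "j < 9" "i \<noteq> j" for i j
          using no_nodes[OF n] that d by simp
      qed (use bl \<open>C < 9\<close> in simp_all)
      then show False using ns d by simp
    next
      assume n: "nodes_count d v = 3"
      let ?N = "{B \<in> blocks 9 v. card B = 2}"
      have "even (card {B \<in> ?N. i \<in> B})" if "i \<in> \<Union>?N" for i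
      proof -
        have "i < 9" using that by (auto simp: blocks_def block_def)
        then obtain t where "9 - 1 = card {B \<in> blocks 9 v. card B = 2 \<and> i \<in> B} + 2 * t"
          using line_block_count[OF v9 o9] by blast
        moreover have "{B \<in> ?N. i \<in> B} = {B \<in> blocks 9 v. card B = 2 \<and> i \<in> B}" by auto
        moreover have "even c" if "9 - 1 = c + 2 * t" for c t :: nat using that by presburger
        ultimately show ?thesis by metis
      qed
      then obtain A B C where ABC: "A \<noteq> B" "A \<noteq> C" "B \<noteq> C" "?N = {{A,B},{A,C},{B,C}}"
      proof (rule three_pairs_even_degree[of ?N, rotated 2])
        show "card ?N = 3" using n d by (simp add: nodes_count_def)
      qed simp_all
      have lt: "A < 9" "B < 9" "C < 9"
      proof -
        have "{A,B} \<in> ?N" "{A,C} \<in> ?N" using ABC(4) by blast+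
        then show "A < 9" "B < 9" "C < 9" by (auto simp: blocks_def block_def)
      qed
      \<comment> \<open>Sides of the triangle meet in nodes, so the block of two sides contains no
        further line, in particular not the third side.\<close>
      have blk: "block 9 v i j = {i,j}" if "i \<in> {A,B,C}" "j \<in> {A,B,C}" "i \<noteq> j" for i j
      proof -
        have "{i,j} \<in> {{A,B},{A,C},{B,C}}" using that by (auto simp: insert_commute)
        then have "{i,j} \<in> blocks 9 v" unfolding ABC(4)[symmetric] by blast
        then obtain k l where kl: "{i,j} = block 9 v k l" "k < 9" "l < 9" "k \<noteq> l" by (auto simp: blocks_def)
        have "block 9 v i j = block 9 v k l" by (rule block_eq[OF v9 kl(2-4)]) (use that kl(1) in auto)
        then show ?thesis using kl(1) by simp
      qed
      have "det3 (v A) (v B) (v C) = 0"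
      proof (rule nine_lines(1)[OF v9 o9 lt ABC(1-3)])
        fix i j l assume "i \<in> {A,B,C}" "j \<in> {A,B,C}" "i \<noteq> j" "l \<in> block 9 v i j"
        then show "l \<in> {A,B,C}" using blk[of i j] by auto
      next
        fix i j :: nat assume ij: "i < 9" "j < 9" "i \<noteq> j" "\<not> {i,j} \<subseteq> {A,B,C}"
        show "card (block 9 v i j) = 3"
        proof (rule ccontr)
          assume "card (block 9 v i j) \<noteq> 3"
          then have "block 9 v i j \<in> ?N" using card_block[OF v9 o9 ij(1-3)] ij by (auto simp: blocks_def)
          then have "block 9 v i j \<subseteq> {A,B,C}" unfolding ABC(4) by auto
          moreover have "i \<in> block 9 v i j" "j \<in> block 9 v i j" using block_mem ij by auto
          ultimately show False using ij by blast
        qed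
      qed
      then have "C \<in> block 9 v A B" using lt by (simp add: block_def)
      then show False using blk[of A B] ABC by auto
    qed
  qed
  ultimately show ?thesis using bounds(1) by auto
qed

end
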